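(* The problem $3$-Fix-Promise is $\mathsf{NP}$-hard when restricted to the class of planar graphs.
   Context: All graphs are finite, simple and undirected. An $r$-coloring of a graph $G$ is any map $c:V(G)\to[r]$ (not necessarily proper); it is proper if adjacent vertices receive distinct colors; $\chi(G)$ is the chromatic number. A recoloring changes the color of one vertex. A swap between two distinct vertices $u,v$ assigns to $u$ the color of $v$ and to $v$ the color of $u$; a coloring $c$ is a permutation of a coloring $c_0$ if $c$ can be obtained from $c_0$ by finitely many swaps. $r$-Fix-Promise (for fixed $r$) is the promise problem: input a graph $G$, an $r$-coloring $c$ of $G$ and a positive integer $k$, with the promise that $\chi(G)=r$ and $c$ is a permutation of some optimal proper vertex-coloring of $G$; decide whether $c$ can be turned into a proper $r$-coloring of $G$ using at most $k$ recolorings. (An algorithm solves a promise problem if it answers correctly on all inputs satisfying the promise.) *)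

theory Defs
  imports
    "HOL-Analysis.Analysis"
    "HOL-Computational_Algebra.Polynomial"
    "Graph_Theory.Pair_Digraph"
begin

section \<open>Turing machines and polynomial time\<close>

text \<open>
  Deterministic multi-tape machines. States and tape symbols are initial segments of the natural
  numbers; state 0 is initial and state 1 is the halting state. Symbol 0 is the blank, symbols 1
  and 2 are the bits. Tapes are infinite in both directions. Tape 0 carries the input and
  tape 1 the output; on each tape the head starts on cell 0.
\<close>

record tm =
  tm_tapes :: nat
  tm_states :: nat
  tm_symbols :: nat
  tm_delta :: "nat \<Rightarrow> nat list \<Rightarrow> nat \<times> (nat \<times> int) list"

definition valid_tm :: "tm \<Rightarrow> bool" where
  "valid_tm M \<longleftrightarrow>
     tm_tapes M \<ge> 2 \<and> tm_states M \<ge> 2 \<and> tm_symbols M \<ge> 3 \<and>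
     (\<forall>q<tm_states M. \<forall>ss. length ss = tm_tapes M \<and> set ss \<subseteq> {..<tm_symbols M} \<longrightarrow>
        (case tm_delta M q ss of (q', as) \<Rightarrow>
           q' < tm_states M \<and> length as = tm_tapes M \<and>
           (\<forall>(a, d)\<in>set as. a < tm_symbols M \<and> d \<in> {-1, 0, 1})))"

text \<open>A tape is its contents together with the head position.\<close>

type_synonym tape = "(int \<Rightarrow> nat) \<times> int"
type_synonym tm_config = "nat \<times> tape list"

fun tape_read :: "tape \<Rightarrow> nat" where
  "tape_read (T, i) = T i"

fun tape_act :: "tape \<Rightarrow> nat \<times> int \<Rightarrow> tape" where
  "tape_act (T, i) (a, d) = (T(i := a), i + d)"

fun tm_step :: "tm \<Rightarrow> tm_config \<Rightarrow> tm_config" where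
  "tm_step M (q, ts) =
     (if q = 1 then (q, ts)
      else case tm_delta M q (map tape_read ts) of (q', as) \<Rightarrow> (q', map2 tape_act ts as))"

definition bit_symbol :: "bool \<Rightarrow> nat" where
  "bit_symbol b = (if b then 2 else 1)"

definition word_tape :: "bool list \<Rightarrow> tape" where
  "word_tape x =
     ((\<lambda>i. if 0 \<le> i \<and> i < int (length x) then bit_symbol (x ! nat i) else 0), 0)"

definition tm_init :: "tm \<Rightarrow> bool list \<Rightarrow> tm_config" where
  "tm_init M x = (0, word_tape x # replicate (tm_tapes M - 1) (word_tape []))"

text \<open>The output is the word on tape 1 from cell 0 up to the first blank.\<close>

definition tm_outputs_within :: "tm \<Rightarrow> bool list \<Rightarrow> nat \<Rightarrow> bool list \<Rightarrow> bool" where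
  "tm_outputs_within M x t y \<longleftrightarrow>
     (case (tm_step M ^^ t) (tm_init M x) of (q, ts) \<Rightarrow>
        q = 1 \<and> (\<forall>i<length y. fst (ts ! 1) (int i) = bit_symbol (y ! i)) \<and>
        fst (ts ! 1) (int (length y)) = 0)"

definition polytime_computable :: "(bool list \<Rightarrow> bool list) \<Rightarrow> bool" where
  "polytime_computable f \<longleftrightarrow>
     (\<exists>M (p :: nat poly). valid_tm M \<and>
        (\<forall>x. tm_outputs_within M x (poly p (length x)) (f x)))"


section \<open>NP and NP-hardness of promise problems\<close>

type_synonym language = "bool list set"

definition encode_pair :: "bool list \<Rightarrow> bool list \<Rightarrow> bool list" where
  "encode_pair x w = concat (map (\<lambda>b. [b, b]) x) @ [False, True] @ w"

definition NP :: "language set" where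
  "NP = {L. \<exists>V (p :: nat poly). polytime_computable V \<and>
           (\<forall>x. x \<in> L \<longleftrightarrow>
              (\<exists>w. length w \<le> poly p (length x) \<and> V (encode_pair x w) = [True]))}"

text \<open>The inputs that satisfy the promise are the yes-instances and the no-instances.\<close>

record promise_problem =
  yes_instances :: language
  no_instances :: language

definition NP_hard :: "promise_problem \<Rightarrow> bool" where
  "NP_hard P \<longleftrightarrow>
     (\<forall>L\<in>NP. \<exists>f. polytime_computable f \<and>
        (\<forall>x. (x \<in> L \<longrightarrow> f x \<in> yes_instances P) \<and> (x \<notin> L \<longrightarrow> f x \<in> no_instances P)))"


section \<open>Colorings\<close>

text \<open>
  A finite simple undirected graph is a \<^const>\<open>pair_graph\<close>: each edge is represented by its two
  orientations.
\<close>

definition colorings :: "'a pair_pre_digraph \<Rightarrow> nat \<Rightarrow> ('a \<Rightarrow> nat) set" where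
  "colorings G r = pverts G \<rightarrow>\<^sub>E {1..r}"

definition proper_coloring :: "'a pair_pre_digraph \<Rightarrow> nat \<Rightarrow> ('a \<Rightarrow> nat) \<Rightarrow> bool" where
  "proper_coloring G r c \<longleftrightarrow> c \<in> colorings G r \<and> (\<forall>(u, v)\<in>parcs G. c u \<noteq> c v)"

definition chromatic_number :: "'a pair_pre_digraph \<Rightarrow> nat" where
  "chromatic_number G = (LEAST r. \<exists>c. proper_coloring G r c)"

definition recoloring :: "'a pair_pre_digraph \<Rightarrow> nat \<Rightarrow> ('a \<Rightarrow> nat) \<Rightarrow> ('a \<Rightarrow> nat) \<Rightarrow> bool" where
  "recoloring G r c c' \<longleftrightarrow> (\<exists>v\<in>pverts G. \<exists>a\<in>{1..r}. a \<noteq> c v \<and> c' = c(v := a))"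

definition swap :: "'a pair_pre_digraph \<Rightarrow> ('a \<Rightarrow> nat) \<Rightarrow> ('a \<Rightarrow> nat) \<Rightarrow> bool" where
  "swap G c c' \<longleftrightarrow>
     (\<exists>u\<in>pverts G. \<exists>v\<in>pverts G. u \<noteq> v \<and> c' = c(u := c v, v := c u))"

definition permutation_of :: "'a pair_pre_digraph \<Rightarrow> ('a \<Rightarrow> nat) \<Rightarrow> ('a \<Rightarrow> nat) \<Rightarrow> bool" where
  "permutation_of G c c\<^sub>0 \<longleftrightarrow> (swap G)\<^sup>*\<^sup>* c\<^sub>0 c"

definition fixable :: "'a pair_pre_digraph \<Rightarrow> nat \<Rightarrow> ('a \<Rightarrow> nat) \<Rightarrow> nat \<Rightarrow> bool" where
  "fixable G r c k \<longleftrightarrow>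
     (\<exists>m\<le>k. \<exists>c'. (recoloring G r ^^ m) c c' \<and> proper_coloring G r c')"


section \<open>Planar graphs\<close>

text \<open>
  A planar drawing, with the complex numbers as the plane: vertices are distinct points, the edge
  \<open>{u, v}\<close> is a simple arc between its end vertices that meets no other vertex, and distinct edges
  meet only in common end vertices.
\<close>

definition planar_drawing ::
    "'a pair_pre_digraph \<Rightarrow> ('a \<Rightarrow> complex) \<Rightarrow> ('a set \<Rightarrow> real \<Rightarrow> complex) \<Rightarrow> bool" where
  "planar_drawing G \<phi> \<gamma> \<longleftrightarrow>
     inj_on \<phi> (pverts G) \<and>
     (\<forall>(u, v)\<in>parcs G.
        arc (\<gamma> {u, v}) \<and>
        {pathstart (\<gamma> {u, v}), pathfinish (\<gamma> {u, v})} = {\<phi> u, \<phi> v} \<and>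
        path_image (\<gamma> {u, v}) \<inter> \<phi> ` pverts G = {\<phi> u, \<phi> v}) \<and>
     (\<forall>(u, v)\<in>parcs G. \<forall>(u', v')\<in>parcs G. {u, v} \<noteq> {u', v'} \<longrightarrow>
        path_image (\<gamma> {u, v}) \<inter> path_image (\<gamma> {u', v'}) \<subseteq> \<phi> ` ({u, v} \<inter> {u', v'}))"

definition planar :: "'a pair_pre_digraph \<Rightarrow> bool" where
  "planar G \<longleftrightarrow> (\<exists>\<phi> \<gamma>. planar_drawing G \<phi> \<gamma>)"


section \<open>The problem Fix-Promise\<close>

text \<open>Binary representation, least significant bit first.\<close>

fun binary_word :: "nat \<Rightarrow> bool list" where
  "binary_word k = (if k = 0 then [] else odd k # binary_word (k div 2))"

declare binary_word.simps [simp del]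

text \<open>
  Input graphs have vertex set \<open>{..<n}\<close>. An instance is written as \<open>n\<close> in unary, the rows of the
  adjacency matrix, the colors of the vertices in unary, and \<open>k\<close> in binary.
\<close>

definition encode_instance :: "nat pair_pre_digraph \<Rightarrow> (nat \<Rightarrow> nat) \<Rightarrow> nat \<Rightarrow> bool list" where
  "encode_instance G c k =
     (let n = card (pverts G) in
        replicate n True @ [False] @
        concat (map (\<lambda>u. map (\<lambda>v. (u, v) \<in> parcs G) [0..<n]) [0..<n]) @
        concat (map (\<lambda>v. replicate (c v) True @ [False]) [0..<n]) @
        binary_word k)"

definition fix_instance :: "nat \<Rightarrow> nat pair_pre_digraph \<Rightarrow> (nat \<Rightarrow> nat) \<Rightarrow> nat \<Rightarrow> bool" where
  "fix_instance r G c k \<longleftrightarrow>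
     pair_graph G \<and> (\<exists>n. pverts G = {..<n}) \<and> c \<in> colorings G r \<and> k > 0"

definition fix_promise :: "nat \<Rightarrow> 'a pair_pre_digraph \<Rightarrow> ('a \<Rightarrow> nat) \<Rightarrow> bool" where
  "fix_promise r G c \<longleftrightarrow>
     chromatic_number G = r \<and>
     (\<exists>c\<^sub>0. proper_coloring G (chromatic_number G) c\<^sub>0 \<and> permutation_of G c c\<^sub>0)"

definition Fix_Promise :: "nat \<Rightarrow> nat pair_pre_digraph set \<Rightarrow> promise_problem" where
  "Fix_Promise r \<G> =
     \<lparr>yes_instances = {encode_instance G c k | G c k.
        fix_instance r G c k \<and> G \<in> \<G> \<and> fix_promise r G c \<and> fixable G r c k},
      no_instances = {encode_instance G c k | G c k.
        fix_instance r G c k \<and> G \<in> \<G> \<and> fix_promise r G c \<and> \<not> fixable G r c k}\<rparr>"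

end

theory Submission
  imports Defs
begin

text \<open>
  The computation of an NP verifier is a tableau, that is, a labeling of a rectangle in which
  neighboring labels are compatible. Replacing every label by a bundle of boolean wires turns the
  tableau into a rectangle of tiles of seven kinds, and every tile into a piece of a grid graph in
  which some vertices have a prescribed and some a forbidden color; planarity is free, because
  crossing wires are one of the tile kinds.

  Prescribed and forbidden colors are enforced by the budget. The given coloring puts color \<open>a\<close> on a
  vertex and on one or two pendant neighbors of it, so that at least one recoloring is needed there.
  If the budget is the number of vertices with pendant neighbors, exactly one recoloring is
  available at each of them and none elsewhere: a vertex without pendant neighbors keeps its color,
  one with two pendant neighbors must itself abandon \<open>a\<close>, and one with a single pendant neighbor may
  end with any color. The promise is cheap: the grid is bipartite, a triangle at every
  vertex makes the chromatic number 3, and three isolated vertices of distinct colors at every vertex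
  allow the swaps that lead to the given coloring from a proper one.

  The reduction is written in a small loop language whose programs are simulated by multi-tape
  machines with constant overhead per step.
\<close>

section \<open>Row-major indices\<close>

lemma row_major_less:
  fixes i j m n :: nat
  assumes "i < m" "j < n"
  shows "i * n + j < m * n"
proof -
  have "i * n + j < Suc i * n" using assms(2) by simp
  also have "\<dots> \<le> m * n" using assms(1) by (intro mult_le_mono1) simp
  finally show ?thesis .
qed

lemma row_major_div_mod:
  fixes i j n :: nat
  assumes "j < n"
  shows "(i * n + j) div n = i" "(i * n + j) mod n = j"
  using assms by simp_all

lemma row_major_cases:
  fixes g m n :: nat
  assumes "g < m * n"
  obtains i j where "i < m" "j < n" "g = i * n + j"
proof
  show "g div n < m" using assms by (rule less_mult_imp_div_less)
  show "g mod n < n" using assms by (cases n) auto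
  show "g = g div n * n + g mod n" by simp
qed

lemma row_major_Suc_eq:
  fixes i j m n :: nat
  assumes "j < n"
  shows "Suc (i * n + j) = m * n \<longleftrightarrow> Suc i = m \<and> Suc j = n"
proof
  assume eq: "Suc (i * n + j) = m * n"
  have "Suc j = n"
  proof (rule ccontr)
    assume "Suc j \<noteq> n"
    then have "Suc j < n" using assms by simp
    from row_major_div_mod(2)[OF this, of i] eq show False by simp
  qed
  then have "Suc i * n = m * n" using eq by simp
  then show "Suc i = m \<and> Suc j = n" using \<open>Suc j = n\<close> assms by (simp only: mult_cancel2) simp
qed auto

section \<open>Recoloring and swapping\<close>

definition changed :: "'a pair_pre_digraph \<Rightarrow> ('a \<Rightarrow> nat) \<Rightarrow> ('a \<Rightarrow> nat) \<Rightarrow> 'a set" where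
  "changed G c c' = {v \<in> pverts G. c v \<noteq> c' v}"

lemma card_changed_le:
  assumes "(recoloring G r ^^ m) c c'" "finite (pverts G)"
  shows "card (changed G c c') \<le> m"
  using assms(1)
proof (induction m arbitrary: c')
  case 0
  then show ?case by (simp add: changed_def)
next
  case (Suc m)
  from Suc.prems obtain d where d: "(recoloring G r ^^ m) c d" "recoloring G r d c'"
    by (rule relpowp_Suc_E)
  from d(2) obtain w a where "c' = d(w := a)" unfolding recoloring_def by blast
  then have "changed G c c' \<subseteq> insert w (changed G c d)" by (auto simp: changed_def)
  then have "card (changed G c c') \<le> card (insert w (changed G c d))"
    using assms(2) by (intro card_mono) (auto simp: changed_def)
  also have "\<dots> \<le> Suc (card (changed G c d))" by (rule card_insert_le_m1) simp_all
  also have "\<dots> \<le> Suc m" using Suc.IH[OF d(1)] by simp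
  finally show ?case .
qed

lemma recoloring_card_changed:
  assumes "finite (pverts G)" "c \<in> colorings G r" "c' \<in> colorings G r"
  shows "(recoloring G r ^^ card (changed G c c')) c c'"
  using assms(2)
proof (induction "card (changed G c c')" arbitrary: c)
  case 0
  then have "changed G c c' = {}" using assms(1) by (auto simp: changed_def)
  then have "c = c'"
    using 0(2) assms(3) unfolding colorings_def changed_def
    by (intro PiE_ext[of c "pverts G" "\<lambda>_. {1..r}" c']) auto
  then show ?case by (simp add: changed_def)
next
  case (Suc m)
  then have "changed G c c' \<noteq> {}" by (metis card.empty nat.distinct(1))
  then obtain w where w: "w \<in> pverts G" "c w \<noteq> c' w" unfolding changed_def by blast
  let ?d = "c(w := c' w)"
  have target: "c' w \<in> {1..r}"
    using w(1) assms(3) unfolding colorings_def by (rule PiE_mem[rotated])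
  have coloring: "?d \<in> colorings G r"
    using Suc.prems w(1) target unfolding colorings_def by (auto simp: PiE_def Pi_def extensional_def)
  have "changed G c c' = insert w (changed G ?d c')" "w \<notin> changed G ?d c'"
    using w by (auto simp: changed_def)
  then have m: "m = card (changed G ?d c')"
    using Suc.hyps(2) assms(1) by (simp add: changed_def)
  have "(recoloring G r ^^ m) ?d c'" unfolding m by (rule Suc.hyps(1)[OF m coloring])
  moreover have "recoloring G r c ?d" unfolding recoloring_def using w target by force
  ultimately have "(recoloring G r ^^ Suc m) c c'" by (meson relpowp_Suc_I2)
  then show ?case unfolding Suc.hyps(2) .
qed

lemma fixable_iff_card_changed:
  assumes "finite (pverts G)" "c \<in> colorings G r"
  shows "fixable G r c k \<longleftrightarrow> (\<exists>c'. proper_coloring G r c' \<and> card (changed G c c') \<le> k)"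
proof
  assume "fixable G r c k"
  then obtain m c' where "m \<le> k" "(recoloring G r ^^ m) c c'" "proper_coloring G r c'"
    unfolding fixable_def by blast
  then show "\<exists>c'. proper_coloring G r c' \<and> card (changed G c c') \<le> k"
    using card_changed_le[OF _ assms(1)] le_trans by blast
next
  assume "\<exists>c'. proper_coloring G r c' \<and> card (changed G c c') \<le> k"
  then obtain c' where c': "proper_coloring G r c'" "card (changed G c c') \<le> k" by blast
  then have "c' \<in> colorings G r" unfolding proper_coloring_def by blast
  from recoloring_card_changed[OF assms this] c' show "fixable G r c k"
    unfolding fixable_def by blast
qed

lemma permutation_of_comp_permutes:
  assumes "p permutes pverts G" "finite (pverts G)"
  shows "permutation_of G c (c \<circ> p)"
  unfolding permutation_of_def using assms
proof (induction p arbitrary: c rule: permutes_induct)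
  case id
  then show ?case by simp
next
  case (swap a b p)
  let ?d = "c \<circ> Transposition.transpose a b"
  have "(Defs.swap G)\<^sup>*\<^sup>* (?d \<circ> p) ?d" by (rule swap.IH)
  also have "(Defs.swap G)\<^sup>*\<^sup>* ?d c"
  proof (cases "a = b")
    case False
    have "c = ?d(a := ?d b, b := ?d a)" by (auto simp: fun_eq_iff Transposition.transpose_def)
    then have "Defs.swap G ?d c" unfolding swap_def using swap.hyps False by blast
    then show ?thesis by blast
  qed simp
  finally show ?case by (simp only: comp_assoc)
qed

section \<open>The graph of a picture\<close>

text \<open>
  Site number \<open>g\<close> of a picture becomes the vertices \<open>9 g + s\<close> with \<open>s < 9\<close>: slot 0 is the vertex of
  the grid, slots 1 and 2 are its pendant neighbors (of which the first \<open>pendants\<close> are joined to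
  it), slots 3 to 5 form the triangle and slots 6 to 8 are the isolated vertices.
\<close>

record site =
  site_color :: nat
  pendants :: nat
  right_edge :: bool
  down_edge :: bool

definition allowed :: "nat \<Rightarrow> nat \<Rightarrow> nat \<Rightarrow> bool" where
  "allowed a l x \<longleftrightarrow> x \<in> {1, 2, 3} \<and> (l = 0 \<longrightarrow> x = a) \<and> (l = 2 \<longrightarrow> x \<noteq> a)"

definition list_coloring ::
    "nat \<Rightarrow> nat \<Rightarrow> (nat \<Rightarrow> nat \<Rightarrow> site) \<Rightarrow> (nat \<Rightarrow> nat \<Rightarrow> nat) \<Rightarrow> bool" where
  "list_coloring m n S f \<longleftrightarrow> (\<forall>i<m. \<forall>j<n.
     allowed (site_color (S i j)) (pendants (S i j)) (f i j) \<and>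
     (right_edge (S i j) \<longrightarrow> f i j \<noteq> f i (Suc j)) \<and> (down_edge (S i j) \<longrightarrow> f i j \<noteq> f (Suc i) j))"

definition slot_edges :: "nat \<Rightarrow> (nat \<times> nat) set" where
  "slot_edges l = {(0, t) |t. t \<in> {1, 2} \<and> t \<le> l} \<union> {(3, 4), (3, 5), (4, 5)}"

definition slot_adj :: "nat \<Rightarrow> nat \<Rightarrow> nat \<Rightarrow> bool" where
  "slot_adj l s t \<longleftrightarrow> (s, t) \<in> slot_edges l \<or> (t, s) \<in> slot_edges l"

definition slot_color :: "site \<Rightarrow> nat \<Rightarrow> nat" where
  "slot_color x s = (if s < 3 then site_color x else if s < 6 then s - 2 else s - 5)"

lemma slot_edges_2: "slot_edges 2 = {(0, 1), (0, 2), (3, 4), (3, 5), (4, 5)}"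
  by (auto simp: slot_edges_def)

lemma slot_edges_subset: "slot_edges l \<subseteq> slot_edges 2"
  by (auto simp: slot_edges_def)

lemma slot_adj_imp_slot_edges:
  assumes "slot_adj l s t"
  shows "(s, t) \<in> slot_edges 2 \<or> (t, s) \<in> slot_edges 2"
  using assms slot_edges_subset unfolding slot_adj_def by blast

lemma slot_adj_less:
  assumes "slot_adj l s t"
  shows "s < 9" "t < 9"
  using slot_adj_imp_slot_edges[OF assms] by (auto simp: slot_edges_2)

lemma slot_adj_sym: "slot_adj l s t \<Longrightarrow> slot_adj l t s"
  unfolding slot_adj_def by blast

lemma slot_adj_irrefl: "\<not> slot_adj l s s"
  unfolding slot_adj_def slot_edges_def by auto

locale picture =
  fixes m n :: nat and S :: "nat \<Rightarrow> nat \<Rightarrow> site"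
  assumes m_pos: "0 < m" and n_pos: "0 < n"
    and site_color_range: "\<And>i j. site_color (S i j) \<in> {1, 2, 3}"
    and pendants_le: "\<And>i j. pendants (S i j) \<le> 2"
    and right_edge_inside: "\<And>i j. j < n \<Longrightarrow> right_edge (S i j) \<Longrightarrow> Suc j < n"
    and down_edge_inside: "\<And>i j. i < m \<Longrightarrow> down_edge (S i j) \<Longrightarrow> Suc i < m"
begin

definition site_at :: "nat \<Rightarrow> site" where
  "site_at g = S (g div n) (g mod n)"

definition link :: "nat \<Rightarrow> nat \<Rightarrow> bool" where
  "link g h \<longleftrightarrow> (right_edge (site_at g) \<and> h = g + 1) \<or> (down_edge (site_at g) \<and> h = g + n)"

definition adj :: "nat \<Rightarrow> nat \<Rightarrow> bool" where
  "adj u v \<longleftrightarrow> (u div 9 = v div 9 \<and> slot_adj (pendants (site_at (u div 9))) (u mod 9) (v mod 9)) \<or>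
     (u mod 9 = 0 \<and> v mod 9 = 0 \<and> (link (u div 9) (v div 9) \<or> link (v div 9) (u div 9)))"

definition graph :: "nat pair_pre_digraph" where
  "graph = \<lparr>pverts = {..<m * n * 9},
     parcs = {(u, v). u < m * n * 9 \<and> v < m * n * 9 \<and> adj u v}\<rparr>"

definition slot_coloring :: "(nat \<Rightarrow> nat \<Rightarrow> nat) \<Rightarrow> nat \<Rightarrow> nat" where
  "slot_coloring F u = (if u < m * n * 9 then F (u div 9) (u mod 9) else undefined)"

definition given_coloring :: "nat \<Rightarrow> nat" where
  "given_coloring = slot_coloring (\<lambda>g. slot_color (site_at g))"

definition budget :: nat where
  "budget = card {g. g < m * n \<and> 1 \<le> pendants (site_at g)}"

lemma pverts_graph [simp]: "pverts graph = {..<m * n * 9}"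
  by (simp add: graph_def)

lemma parcs_graph: "(u, v) \<in> parcs graph \<longleftrightarrow> u < m * n * 9 \<and> v < m * n * 9 \<and> adj u v"
  by (simp add: graph_def)

lemma site_color_site_at: "site_color (site_at g) \<in> {1, 2, 3}"
  unfolding site_at_def by (rule site_color_range)

lemma pendants_site_at: "pendants (site_at g) \<le> 2"
  unfolding site_at_def by (rule pendants_le)

lemma site_at_row_major: "j < n \<Longrightarrow> site_at (i * n + j) = S i j"
  by (simp add: site_at_def)

lemma adj_vertices:
  assumes "s < 9" "t < 9"
  shows "adj (g * 9 + s) (h * 9 + t) \<longleftrightarrow>
    g = h \<and> slot_adj (pendants (site_at g)) s t \<or> s = 0 \<and> t = 0 \<and> (link g h \<or> link h g)"
  using assms by (simp add: adj_def)

lemma adj_cases: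
  assumes "adj u v"
  obtains (slot) g s t where "u = g * 9 + s" "v = g * 9 + t" "slot_adj (pendants (site_at g)) s t"
    | (link) g h where "u = g * 9" "v = h * 9" "link g h"
    | (link_back) g h where "u = g * 9" "v = h * 9" "link h g"
proof -
  consider (same_site) "u div 9 = v div 9" "slot_adj (pendants (site_at (u div 9))) (u mod 9) (v mod 9)"
    | (linked) "u = u div 9 * 9" "v = v div 9 * 9" "link (u div 9) (v div 9) \<or> link (v div 9) (u div 9)"
    using assms unfolding adj_def by fastforce
  then show thesis
  proof cases
    case same_site
    then have "v = u div 9 * 9 + v mod 9" by simp
    then show thesis using slot[of "u div 9" "u mod 9" "v mod 9"] same_site(2) by simp
  next
    case linked
    then show thesis using link link_back by blast
  qed
qed

lemma adj_sym: "adj u v \<Longrightarrow> adj v u"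
  unfolding adj_def using slot_adj_sym by metis

lemma adj_irrefl: "\<not> adj u u"
  using n_pos by (auto simp: adj_def link_def slot_adj_irrefl)

lemma pair_graph_graph: "pair_graph graph"
proof -
  have finite: "finite (parcs graph)"
    by (rule finite_subset[of _ "{..<m * n * 9} \<times> {..<m * n * 9}"]) (auto simp: graph_def)
  have "symmetric (with_proj graph)"
    unfolding symmetric_def by (rule symI) (use adj_sym in \<open>simp add: parcs_graph\<close>)
  then show ?thesis
    by unfold_locales (use finite adj_irrefl in \<open>auto simp: parcs_graph\<close>)
qed

lemma link_cases:
  assumes "g < m * n" "link g h"
  obtains (right) i j where "i < m" "Suc j < n" "g = i * n + j" "h = i * n + Suc j" "right_edge (S i j)"
    | (down) i j where "Suc i < m" "j < n" "g = i * n + j" "h = Suc i * n + j" "down_edge (S i j)"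
proof -
  obtain i j where ij: "i < m" "j < n" and g: "g = i * n + j"
    using assms(1) by (rule row_major_cases)
  consider (right_link) "right_edge (S i j)" "h = g + 1" | (down_link) "down_edge (S i j)" "h = g + n"
    using assms(2) unfolding link_def g site_at_row_major[OF ij(2)] by blast
  then show thesis
  proof cases
    case right_link
    then show thesis using right[of i j] right_edge_inside[OF ij(2)] ij g by simp
  next
    case down_link
    then show thesis using down[of i j] down_edge_inside[OF ij(1)] ij g by simp
  qed
qed

lemma link_less: "g < m * n \<Longrightarrow> link g h \<Longrightarrow> h < m * n"
  by (erule (1) link_cases) (simp_all only: row_major_less Suc_lessD)

lemma slot_coloring_vertex: "g < m * n \<Longrightarrow> s < 9 \<Longrightarrow> slot_coloring F (g * 9 + s) = F g s"
  by (simp add: slot_coloring_def)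

lemma slot_coloring_colorings:
  assumes "\<And>g s. g < m * n \<Longrightarrow> s < 9 \<Longrightarrow> F g s \<in> {1..r}"
  shows "slot_coloring F \<in> colorings graph r"
  using assms unfolding colorings_def
  by (auto simp: slot_coloring_def PiE_def extensional_def less_mult_imp_div_less)

lemma slot_color_site_at: "s < 9 \<Longrightarrow> slot_color (site_at g) s \<in> {1..3}"
  using site_color_site_at[of g] by (auto simp: slot_color_def)

lemma given_coloring_colorings: "given_coloring \<in> colorings graph 3"
  unfolding given_coloring_def by (rule slot_coloring_colorings[OF slot_color_site_at])

lemma proper_slot_coloringI:
  assumes "\<And>g s. g < m * n \<Longrightarrow> s < 9 \<Longrightarrow> F g s \<in> {1..r}"
    and slots: "\<And>g s t. g < m * n \<Longrightarrow> slot_adj (pendants (site_at g)) s t \<Longrightarrow> F g s \<noteq> F g t"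
    and links: "\<And>g h. g < m * n \<Longrightarrow> link g h \<Longrightarrow> F g 0 \<noteq> F h 0"
  shows "proper_coloring graph r (slot_coloring F)"
proof -
  have "slot_coloring F u \<noteq> slot_coloring F v" if "(u, v) \<in> parcs graph" for u v
  proof -
    from that have bounds: "u < m * n * 9" "v < m * n * 9" and "adj u v" by (simp_all add: parcs_graph)
    from \<open>adj u v\<close> show ?thesis
    proof (cases rule: adj_cases)
      case (slot g s t)
      then show ?thesis
        using bounds slots[of g s t] slot_adj_less[OF slot(3)] by (simp add: slot_coloring_def)
    next
      case (link g h)
      then show ?thesis using bounds links[of g h] by (simp add: slot_coloring_def)
    next
      case (link_back g h)
      then show ?thesis using bounds links[of h g] by (simp add: slot_coloring_def)
    qed
  qed
  then show ?thesis
    unfolding proper_coloring_def using slot_coloring_colorings[of F r, OF assms(1)] by blast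
qed

lemma proper_coloring_graphD:
  assumes "proper_coloring graph r c" "g < m * n"
  shows "s < 9 \<Longrightarrow> c (g * 9 + s) \<in> {1..r}"
    and "slot_adj (pendants (site_at g)) s t \<Longrightarrow> c (g * 9 + s) \<noteq> c (g * 9 + t)"
    and "link g h \<Longrightarrow> c (g * 9) \<noteq> c (h * 9)"
proof -
  have edge: "c u \<noteq> c v" if "u < m * n * 9" "v < m * n * 9" "adj u v" for u v
    using assms(1) that parcs_graph unfolding proper_coloring_def by blast
  have vertex: "g * 9 + s < m * n * 9" if "s < 9" for s
    using assms(2) that by (rule row_major_less)
  show "c (g * 9 + s) \<in> {1..r}" if "s < 9"
    using assms(1) vertex[OF that] unfolding proper_coloring_def colorings_def by (auto dest: PiE_mem)
  show "c (g * 9 + s) \<noteq> c (g * 9 + t)" if adj: "slot_adj (pendants (site_at g)) s t"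
    using adj slot_adj_less[OF adj] by (intro edge vertex) (simp_all add: adj_vertices)
  show "c (g * 9) \<noteq> c (h * 9)" if link: "link g h"
    using link_less[OF assms(2) link] assms(2) adj_vertices[of 0 0 g h] link by (intro edge) simp_all
qed

subsection \<open>The promise\<close>

text \<open>
  In a proper coloring of checkerboard type slot 0 gets color \<open>x\<close>. If the given color \<open>a\<close> differs from
  \<open>x\<close>, exchanging slot 0 with the isolated vertex of color \<open>x\<close> suffices; if it agrees, the pendant
  neighbors are exchanged with the isolated vertices of the two other colors.
\<close>

definition slot_perm :: "nat \<Rightarrow> nat \<Rightarrow> nat \<Rightarrow> nat" where
  "slot_perm a x =
     (if x \<noteq> a then Transposition.transpose 0 (5 + x)
      else Transposition.transpose 1 (5 + (if a = 1 then 2 else 1)) \<circ>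
        Transposition.transpose 2 (5 + (if a = 3 then 2 else 3)))"

definition checkerboard :: "nat \<Rightarrow> nat" where
  "checkerboard g = 1 + (g div n + g mod n) mod 2"

definition site_perm :: "nat \<Rightarrow> nat \<Rightarrow> nat" where
  "site_perm g = slot_perm (site_color (site_at g)) (checkerboard g)"

definition vertex_perm :: "nat \<Rightarrow> nat" where
  "vertex_perm u = (if u < m * n * 9 then u div 9 * 9 + site_perm (u div 9) (u mod 9) else u)"

lemma checkerboard_range: "checkerboard g \<in> {1, 2}"
  unfolding checkerboard_def by auto

lemma slot_perm_involution:
  assumes "a \<in> {1, 2, 3}" "x \<in> {1, 2}" "s < 9"
  shows "slot_perm a x s < 9" "slot_perm a x (slot_perm a x s) = s"
  using assms
  by (elim insertE emptyE; simp add: slot_perm_def Transposition.transpose_def split del: if_split;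
      simp split: if_splits)+

lemma slot_color_slot_perm:
  assumes "site_color y \<in> {1, 2, 3}" "x \<in> {1, 2}"
  shows "slot_color y (slot_perm (site_color y) x 0) = x"
    and "slot_adj l s t \<Longrightarrow>
      slot_color y (slot_perm (site_color y) x s) \<noteq> slot_color y (slot_perm (site_color y) x t)"
proof -
  show "slot_color y (slot_perm (site_color y) x 0) = x"
    using assms by (auto simp: slot_color_def slot_perm_def Transposition.transpose_def)
  assume "slot_adj l s t"
  moreover have "slot_color y (slot_perm (site_color y) x s) \<noteq> slot_color y (slot_perm (site_color y) x t)"
    if "(s, t) \<in> slot_edges 2" for s t
    using assms that unfolding slot_edges_2
    by (elim insertE emptyE Pair_inject) (simp_all add: slot_color_def slot_perm_def Transposition.transpose_def)
  ultimately show "slot_color y (slot_perm (site_color y) x s) \<noteq> slot_color y (slot_perm (site_color y) x t)"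
    using slot_adj_imp_slot_edges by metis
qed

lemma site_perm_involution:
  assumes "s < 9"
  shows "site_perm g s < 9" "site_perm g (site_perm g s) = s"
  unfolding site_perm_def
  using slot_perm_involution[OF site_color_site_at checkerboard_range assms] by blast+

lemma slot_color_site_perm:
  "slot_color (site_at g) (site_perm g 0) = checkerboard g"
  "slot_adj l s t \<Longrightarrow> slot_color (site_at g) (site_perm g s) \<noteq> slot_color (site_at g) (site_perm g t)"
  unfolding site_perm_def
  using slot_color_slot_perm[OF site_color_site_at checkerboard_range] by blast+

lemma vertex_perm_vertex:
  assumes "g < m * n" "s < 9"
  shows "vertex_perm (g * 9 + s) = g * 9 + site_perm g s"
  using row_major_less[OF assms] assms(2) by (simp add: vertex_perm_def)

lemma vertex_perm_permutes: "vertex_perm permutes pverts graph"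
proof (rule bij_imp_permutes)
  have "vertex_perm u < m * n * 9 \<and> vertex_perm (vertex_perm u) = u"
    if u: "u < m * n * 9" for u
  proof -
    obtain g s where g: "g < m * n" "s < 9" "u = g * 9 + s" using u by (rule row_major_cases)
    then show ?thesis
      using row_major_less[OF g(1) site_perm_involution(1)[OF g(2)]]
      by (simp add: vertex_perm_vertex site_perm_involution)
  qed
  then show "bij_betw vertex_perm (pverts graph) (pverts graph)"
    by (intro bij_betw_byWitness[of _ vertex_perm]) auto
qed (simp add: vertex_perm_def)

lemma checkerboard_link:
  assumes "g < m * n" "link g h"
  shows "checkerboard g \<noteq> checkerboard h"
proof -
  have "h div n + h mod n = Suc (g div n + g mod n)"
    using assms
  proof (cases rule: link_cases)
    case (right i j)
    then show ?thesis using row_major_div_mod[of "Suc j" n i] by simp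
  next
    case (down i j)
    then show ?thesis using row_major_div_mod[of j n "Suc i"] by simp
  qed
  moreover have "Suc k mod 2 \<noteq> k mod 2" for k :: nat by presburger
  ultimately show ?thesis unfolding checkerboard_def by (metis add_left_cancel)
qed

lemma given_coloring_comp_vertex_perm:
  "given_coloring \<circ> vertex_perm = slot_coloring (\<lambda>g s. slot_color (site_at g) (site_perm g s))"
proof
  fix u
  show "(given_coloring \<circ> vertex_perm) u = slot_coloring (\<lambda>g s. slot_color (site_at g) (site_perm g s)) u"
  proof (cases "u < m * n * 9")
    case True
    then show ?thesis
      by (rule row_major_cases)
        (simp add: vertex_perm_vertex slot_coloring_vertex site_perm_involution given_coloring_def)
  next
    case False
    then show ?thesis by (simp add: given_coloring_def vertex_perm_def slot_coloring_def)
  qed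
qed

lemma proper_coloring_comp_vertex_perm: "proper_coloring graph 3 (given_coloring \<circ> vertex_perm)"
  unfolding given_coloring_comp_vertex_perm
proof (rule proper_slot_coloringI)
  fix g s :: nat assume "s < 9"
  then show "slot_color (site_at g) (site_perm g s) \<in> {1..3}"
    by (intro slot_color_site_at site_perm_involution)
qed (simp_all add: slot_color_site_perm checkerboard_link)

lemma chromatic_number_graph: "chromatic_number graph = 3"
  unfolding chromatic_number_def
proof (rule Least_equality)
  show "\<exists>c. proper_coloring graph 3 c" using proper_coloring_comp_vertex_perm by blast
next
  fix r assume "\<exists>c. proper_coloring graph r c"
  then obtain c where c: "proper_coloring graph r c" by blast
  have "0 < m * n" using m_pos n_pos by simp
  note c_slots = proper_coloring_graphD[OF c this, simplified]
  have "slot_adj l 3 4" "slot_adj l 3 5" "slot_adj l 4 5" for l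
    by (simp_all add: slot_adj_def slot_edges_def)
  then have "card {c 3, c 4, c 5} = 3" using c_slots(2) by simp
  moreover have "{c 3, c 4, c 5} \<subseteq> {1..r}" using c_slots(1)[of 3] c_slots(1)[of 4] c_slots(1)[of 5] by simp
  ultimately show "3 \<le> r" using card_mono[of "{1..r}" "{c 3, c 4, c 5}"] by simp
qed

lemma fix_promise_graph: "fix_promise 3 graph given_coloring"
  unfolding fix_promise_def chromatic_number_graph
  using proper_coloring_comp_vertex_perm permutation_of_comp_permutes[OF vertex_perm_permutes] by auto

subsection \<open>Counting recolorings\<close>

definition site_cost :: "(nat \<Rightarrow> nat) \<Rightarrow> nat \<Rightarrow> nat" where
  "site_cost c g = (\<Sum>s<9. of_bool (given_coloring (g * 9 + s) \<noteq> c (g * 9 + s)))"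

lemma card_changed_graph: "card (changed graph given_coloring c) = (\<Sum>g<m * n. site_cost c g)"
proof -
  have "card (changed graph given_coloring c) = (\<Sum>u<m * n * 9. of_bool (given_coloring u \<noteq> c u))"
    by (simp add: changed_def sum.If_cases of_bool_def Int_def)
  also have "\<dots> = (\<Sum>g<m * n. \<Sum>u = g * 9..<g * 9 + 9. of_bool (given_coloring u \<noteq> c u))"
    by (rule sum.nat_group[symmetric])
  also have "\<dots> = (\<Sum>g<m * n. site_cost c g)"
    unfolding site_cost_def
    by (rule sum.cong[OF refl]) (subst sum.atLeastLessThan_shift_0, simp add: atLeast0LessThan)
  finally show ?thesis .
qed

lemma budget_eq_sum: "budget = (\<Sum>g<m * n. of_bool (1 \<le> pendants (site_at g)))"
  unfolding budget_def by (simp add: sum.If_cases of_bool_def Int_def lessThan_def)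

lemma sum_lessThan_9:
  fixes f :: "nat \<Rightarrow> nat"
  shows "(\<Sum>s<9. f s) = f 0 + f 1 + f 2 + f 3 + f 4 + f 5 + f 6 + f 7 + f 8"
  by (simp add: eval_nat_numeral)

lemma
  assumes g: "g < m * n" and c: "proper_coloring graph 3 c"
  shows site_cost_ge: "of_bool (1 \<le> pendants (site_at g)) \<le> site_cost c g"
    and allowed_if_site_cost_le: "site_cost c g \<le> of_bool (1 \<le> pendants (site_at g)) \<Longrightarrow>
      allowed (site_color (site_at g)) (pendants (site_at g)) (c (g * 9))"
proof -
  let ?a = "site_color (site_at g)" and ?l = "pendants (site_at g)"
  have given: "given_coloring (g * 9 + s) = slot_color (site_at g) s" if "s < 9" for s
    using g that by (simp add: given_coloring_def slot_coloring_vertex)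
  have cost: "of_bool (c (g * 9) \<noteq> ?a) + of_bool (c (g * 9 + 1) \<noteq> ?a) + of_bool (c (g * 9 + 2) \<noteq> ?a) \<le> site_cost c g"
    unfolding site_cost_def sum_lessThan_9 using given[of 0] given[of 1] given[of 2]
    by (simp add: slot_color_def eq_commute)
  have pendant: "c (g * 9) \<noteq> c (g * 9 + s)" if "s \<in> {1, 2}" "s \<le> ?l" for s
  proof -
    have "slot_adj ?l 0 s" using that by (auto simp: slot_adj_def slot_edges_def)
    from proper_coloring_graphD(2)[OF c g this] show ?thesis by simp
  qed
  show "of_bool (1 \<le> ?l) \<le> site_cost c g"
    using cost pendant[of 1] by (cases "c (g * 9) = ?a") (auto simp: of_bool_def split: if_splits)
  have "c (g * 9) \<in> {1, 2, 3}"
    using proper_coloring_graphD(1)[OF c g, of 0] by auto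
  moreover have "?l = 0 \<or> ?l = 1 \<or> ?l = 2" using pendants_site_at[of g] by linarith
  ultimately show "allowed ?a ?l (c (g * 9))" if "site_cost c g \<le> of_bool (1 \<le> ?l)"
    unfolding allowed_def
    using cost pendant[of 1] pendant[of 2] that by (auto simp: of_bool_def split: if_splits)
qed

lemma list_coloring_of_proper_coloring:
  assumes c: "proper_coloring graph 3 c"
    and allowed: "\<And>g. g < m * n \<Longrightarrow> allowed (site_color (site_at g)) (pendants (site_at g)) (c (g * 9))"
  shows "list_coloring m n S (\<lambda>i j. c ((i * n + j) * 9))"
  unfolding list_coloring_def
proof (intro allI impI)
  fix i j assume i: "i < m" and j: "j < n"
  let ?g = "i * n + j"
  have g: "?g < m * n" using i j by (rule row_major_less)
  have site: "site_at ?g = S i j" using j by (rule site_at_row_major)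
  have "right_edge (S i j) \<longrightarrow> link ?g (i * n + Suc j)" "down_edge (S i j) \<longrightarrow> link ?g (Suc i * n + j)"
    by (simp_all add: link_def site)
  then show "allowed (site_color (S i j)) (pendants (S i j)) (c (?g * 9)) \<and>
      (right_edge (S i j) \<longrightarrow> c (?g * 9) \<noteq> c ((i * n + Suc j) * 9)) \<and>
      (down_edge (S i j) \<longrightarrow> c (?g * 9) \<noteq> c ((Suc i * n + j) * 9))"
    using allowed[OF g] proper_coloring_graphD(3)[OF c g] unfolding site by blast
qed

lemma fixable_imp_list_coloring:
  assumes "fixable graph 3 given_coloring budget"
  shows "\<exists>f. list_coloring m n S f"
proof -
  let ?needed = "\<lambda>g. of_bool (1 \<le> pendants (site_at g))"
  from assms obtain c where c: "proper_coloring graph 3 c"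
    and cheap: "card (changed graph given_coloring c) \<le> budget"
    using fixable_iff_card_changed[OF _ given_coloring_colorings] by auto
  have le: "?needed g \<le> site_cost c g" if "g \<in> {..<m * n}" for g
    using site_cost_ge[OF _ c] that by simp
  have "(\<Sum>g<m * n. ?needed g) = (\<Sum>g<m * n. site_cost c g)"
    using sum_mono[OF le] cheap unfolding card_changed_graph budget_eq_sum by (rule antisym)
  then have "?needed g = site_cost c g" if "g < m * n" for g
    using sum_mono_inv[of ?needed "{..<m * n}" "site_cost c" g] le that by simp
  then have "list_coloring m n S (\<lambda>i j. c ((i * n + j) * 9))"
    by (intro list_coloring_of_proper_coloring[OF c] allowed_if_site_cost_le[OF _ c]) simp_all
  then show ?thesis by blast
qed

definition fixed_slot_color :: "site \<Rightarrow> nat \<Rightarrow> nat \<Rightarrow> nat" where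
  "fixed_slot_color x b s =
     (if s = 0 then b
      else if s = 1 \<and> pendants x = 1 \<and> b = site_color x then (if site_color x = 1 then 2 else 1)
      else slot_color x s)"

lemma fixed_slot_color_adj:
  assumes allowed: "allowed (site_color x) (pendants x) b" and "site_color x \<in> {1, 2, 3}" "pendants x \<le> 2"
    and "slot_adj (pendants x) s t"
  shows "fixed_slot_color x b s \<noteq> fixed_slot_color x b t"
proof -
  have "fixed_slot_color x b 0 \<noteq> fixed_slot_color x b 1" if "1 \<le> pendants x"
    using allowed assms(3) that by (auto simp: fixed_slot_color_def slot_color_def allowed_def)
  moreover have "fixed_slot_color x b 0 \<noteq> fixed_slot_color x b 2" if "2 \<le> pendants x"
    using allowed assms(3) that by (simp add: fixed_slot_color_def slot_color_def allowed_def)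
  moreover have "fixed_slot_color x b s \<noteq> fixed_slot_color x b t" if "(s, t) \<in> {(3, 4), (3, 5), (4, 5)}" for s t
    using that by (elim insertE emptyE Pair_inject) (simp_all add: fixed_slot_color_def slot_color_def)
  ultimately have "fixed_slot_color x b s \<noteq> fixed_slot_color x b t" if "(s, t) \<in> slot_edges (pendants x)" for s t
    using that unfolding slot_edges_def by blast
  then show ?thesis using assms(4) unfolding slot_adj_def by metis
qed

lemma sum_changed_slots:
  assumes "allowed (site_color x) (pendants x) b" "pendants x \<le> 2"
  shows "(\<Sum>s<9. of_bool (slot_color x s \<noteq> fixed_slot_color x b s)) = (of_bool (1 \<le> pendants x) :: nat)"
proof -
  have "(\<Sum>s<9. of_bool (slot_color x s \<noteq> fixed_slot_color x b s) :: nat) =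
      (\<Sum>s\<in>{0, 1}. of_bool (slot_color x s \<noteq> fixed_slot_color x b s))"
    by (rule sum.mono_neutral_right) (auto simp: fixed_slot_color_def)
  moreover have "pendants x = 0 \<or> pendants x = 1 \<or> pendants x = 2" using assms(2) by linarith
  ultimately show ?thesis
    using assms(1)
    by (elim disjE; cases "b = site_color x") (simp_all add: fixed_slot_color_def slot_color_def allowed_def)
qed

lemma list_coloring_imp_fixable:
  assumes f: "list_coloring m n S f"
  shows "fixable graph 3 given_coloring budget"
proof -
  define F where "F g = f (g div n) (g mod n)" for g
  define c where "c = slot_coloring (\<lambda>g. fixed_slot_color (site_at g) (F g))"
  have F_row_major: "F (i * n + j) = f i j" if "j < n" for i j
    unfolding F_def row_major_div_mod[OF that] ..
  have allowed: "allowed (site_color (site_at g)) (pendants (site_at g)) (F g)" if g: "g < m * n" for g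
  proof -
    obtain i j where "i < m" "j < n" "g = i * n + j" using g by (rule row_major_cases)
    then show ?thesis using f by (simp add: F_row_major site_at_row_major list_coloring_def)
  qed
  have "proper_coloring graph 3 c"
    unfolding c_def
  proof (rule proper_slot_coloringI)
    fix g h s t assume g: "g < m * n"
    show "fixed_slot_color (site_at g) (F g) s \<in> {1..3}" if "s < 9"
      using allowed[OF g] slot_color_site_at[OF that, of g] by (auto simp: fixed_slot_color_def allowed_def)
    show "fixed_slot_color (site_at g) (F g) s \<noteq> fixed_slot_color (site_at g) (F g) t"
      if "slot_adj (pendants (site_at g)) s t"
      using allowed[OF g] site_color_site_at pendants_site_at that by (rule fixed_slot_color_adj)
    assume "link g h"
    with g have "F g \<noteq> F h"
      using f by (cases rule: link_cases) (auto simp only: F_row_major list_coloring_def Suc_lessD)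
    then show "fixed_slot_color (site_at g) (F g) 0 \<noteq> fixed_slot_color (site_at h) (F h) 0"
      by (simp add: fixed_slot_color_def)
  qed
  moreover have "site_cost c g = of_bool (1 \<le> pendants (site_at g))" if g: "g < m * n" for g
    using sum_changed_slots[OF allowed[OF g] pendants_site_at] g
    by (simp add: site_cost_def c_def given_coloring_def slot_coloring_vertex)
  then have "card (changed graph given_coloring c) = budget"
    unfolding card_changed_graph budget_eq_sum by (intro sum.cong) auto
  ultimately show ?thesis
    using fixable_iff_card_changed[OF _ given_coloring_colorings] by auto
qed

theorem fixable_graph_iff: "fixable graph 3 given_coloring budget \<longleftrightarrow> (\<exists>f. list_coloring m n S f)"
  using fixable_imp_list_coloring list_coloring_imp_fixable by blast

end

section \<open>Planarity\<close>

lemma planar_if_straight_line_drawing: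
  fixes \<phi> :: "'a \<Rightarrow> complex"
  assumes G: "pair_loopfree_digraph G" and inj: "inj_on \<phi> (pverts G)"
    and vertices: "\<And>u v w. (u, v) \<in> parcs G \<Longrightarrow> w \<in> pverts G \<Longrightarrow>
      \<phi> w \<in> closed_segment (\<phi> u) (\<phi> v) \<Longrightarrow> w \<in> {u, v}"
    and edges: "\<And>u v u' v'. (u, v) \<in> parcs G \<Longrightarrow> (u', v') \<in> parcs G \<Longrightarrow> {u, v} \<noteq> {u', v'} \<Longrightarrow>
      closed_segment (\<phi> u) (\<phi> v) \<inter> closed_segment (\<phi> u') (\<phi> v') \<subseteq> \<phi> ` ({u, v} \<inter> {u', v'})"
  shows "planar G"
proof -
  have wf: "pair_wf_digraph G" by (rule pair_loopfree_digraph.axioms(1)[OF G])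
  define ends where "ends e = (SOME p. e = {fst p, snd p})" for e :: "'a set"
  define \<gamma> where "\<gamma> e = linepath (\<phi> (fst (ends e))) (\<phi> (snd (ends e)))" for e
  have ends: "{u, v} = {fst (ends {u, v}), snd (ends {u, v})}" for u v
    unfolding ends_def by (rule someI[of _ "(u, v)"]) simp
  have image: "path_image (\<gamma> {u, v}) = closed_segment (\<phi> u) (\<phi> v)" for u v
    using ends[of u v] unfolding \<gamma>_def by (auto simp: doubleton_eq_iff closed_segment_commute)
  have endpoints: "{pathstart (\<gamma> {u, v}), pathfinish (\<gamma> {u, v})} = {\<phi> u, \<phi> v}" for u v
    using ends[of u v] unfolding \<gamma>_def by (auto simp: doubleton_eq_iff)
  have "arc (\<gamma> {u, v}) \<and> path_image (\<gamma> {u, v}) \<inter> \<phi> ` pverts G = {\<phi> u, \<phi> v}"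
    if uv: "(u, v) \<in> parcs G" for u v
  proof
    have verts: "u \<in> pverts G" "v \<in> pverts G" "u \<noteq> v"
      using pair_wf_digraph.arc_fst_in_verts[OF wf uv] pair_wf_digraph.arc_snd_in_verts[OF wf uv]
        pair_loopfree_digraph.pair_no_loops[OF G uv] by simp_all
    then have "\<phi> u \<noteq> \<phi> v" using inj by (auto dest: inj_onD)
    then have "\<phi> (fst (ends {u, v})) \<noteq> \<phi> (snd (ends {u, v}))"
      using ends[of u v] by (auto simp: doubleton_eq_iff)
    then show "arc (\<gamma> {u, v})" unfolding \<gamma>_def by (rule arc_linepath)
    show "path_image (\<gamma> {u, v}) \<inter> \<phi> ` pverts G = {\<phi> u, \<phi> v}"
      unfolding image using vertices[OF uv] verts by auto
  qed
  then have "planar_drawing G \<phi> \<gamma>"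
    unfolding planar_drawing_def case_prod_beta image using inj endpoints edges
    by (intro conjI ballI impI) simp_all
  then show ?thesis unfolding planar_def by blast
qed

text \<open>
  Site \<open>(i, j)\<close> sits at the grid point with real part \<open>j\<close> and imaginary part \<open>i\<close>, and its other eight
  vertices lie within 1/4 of it in both coordinates, off the grid lines.
\<close>

definition slot_x :: "nat \<Rightarrow> real" where
  "slot_x s = (if s = 1 \<or> s = 4 then 1/4 else if s = 2 \<or> s = 7 then -1/4
     else if s = 3 \<or> s = 5 then 1/8 else if s = 6 \<or> s = 8 then -1/8 else 0)"

definition slot_y :: "nat \<Rightarrow> real" where
  "slot_y s = (if s = 1 \<or> s = 2 then 1/4 else if s = 5 \<or> s = 8 then -1/4
     else if s = 3 \<or> s = 4 \<or> s = 6 \<or> s = 7 then -1/8 else 0)"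

fun position :: "nat \<times> nat \<times> nat \<Rightarrow> complex" where
  "position (i, j, s) = Complex (real j + slot_x s) (real i + slot_y s)"

datatype piece = Horizontal nat nat | Vertical nat nat | Local nat nat nat nat

text \<open>The segment between slots \<open>s\<close> and \<open>t\<close>, relative to the grid point, in a box of radius 1/4.\<close>

definition slot_segment :: "nat \<Rightarrow> nat \<Rightarrow> real \<Rightarrow> real \<Rightarrow> bool" where
  "slot_segment s t dx dy =
     (if t = 1 then dx = dy \<and> 0 \<le> dy else if t = 2 then dx = - dy \<and> 0 \<le> dy
      else if t = 4 then dy = -1/8 \<and> 1/8 \<le> dx
      else if s = 3 then dx = 1/8 \<and> dy \<le> -1/8
      else dx - dy = 3/8 \<and> 1/8 \<le> dx \<and> dy \<le> -1/8)"

fun piece_region :: "piece \<Rightarrow> complex set" where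
  "piece_region (Horizontal i j) = {z. Im z = real i \<and> real j \<le> Re z \<and> Re z \<le> real j + 1}"
| "piece_region (Vertical i j) = {z. Re z = real j \<and> real i \<le> Im z \<and> Im z \<le> real i + 1}"
| "piece_region (Local i j s t) = {z. \<bar>Re z - real j\<bar> \<le> 1/4 \<and> \<bar>Im z - real i\<bar> \<le> 1/4 \<and>
     slot_segment s t (Re z - real j) (Im z - real i)}"

fun piece_ends :: "piece \<Rightarrow> (nat \<times> nat \<times> nat) set" where
  "piece_ends (Horizontal i j) = {(i, j, 0), (i, Suc j, 0)}"
| "piece_ends (Vertical i j) = {(i, j, 0), (Suc i, j, 0)}"
| "piece_ends (Local i j s t) = {(i, j, s), (i, j, t)}"

fun valid_piece :: "piece \<Rightarrow> bool" where
  "valid_piece (Local i j s t) \<longleftrightarrow> (s, t) \<in> slot_edges 2"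
| "valid_piece _ \<longleftrightarrow> True"

lemma of_nat_near: "\<bar>real a - real b\<bar> \<le> 1/2 \<Longrightarrow> a = b"
  by linarith

lemma slot_xy_bounds: "\<bar>slot_x s\<bar> \<le> 1/4" "\<bar>slot_y s\<bar> \<le> 1/4"
  by (simp_all add: slot_x_def slot_y_def)

lemma slot_xy_eq_0: "s < 9 \<Longrightarrow> slot_x s = 0 \<Longrightarrow> s = 0" "s < 9 \<Longrightarrow> slot_y s = 0 \<Longrightarrow> s = 0"
  by (auto simp: slot_x_def slot_y_def split: if_splits)

lemma slot_segment_meets_axis:
  assumes "(s, t) \<in> slot_edges 2" "slot_segment s t dx dy" "dx = 0 \<or> dy = 0"
  shows "s = 0 \<and> dx = 0 \<and> dy = 0"
  using assms by (auto simp: slot_edges_2 slot_segment_def)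

lemma slot_segment_disjoint:
  assumes "(s, t) \<in> slot_edges 2" "(s', t') \<in> slot_edges 2" "(s, t) \<noteq> (s', t')"
    and "slot_segment s t dx dy" "slot_segment s' t' dx dy"
  shows "\<exists>w. w \<in> {s, t} \<inter> {s', t'} \<and> dx = slot_x w \<and> dy = slot_y w"
proof -
  define w where "w = (if s = s' then s else if t = t' then t else if t = s' then t else s)"
  have "w \<in> {s, t} \<inter> {s', t'}" "dx = slot_x w" "dy = slot_y w"
    using assms unfolding slot_edges_2
    by (elim insertE emptyE Pair_inject; auto simp: w_def slot_segment_def slot_x_def slot_y_def)+
  then show ?thesis by blast
qed

lemma position_grid_point: "z = position (i, j, 0) \<longleftrightarrow> Re z = real j \<and> Im z = real i"
  by (auto simp: slot_x_def slot_y_def complex_eq_iff)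

lemma position_inj:
  assumes "position (i, j, s) = position (i', j', s')" "s < 9" "s' < 9"
  shows "(i, j, s) = (i', j', s')"
proof -
  have eqs: "real j + slot_x s = real j' + slot_x s'" "real i + slot_y s = real i' + slot_y s'"
    using assms(1) by simp_all
  then have "j = j'" "i = i'"
    by (intro of_nat_near; use slot_xy_bounds[of s] slot_xy_bounds[of s'] in linarith)+
  moreover have "s = s'"
  proof -
    have "slot_x s = slot_x s'" "slot_y s = slot_y s'" using eqs calculation by simp_all
    moreover have "s \<in> {0, 1, 2, 3, 4, 5, 6, 7, 8}" "s' \<in> {0, 1, 2, 3, 4, 5, 6, 7, 8}"
      using assms(2,3) by auto
    ultimately show ?thesis by (elim insertE emptyE) (simp_all add: slot_x_def slot_y_def)
  qed
  ultimately show ?thesis by simp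
qed

lemma position_in_piece_region:
  assumes "valid_piece p" "position (i, j, s) \<in> piece_region p" "s < 9"
  shows "(i, j, s) \<in> piece_ends p"
proof (cases p)
  case (Horizontal i' j')
  then have y: "real i + slot_y s = real i'"
    and x: "real j' \<le> real j + slot_x s" "real j + slot_x s \<le> real j' + 1"
    using assms(2) by simp_all
  have "i = i'" by (rule of_nat_near) (use y slot_xy_bounds[of s] in linarith)
  then have s: "s = 0" using y slot_xy_eq_0(2)[OF assms(3)] by simp
  then have "j = j' \<or> j = Suc j'" using x by (simp add: slot_x_def) linarith
  then show ?thesis using Horizontal s \<open>i = i'\<close> by auto
next
  case (Vertical i' j')
  then have x: "real j + slot_x s = real j'"
    and y: "real i' \<le> real i + slot_y s" "real i + slot_y s \<le> real i' + 1"
    using assms(2) by simp_all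
  have "j = j'" by (rule of_nat_near) (use x slot_xy_bounds[of s] in linarith)
  then have s: "s = 0" using x slot_xy_eq_0(1)[OF assms(3)] by simp
  then have "i = i' \<or> i = Suc i'" using y by (simp add: slot_y_def) linarith
  then show ?thesis using Vertical s \<open>j = j'\<close> by auto
next
  case (Local i' j' a b)
  then have near: "\<bar>real j + slot_x s - real j'\<bar> \<le> 1/4" "\<bar>real i + slot_y s - real i'\<bar> \<le> 1/4"
    and segment: "slot_segment a b (real j + slot_x s - real j') (real i + slot_y s - real i')"
    using assms(2) by simp_all
  have "i = i'" "j = j'" by (rule of_nat_near, use near slot_xy_bounds[of s] in linarith)+
  then have "slot_segment a b (slot_x s) (slot_y s)" using segment by simp
  moreover have "s \<in> {0, 1, 2, 3, 4, 5, 6, 7, 8}" using assms(3) by auto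
  moreover have "(a, b) \<in> slot_edges 2" using assms(1) Local by simp
  ultimately have "s = a \<or> s = b"
    unfolding slot_edges_2
    by (elim insertE emptyE Pair_inject) (simp_all add: slot_x_def slot_y_def slot_segment_def)
  then show ?thesis using Local \<open>i = i'\<close> \<open>j = j'\<close> by auto
qed

lemma Local_Local_inter:
  assumes "valid_piece p" "valid_piece q" "p \<noteq> q" "p = Local i j s t" "q = Local i' j' s' t'"
    and "z \<in> piece_region p" "z \<in> piece_region q"
  shows "z \<in> position ` (piece_ends p \<inter> piece_ends q)"
proof -
  have near: "\<bar>Re z - real j\<bar> \<le> 1/4" "\<bar>Re z - real j'\<bar> \<le> 1/4" "\<bar>Im z - real i\<bar> \<le> 1/4" "\<bar>Im z - real i'\<bar> \<le> 1/4"
    using assms by simp_all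
  have same: "i = i'" "j = j'" by (rule of_nat_near, use near in linarith)+
  then obtain w where w: "w \<in> {s, t} \<inter> {s', t'}" "Re z - real j = slot_x w" "Im z - real i = slot_y w"
    using slot_segment_disjoint[of s t s' t' "Re z - real j" "Im z - real i"] assms by auto
  then have "z = position (i, j, w)" by (auto simp: complex_eq_iff)
  moreover have "(i, j, w) \<in> piece_ends p \<inter> piece_ends q" using w(1) assms same by auto
  ultimately show ?thesis by blast
qed

lemma Local_axis_inter:
  assumes "valid_piece p" "p = Local i j s t" "q = Horizontal i' j' \<or> q = Vertical i' j'"
    and "z \<in> piece_region p" "z \<in> piece_region q"
  shows "z \<in> position ` (piece_ends p \<inter> piece_ends q)"
proof -
  have near: "\<bar>Re z - real j\<bar> \<le> 1/4" "\<bar>Im z - real i\<bar> \<le> 1/4"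
    and segment: "slot_segment s t (Re z - real j) (Im z - real i)" and "(s, t) \<in> slot_edges 2"
    using assms by simp_all
  have "Re z - real j = 0 \<or> Im z - real i = 0"
    using assms(3)
  proof
    assume q: "q = Horizontal i' j'"
    have "Im z = real i'" using assms(5) q by simp
    then have "i = i'" by (intro of_nat_near) (use near in linarith)
    then show ?thesis using assms(5) q by simp
  next
    assume q: "q = Vertical i' j'"
    have "Re z = real j'" using assms(5) q by simp
    then have "j = j'" by (intro of_nat_near) (use near in linarith)
    then show ?thesis using assms(5) q by simp
  qed
  from slot_segment_meets_axis[OF \<open>(s, t) \<in> slot_edges 2\<close> segment this]
  have s: "s = 0" and z: "z = position (i, j, 0)" unfolding position_grid_point by simp_all
  have "valid_piece q" using assms(3) by auto
  then have "(i, j, 0) \<in> piece_ends q" using position_in_piece_region[of q i j 0] z assms(5) by simp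
  then show ?thesis using s z assms(2) by auto
qed

lemma axis_axis_inter_grid_point:
  assumes "p = Horizontal i j \<or> p = Vertical i j" "q = Horizontal i' j' \<or> q = Vertical i' j'" "p \<noteq> q"
    and "z \<in> piece_region p" "z \<in> piece_region q"
  shows "\<exists>a b. z = position (a, b, 0)"
proof -
  have grid_point: ?thesis if "Im z = real a" "Re z = real b" for a b
    using that position_grid_point by blast
  have common_end: "x = real (max a b)"
    if "real a \<le> x" "x \<le> real a + 1" "real b \<le> x" "x \<le> real b + 1" "a \<noteq> b" for a b :: nat and x
    using that by (cases "a < b") (auto simp: max_def)
  from assms(1,2) consider
    (horizontal) "p = Horizontal i j" "q = Horizontal i' j'" | (vertical) "p = Vertical i j" "q = Vertical i' j'"
    | "p = Horizontal i j" "q = Vertical i' j'" | "p = Vertical i j" "q = Horizontal i' j'" by blast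
  then show ?thesis
  proof cases
    case horizontal
    then have "i = i'" "j \<noteq> j'" using assms(3-5) by auto
    then show ?thesis using grid_point common_end[of j "Re z" j'] assms(4,5) horizontal by auto
  next
    case vertical
    then have "j = j'" "i \<noteq> i'" using assms(3-5) by auto
    then show ?thesis using grid_point common_end[of i "Im z" i'] assms(4,5) vertical by auto
  qed (use grid_point assms(4,5) in auto)
qed

lemma piece_region_inter:
  assumes "valid_piece p" "valid_piece q" "p \<noteq> q"
  shows "piece_region p \<inter> piece_region q \<subseteq> position ` (piece_ends p \<inter> piece_ends q)"
proof
  fix z assume "z \<in> piece_region p \<inter> piece_region q"
  then have z: "z \<in> piece_region p" "z \<in> piece_region q" by auto
  have shape: "(\<exists>i j. p = Horizontal i j \<or> p = Vertical i j) \<or> (\<exists>i j s t. p = Local i j s t)" for p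
    by (cases p) auto
  consider (local_local) i j s t i' j' s' t' where "p = Local i j s t" "q = Local i' j' s' t'"
    | (local_axis) i j s t i' j' where "p = Local i j s t" "q = Horizontal i' j' \<or> q = Vertical i' j'"
    | (axis_local) i j s t i' j' where "q = Local i j s t" "p = Horizontal i' j' \<or> p = Vertical i' j'"
    | (axis_axis) i j i' j' where "p = Horizontal i j \<or> p = Vertical i j" "q = Horizontal i' j' \<or> q = Vertical i' j'"
    using shape[of p] shape[of q] by metis
  then show "z \<in> position ` (piece_ends p \<inter> piece_ends q)"
  proof cases
    case local_local
    then show ?thesis using Local_Local_inter[OF assms] z by blast
  next
    case local_axis
    then show ?thesis using Local_axis_inter[OF assms(1)] z by blast
  next
    case axis_local
    then show ?thesis using Local_axis_inter[OF assms(2)] z by (metis Int_commute)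
  next
    case axis_axis
    from axis_axis_inter_grid_point[OF this assms(3) z] obtain a b where ab: "z = position (a, b, 0)" by blast
    then have "(a, b, 0) \<in> piece_ends p \<inter> piece_ends q"
      using position_in_piece_region[OF assms(1), of a b 0] position_in_piece_region[OF assms(2), of a b 0] z
      by simp
    then show ?thesis using ab by blast
  qed
qed

lemma closed_segment_Re_Im:
  assumes "z \<in> closed_segment a b"
  obtains w where "0 \<le> w" "w \<le> 1" "Re z = Re a + w * (Re b - Re a)" "Im z = Im a + w * (Im b - Im a)"
proof -
  obtain w where "0 \<le> w" "w \<le> 1" and z: "z = (1 - w) *\<^sub>R a + w *\<^sub>R b"
    using assms unfolding closed_segment_def by auto
  moreover have "Re z = Re a + w * (Re b - Re a)" "Im z = Im a + w * (Im b - Im a)"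
    unfolding z by (simp_all add: algebra_simps)
  ultimately show thesis using that by blast
qed

lemma closed_segment_subset_Local:
  assumes "(s, t) \<in> slot_edges 2"
  shows "closed_segment (position (i, j, s)) (position (i, j, t)) \<subseteq> piece_region (Local i j s t)"
proof
  fix z assume "z \<in> closed_segment (position (i, j, s)) (position (i, j, t))"
  then obtain w where w: "0 \<le> w" "w \<le> 1"
    and "Re z - real j = slot_x s + w * (slot_x t - slot_x s)"
      "Im z - real i = slot_y s + w * (slot_y t - slot_y s)"
    by (rule closed_segment_Re_Im) simp
  moreover have "\<bar>slot_x s + w * (slot_x t - slot_x s)\<bar> \<le> 1/4 \<and> \<bar>slot_y s + w * (slot_y t - slot_y s)\<bar> \<le> 1/4 \<and>
    slot_segment s t (slot_x s + w * (slot_x t - slot_x s)) (slot_y s + w * (slot_y t - slot_y s))"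
    using assms w unfolding slot_edges_2
    by (elim insertE emptyE Pair_inject) (simp_all add: slot_segment_def slot_x_def slot_y_def field_simps)
  ultimately show "z \<in> piece_region (Local i j s t)" by simp
qed

lemma closed_segment_subset_piece_region:
  assumes "valid_piece p" "piece_ends p = {a, b}"
  shows "closed_segment (position a) (position b) \<subseteq> piece_region p"
proof -
  obtain a' b' where "piece_ends p = {a', b'}"
    and segment: "closed_segment (position a') (position b') \<subseteq> piece_region p"
  proof (cases p)
    case (Horizontal i j)
    moreover have "closed_segment (position (i, j, 0)) (position (i, Suc j, 0)) \<subseteq> piece_region (Horizontal i j)"
      by (auto simp: slot_x_def slot_y_def elim!: closed_segment_Re_Im)
    ultimately show thesis using that by simp
  next
    case (Vertical i j)
    moreover have "closed_segment (position (i, j, 0)) (position (Suc i, j, 0)) \<subseteq> piece_region (Vertical i j)"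
      by (auto simp: slot_x_def slot_y_def elim!: closed_segment_Re_Im)
    ultimately show thesis using that by simp
  next
    case (Local i j s t)
    then show thesis using that closed_segment_subset_Local[of s t i j] assms(1) by simp
  qed
  then have "a = a' \<and> b = b' \<or> a = b' \<and> b = a'" using assms(2) by (metis doubleton_eq_iff)
  then show ?thesis using segment by (auto simp: closed_segment_commute)
qed

context picture
begin

definition coordinates :: "nat \<Rightarrow> nat \<times> nat \<times> nat" where
  "coordinates u = (u div 9 div n, u div 9 mod n, u mod 9)"

lemma inj_coordinates: "inj coordinates"
  unfolding coordinates_def by (rule injI) (metis Pair_inject div_mod_decomp)

lemma coordinates_vertex:
  "s < 9 \<Longrightarrow> coordinates (g * 9 + s) = (g div n, g mod n, s)"
  "j < n \<Longrightarrow> coordinates ((i * n + j) * 9) = (i, j, 0)"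
  by (simp_all add: coordinates_def row_major_div_mod)

lemma coordinates_link:
  assumes "g < m * n" "link g h"
  shows "\<exists>p. valid_piece p \<and> piece_ends p = {coordinates (g * 9), coordinates (h * 9)}"
  using assms
proof (cases rule: link_cases)
  case (right i j)
  then show ?thesis
    using coordinates_vertex(2)[of j i] coordinates_vertex(2)[of "Suc j" i]
    by (intro exI[of _ "Horizontal i j"]) simp
next
  case (down i j)
  then show ?thesis
    using coordinates_vertex(2)[of j i] coordinates_vertex(2)[of j "Suc i"]
    by (intro exI[of _ "Vertical i j"]) simp
qed

lemma coordinates_edge:
  assumes "(u, v) \<in> parcs graph"
  obtains p where "valid_piece p" "piece_ends p = {coordinates u, coordinates v}"
proof -
  have bounds: "u < m * n * 9" "v < m * n * 9" and "adj u v" using assms by (simp_all add: parcs_graph)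
  from \<open>adj u v\<close> have "\<exists>p. valid_piece p \<and> piece_ends p = {coordinates u, coordinates v}"
  proof (cases rule: adj_cases)
    case (slot g s t)
    have ends: "coordinates u = (g div n, g mod n, s)" "coordinates v = (g div n, g mod n, t)"
      using slot slot_adj_less[OF slot(3)] by (simp_all add: coordinates_vertex)
    from slot_adj_imp_slot_edges[OF slot(3)] show ?thesis
    proof
      assume "(s, t) \<in> slot_edges 2"
      then show ?thesis using ends by (intro exI[of _ "Local (g div n) (g mod n) s t"]) simp
    next
      assume "(t, s) \<in> slot_edges 2"
      then show ?thesis using ends by (intro exI[of _ "Local (g div n) (g mod n) t s"]) auto
    qed
  next
    case (link g h)
    then show ?thesis using coordinates_link[of g h] bounds by simp
  next
    case (link_back g h)
    then show ?thesis using coordinates_link[of h g] bounds by (simp add: insert_commute)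
  qed
  then show thesis using that by blast
qed

theorem planar_graph: "planar graph"
proof (rule planar_if_straight_line_drawing)
  let ?\<phi> = "position \<circ> coordinates"
  interpret pair_graph graph by (rule pair_graph_graph)
  show "pair_loopfree_digraph graph" by unfold_locales
  show "inj_on ?\<phi> (pverts graph)"
  proof (rule inj_onI)
    fix u v assume "?\<phi> u = ?\<phi> v"
    then have "coordinates u = coordinates v"
      unfolding coordinates_def comp_def by (intro position_inj) simp_all
    then show "u = v" by (rule injD[OF inj_coordinates])
  qed
  have region: "closed_segment (?\<phi> u) (?\<phi> v) \<subseteq> piece_region p"
    if "valid_piece p" "piece_ends p = {coordinates u, coordinates v}" for u v p
    using closed_segment_subset_piece_region[OF that] by simp
  fix u v assume "(u, v) \<in> parcs graph"
  then obtain p where p: "valid_piece p" "piece_ends p = {coordinates u, coordinates v}"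
    by (rule coordinates_edge)
  show "w \<in> {u, v}" if "?\<phi> w \<in> closed_segment (?\<phi> u) (?\<phi> v)" for w
  proof -
    have "coordinates w \<in> piece_ends p"
      using region[OF p] that unfolding coordinates_def comp_def
      by (intro position_in_piece_region[OF p(1)]) auto
    then show ?thesis unfolding p(2) by (auto dest: injD[OF inj_coordinates])
  qed
  fix u' v' assume "(u', v') \<in> parcs graph" and distinct: "{u, v} \<noteq> {u', v'}"
  then obtain q where q: "valid_piece q" "piece_ends q = {coordinates u', coordinates v'}"
    by (elim coordinates_edge)
  have ends: "piece_ends p = coordinates ` {u, v}" "piece_ends q = coordinates ` {u', v'}"
    using p(2) q(2) by simp_all
  have "p \<noteq> q" using distinct ends inj_image_eq_iff[OF inj_coordinates] by metis
  from piece_region_inter[OF p(1) q(1) this] region[OF p] region[OF q]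
  have "closed_segment (?\<phi> u) (?\<phi> v) \<inter> closed_segment (?\<phi> u') (?\<phi> v') \<subseteq> position ` (piece_ends p \<inter> piece_ends q)"
    by blast
  also have "\<dots> = ?\<phi> ` ({u, v} \<inter> {u', v'})"
    unfolding ends image_Int[OF inj_coordinates, symmetric] by (rule image_comp)
  finally show "closed_segment (?\<phi> u) (?\<phi> v) \<inter> closed_segment (?\<phi> u') (?\<phi> v') \<subseteq> ?\<phi> ` ({u, v} \<inter> {u', v'})" .
qed

end

section \<open>Tiles\<close>

text \<open>
  A tile has a boolean wire at its left, top, right and bottom side. It is drawn as a list-coloring
  instance on an 8 by 8 grid with ports at \<open>(3, 0)\<close>, \<open>(0, 3)\<close>, \<open>(3, 7)\<close>, \<open>(7, 3)\<close>. An entry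
  \<open>((row, column), (c, l))\<close> of \<open>tile_sites\<close> prescribes the color \<open>c\<close> if \<open>l = 0\<close>, forbids it if
  \<open>l = 2\<close>, and means no restriction if \<open>l = 1\<close>. A wire is a path of vertices with colors 1 and 2. The
  crossing and the solutions of the gadgets were found by computer search.
\<close>

datatype tile = Free | Cross | Nand | Junction | Disj | Pass | Cap

fun tile_rel :: "tile \<Rightarrow> bool \<Rightarrow> bool \<Rightarrow> bool \<Rightarrow> bool \<Rightarrow> bool" where
  "tile_rel Free l t r b = True"
| "tile_rel Cross l t r b = (l = r \<and> t = b)"
| "tile_rel Nand l t r b = (l = r \<and> t = b \<and> \<not> (l \<and> t))"
| "tile_rel Junction l t r b = (l = r \<and> t = b \<and> l = t)"
| "tile_rel Disj l t r b = (b \<longrightarrow> t \<or> l)"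
| "tile_rel Pass l t r b = (t = b)"
| "tile_rel Cap l t r b = (t \<and> \<not> b)"

definition cross_sites :: "((nat \<times> nat) \<times> nat \<times> nat) list" where
  "cross_sites = [
    ((0, 0), (3, 2)), ((0, 1), (3, 2)), ((0, 2), (1, 2)), ((0, 3), (3, 2)), ((0, 4), (2, 2)),
    ((0, 5), (3, 2)), ((0, 6), (3, 2)), ((1, 0), (3, 2)), ((1, 2), (1, 1)), ((1, 3), (3, 2)),
    ((1, 4), (1, 1)), ((1, 5), (3, 2)), ((1, 6), (3, 2)), ((2, 0), (2, 2)), ((2, 1), (1, 1)),
    ((2, 2), (2, 2)), ((2, 3), (1, 2)), ((2, 4), (1, 2)), ((2, 5), (1, 1)), ((2, 6), (1, 2)),
    ((3, 0), (3, 2)), ((3, 1), (3, 2)), ((3, 2), (2, 2)), ((3, 4), (2, 2)), ((3, 5), (3, 2)),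
    ((3, 6), (3, 2)), ((3, 7), (3, 2)), ((4, 0), (1, 2)), ((4, 1), (1, 1)), ((4, 2), (1, 2)),
    ((4, 3), (1, 2)), ((4, 4), (2, 2)), ((4, 5), (1, 1)), ((4, 6), (2, 2)), ((5, 0), (3, 2)),
    ((5, 1), (3, 2)), ((5, 2), (1, 1)), ((5, 3), (3, 2)), ((5, 4), (1, 1)), ((5, 5), (3, 2)),
    ((5, 6), (3, 2)), ((6, 0), (3, 2)), ((6, 1), (3, 2)), ((6, 2), (2, 2)), ((6, 3), (3, 2)),
    ((6, 4), (1, 2)), ((6, 5), (3, 2)), ((6, 6), (3, 2)), ((7, 3), (3, 2))]"

definition cross_right :: "(nat \<times> nat) list" where
  "cross_right = [
    (0, 0), (0, 1), (0, 4), (0, 5), (1, 1), (1, 2), (1, 3), (1, 4), (2, 0), (2, 1), (2, 2),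
    (2, 3), (2, 4), (2, 5), (3, 0), (3, 5), (3, 6), (4, 0), (4, 1), (4, 2), (4, 3), (4, 4),
    (4, 5), (5, 1), (5, 2), (5, 3), (5, 4), (6, 0), (6, 1), (6, 4), (6, 5)]"

definition cross_down :: "(nat \<times> nat) list" where
  "cross_down = [
    (0, 0), (0, 2), (0, 3), (0, 4), (0, 6), (1, 0), (1, 1), (1, 2), (1, 4), (1, 5), (1, 6),
    (2, 1), (2, 2), (2, 4), (2, 5), (3, 1), (3, 2), (3, 4), (3, 5), (4, 0), (4, 1), (4, 2),
    (4, 4), (4, 5), (4, 6), (5, 0), (5, 2), (5, 3), (5, 4), (5, 6), (6, 3)]"

fun tile_sites :: "tile \<Rightarrow> ((nat \<times> nat) \<times> nat \<times> nat) list" where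
  "tile_sites Free = [((3, 0), (3, 2)), ((0, 3), (3, 2)), ((3, 7), (3, 2)), ((7, 3), (3, 2))]"
| "tile_sites Cross = ((1, 1), (3, 2)) # cross_sites"
| "tile_sites Nand = ((1, 1), (1, 0)) # cross_sites"
| "tile_sites Junction =
    [((0, 3), (3, 2)), ((1, 3), (3, 2)), ((2, 3), (3, 2)), ((3, 0), (3, 2)), ((3, 1), (3, 2)),
     ((3, 2), (3, 2)), ((3, 3), (3, 2)), ((3, 4), (3, 2)), ((3, 5), (3, 2)), ((3, 6), (3, 2)),
     ((3, 7), (3, 2)), ((4, 3), (3, 2)), ((5, 3), (3, 2)), ((6, 3), (3, 2)), ((7, 3), (3, 2))]"
| "tile_sites Disj =
    [((0, 3), (3, 2)), ((1, 3), (3, 2)), ((2, 3), (3, 2)), ((3, 0), (3, 2)), ((3, 1), (1, 2)),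
     ((3, 2), (2, 2)), ((3, 3), (1, 1)), ((3, 7), (3, 2)), ((4, 3), (1, 2)), ((5, 3), (3, 2)),
     ((6, 3), (3, 2)), ((7, 3), (3, 2))]"
| "tile_sites Pass =
    [((0, 3), (3, 2)), ((1, 3), (3, 2)), ((2, 3), (3, 2)), ((3, 0), (3, 2)), ((3, 3), (3, 2)),
     ((3, 7), (3, 2)), ((4, 3), (3, 2)), ((5, 3), (3, 2)), ((6, 3), (3, 2)), ((7, 3), (3, 2))]"
| "tile_sites Cap = [((3, 0), (3, 2)), ((0, 3), (1, 0)), ((3, 7), (3, 2)), ((7, 3), (1, 0))]"

fun tile_right :: "tile \<Rightarrow> (nat \<times> nat) list" where
  "tile_right Cross = cross_right"
| "tile_right Nand = cross_right"
| "tile_right Junction = [(3, 0), (3, 1), (3, 2), (3, 3), (3, 4), (3, 5), (3, 6)]"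
| "tile_right Disj = [(3, 0), (3, 1), (3, 2)]"
| "tile_right _ = []"

fun tile_down :: "tile \<Rightarrow> (nat \<times> nat) list" where
  "tile_down Cross = cross_down"
| "tile_down Nand = cross_down"
| "tile_down Free = []"
| "tile_down Cap = []"
| "tile_down _ = [(0, 3), (1, 3), (2, 3), (3, 3), (4, 3), (5, 3), (6, 3)]"

definition gadget_coloring :: "tile \<Rightarrow> (nat \<Rightarrow> nat \<Rightarrow> nat) \<Rightarrow> bool" where
  "gadget_coloring k f \<longleftrightarrow>
     list_all (\<lambda>((p, q), (c, l)). allowed c l (f p q)) (tile_sites k) \<and>
     list_all (\<lambda>(p, q). f p q \<noteq> f p (q + 1)) (tile_right k) \<and>
     list_all (\<lambda>(p, q). f p q \<noteq> f (p + 1) q) (tile_down k)"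

subsection \<open>Soundness of the gadgets\<close>

context
  notes One_nat_def [simp del]
begin

lemma allowed_simps [simp]:
  "allowed 3 2 a \<longleftrightarrow> a = 1 \<or> a = 2"
  "allowed 2 2 a \<longleftrightarrow> a = 1 \<or> a = 3"
  "allowed 1 2 a \<longleftrightarrow> a = 2 \<or> a = 3"
  "allowed 1 1 a \<longleftrightarrow> a = 1 \<or> a = 2 \<or> a = 3"
  "allowed 1 0 a \<longleftrightarrow> a = 1"
  by (auto simp: allowed_def)

lemma alternate:
  fixes a b :: nat
  assumes "a = 1 \<or> a = 2" "b = 1 \<or> b = 2" "a \<noteq> b"
  shows "(a = 1) = (b = 2)" "(a = 2) = (b = 1)"
  using assms by auto

text \<open>One corner of the crossing: \<open>m\<close> is the copy of the central bit, whose value 3 forces the two arms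
  \<open>x\<close> and \<open>y\<close> to agree and whose other value \<open>a\<close> forbids that both are \<open>3 - a\<close>.\<close>

lemma cross_corner:
  fixes x y m a p s r q1 q2 q3 q4 q5 :: nat
  assumes "x = 1 \<or> x = 2" "y = 1 \<or> y = 2" "a = 1 \<or> a = 2" "m = a \<or> m = 3"
    "p = 1 \<or> p = 2 \<or> p = 3" "r = 1 \<or> r = 2 \<or> r = 3" "s = 1 \<or> s = 2"
    "q1 = 1 \<or> q1 = 3" "q2 = 1 \<or> q2 = 2" "q3 = 1 \<or> q3 = 2" "q4 = 1 \<or> q4 = 2" "q5 = 2 \<or> q5 = 3"
    "p \<noteq> x" "p \<noteq> m" "r \<noteq> y" "r \<noteq> m" "p \<noteq> s" "s \<noteq> r"
    "p \<noteq> q1" "q1 \<noteq> q2" "q2 \<noteq> q3" "q3 \<noteq> q4" "q4 \<noteq> q5" "q5 \<noteq> r"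
  shows "(m = 3 \<longrightarrow> x = y) \<and> (m = a \<longrightarrow> \<not> (x = 3 - a \<and> y = 3 - a)) \<and>
    (s = 1 \<longrightarrow> a = 1 \<longrightarrow> \<not> (x = 2 \<and> y = 2))"
proof -
  have "p = 3 \<Longrightarrow> r \<noteq> 3" using assms(8-12,19-24) by auto
  moreover have "m = 3 \<Longrightarrow> p = 3 - x \<and> r = 3 - y \<and> x = y"
    using assms(1-7,13-18) by auto
  moreover have "m = a \<Longrightarrow> x = 3 - a \<Longrightarrow> p = 3" "m = a \<Longrightarrow> y = 3 - a \<Longrightarrow> r = 3"
    using assms(1-7,13-18) by auto
  ultimately show ?thesis using assms(1-7,13-18) by auto
qed

lemma cross_ring:
  fixes a b c d e f g h :: nat
  assumes "a = 1 \<or> a = 3" "b = 2 \<or> b = 3" "c = 2 \<or> c = 3" "d = 1 \<or> d = 3" "e = 1 \<or> e = 3"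
    "f = 2 \<or> f = 3" "g = 2 \<or> g = 3" "h = 1 \<or> h = 3"
    "a \<noteq> b" "b \<noteq> c" "c \<noteq> d" "d \<noteq> e" "e \<noteq> f" "f \<noteq> g" "g \<noteq> h" "h \<noteq> a"
  shows "(a = 3 \<longleftrightarrow> c = 3) \<and> (c = 3 \<longleftrightarrow> e = 3) \<and> (e = 3 \<longleftrightarrow> g = 3)"
  using assms by auto

definition cross_coloring :: "(nat \<Rightarrow> nat \<Rightarrow> nat) \<Rightarrow> bool" where
  "cross_coloring f \<longleftrightarrow> list_all (\<lambda>((p, q), (c, l)). allowed c l (f p q)) cross_sites \<and>
     list_all (\<lambda>(p, q). f p q \<noteq> f p (q + 1)) cross_right \<and>
     list_all (\<lambda>(p, q). f p q \<noteq> f (p + 1) q) cross_down"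

lemma cross_corners:
  assumes f: "cross_coloring f" and "f 1 1 = 1 \<or> f 1 1 = 2"
  shows "(f 2 2 = 3 \<longrightarrow> f 3 1 = f 1 3) \<and> (f 2 2 = 1 \<longrightarrow> \<not> (f 3 1 = 3 - 1 \<and> f 1 3 = 3 - 1)) \<and>
      (f 1 1 = 1 \<longrightarrow> 1 = (1::nat) \<longrightarrow> \<not> (f 3 1 = 2 \<and> f 1 3 = 2))" (is ?north_west)
    and "(f 2 4 = 3 \<longrightarrow> f 1 3 = f 3 5) \<and> (f 2 4 = 2 \<longrightarrow> \<not> (f 1 3 = 3 - 2 \<and> f 3 5 = 3 - 2)) \<and>
      (f 1 5 = 1 \<longrightarrow> 2 = (1::nat) \<longrightarrow> \<not> (f 1 3 = 2 \<and> f 3 5 = 2))" (is ?north_east)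
    and "(f 4 4 = 3 \<longrightarrow> f 3 5 = f 5 3) \<and> (f 4 4 = 1 \<longrightarrow> \<not> (f 3 5 = 3 - 1 \<and> f 5 3 = 3 - 1)) \<and>
      (f 5 5 = 1 \<longrightarrow> 1 = (1::nat) \<longrightarrow> \<not> (f 3 5 = 2 \<and> f 5 3 = 2))" (is ?south_east)
    and "(f 4 2 = 3 \<longrightarrow> f 5 3 = f 3 1) \<and> (f 4 2 = 2 \<longrightarrow> \<not> (f 5 3 = 3 - 2 \<and> f 3 1 = 3 - 2)) \<and>
      (f 5 1 = 1 \<longrightarrow> 2 = (1::nat) \<longrightarrow> \<not> (f 5 3 = 2 \<and> f 3 1 = 2))" (is ?south_west)
    and "(f 2 2 = 3 \<longleftrightarrow> f 2 4 = 3) \<and> (f 2 4 = 3 \<longleftrightarrow> f 4 4 = 3) \<and> (f 4 4 = 3 \<longleftrightarrow> f 4 2 = 3)" (is ?ring)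
proof -
  have "list_all (\<lambda>(p, q). f p (q + 1) \<noteq> f p q) cross_right"
    "list_all (\<lambda>(p, q). f (p + 1) q \<noteq> f p q) cross_down"
    using f by (auto simp: cross_coloring_def list_all_iff)
  note reversed = this[unfolded cross_right_def cross_down_def, simplified]
  note f' = f[unfolded cross_coloring_def cross_sites_def cross_right_def cross_down_def, simplified] reversed
  show ?north_west
    by (rule cross_corner[of "f 3 1" "f 1 3" 1 "f 2 2" "f 2 1" "f 1 2" "f 1 1" "f 2 0" "f 1 0" "f 0 0" "f 0 1" "f 0 2"])
      (use assms(2) in \<open>simp_all add: f'\<close>)
  show ?north_east
    by (rule cross_corner[of "f 1 3" "f 3 5" 2 "f 2 4" "f 1 4" "f 2 5" "f 1 5" "f 0 4" "f 0 5" "f 0 6" "f 1 6" "f 2 6"])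
      (simp_all add: f')
  show ?south_east
    by (rule cross_corner[of "f 3 5" "f 5 3" 1 "f 4 4" "f 4 5" "f 5 4" "f 5 5" "f 4 6" "f 5 6" "f 6 6" "f 6 5" "f 6 4"])
      (simp_all add: f')
  show ?south_west
    by (rule cross_corner[of "f 5 3" "f 3 1" 2 "f 4 2" "f 5 2" "f 4 1" "f 5 1" "f 6 2" "f 6 1" "f 6 0" "f 5 0" "f 4 0"])
      (simp_all add: f')
  show ?ring
    by (rule cross_ring[of "f 2 2" "f 2 3" "f 2 4" "f 3 4" "f 4 4" "f 4 3" "f 4 2" "f 3 2"]) (simp_all add: f')
qed

lemma cross_arms:
  assumes f: "cross_coloring f" and "f 1 1 = 1 \<or> f 1 1 = 2"
  shows "f 3 1 = f 3 5 \<and> f 1 3 = f 5 3" "f 1 1 = 1 \<Longrightarrow> \<not> (f 3 1 = 2 \<and> f 1 3 = 2)"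
proof -
  note corners = cross_corners[OF assms]
  have arms: "f 3 1 = 1 \<or> f 3 1 = 2" "f 1 3 = 1 \<or> f 1 3 = 2" "f 3 5 = 1 \<or> f 3 5 = 2" "f 5 3 = 1 \<or> f 5 3 = 2"
    and ring: "f 2 2 = 1 \<or> f 2 2 = 3" "f 2 4 = 2 \<or> f 2 4 = 3" "f 4 4 = 1 \<or> f 4 4 = 3" "f 4 2 = 2 \<or> f 4 2 = 3"
    using f by (simp_all add: cross_coloring_def cross_sites_def)
  show "f 3 1 = f 3 5 \<and> f 1 3 = f 5 3"
  proof (cases "f 2 2 = 3")
    case True
    then show ?thesis using corners by simp
  next
    case False
    then have "f 2 2 = 1" "f 2 4 = 2" "f 4 4 = 1" "f 4 2 = 2" using corners(5) ring by metis+
    then have "\<not> (f 3 1 = 2 \<and> f 1 3 = 2)" "\<not> (f 1 3 = 1 \<and> f 3 5 = 1)"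
      "\<not> (f 3 5 = 2 \<and> f 5 3 = 2)" "\<not> (f 5 3 = 1 \<and> f 3 1 = 1)"
      using corners(1-4) by (simp_all add: One_nat_def)
    then show ?thesis using arms by metis
  qed
  show "f 1 1 = 1 \<Longrightarrow> \<not> (f 3 1 = 2 \<and> f 1 3 = 2)" using corners(1) by simp
qed

lemma tile_rel_cross:
  assumes "gadget_coloring k f" "k = Cross \<or> k = Nand"
  shows "tile_rel k (f 3 0 = 1) (f 0 3 = 1) (f 3 7 = 2) (f 7 3 = 2)"
proof -
  have f: "cross_coloring f"
    and center: "f 1 1 = 1 \<or> f 1 1 = 2" "k = Nand \<Longrightarrow> f 1 1 = 1"
    using assms by (auto simp: gadget_coloring_def cross_coloring_def)
  note f' = f[unfolded cross_coloring_def cross_sites_def cross_right_def cross_down_def, simplified]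
  have "(f 3 0 = 1) = (f 3 1 = 2)" "(f 0 3 = 1) = (f 1 3 = 2)"
    "(f 3 5 = 2) = (f 3 6 = 1)" "(f 3 6 = 1) = (f 3 7 = 2)"
    "(f 5 3 = 2) = (f 6 3 = 1)" "(f 6 3 = 1) = (f 7 3 = 2)"
    by (rule alternate; simp add: f')+
  then show ?thesis using assms(2) cross_arms[OF f center(1)] center(2) by auto
qed

lemma tile_rel_junction:
  assumes "gadget_coloring Junction f"
  shows "tile_rel Junction (f 3 0 = 1) (f 0 3 = 1) (f 3 7 = 2) (f 7 3 = 2)"
proof -
  note colors = assms[unfolded gadget_coloring_def, simplified]
  have "(f 3 0 = 1) = (f 3 1 = 2)" "(f 3 1 = 2) = (f 3 2 = 1)" "(f 3 2 = 1) = (f 3 3 = 2)"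
    "(f 3 3 = 2) = (f 3 4 = 1)" "(f 3 4 = 1) = (f 3 5 = 2)" "(f 3 5 = 2) = (f 3 6 = 1)"
    "(f 3 6 = 1) = (f 3 7 = 2)"
    "(f 0 3 = 1) = (f 1 3 = 2)" "(f 1 3 = 2) = (f 2 3 = 1)" "(f 2 3 = 1) = (f 3 3 = 2)"
    "(f 3 3 = 2) = (f 4 3 = 1)" "(f 4 3 = 1) = (f 5 3 = 2)" "(f 5 3 = 2) = (f 6 3 = 1)"
    "(f 6 3 = 1) = (f 7 3 = 2)"
    by (rule alternate; simp add: colors)+
  then show ?thesis by (simp only: tile_rel.simps)
qed

lemma tile_rel_disj:
  assumes "gadget_coloring Disj f"
  shows "tile_rel Disj (f 3 0 = 1) (f 0 3 = 1) (f 3 7 = 2) (f 7 3 = 2)"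
proof -
  note colors = assms[unfolded gadget_coloring_def, simplified]
  have "(f 0 3 = 1) = (f 1 3 = 2)" "(f 1 3 = 2) = (f 2 3 = 1)"
    "(f 5 3 = 2) = (f 6 3 = 1)" "(f 6 3 = 1) = (f 7 3 = 2)"
    by (rule alternate; simp add: colors)+
  moreover have "f 5 3 = 2 \<Longrightarrow> f 4 3 = 3" "f 3 0 \<noteq> 1 \<Longrightarrow> f 3 1 = 3" "f 3 1 = 3 \<Longrightarrow> f 3 2 = 1"
    "f 2 3 = 1 \<or> f 2 3 = 2" "f 3 3 = 1 \<or> f 3 3 = 2 \<or> f 3 3 = 3"
    "f 3 2 \<noteq> f 3 3" "f 2 3 \<noteq> f 3 3" "f 3 3 \<noteq> f 4 3"
    using colors by metis+
  ultimately show ?thesis unfolding tile_rel.simps by metis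
qed

lemma tile_rel_pass:
  assumes "gadget_coloring Pass f"
  shows "tile_rel Pass (f 3 0 = 1) (f 0 3 = 1) (f 3 7 = 2) (f 7 3 = 2)"
proof -
  note colors = assms[unfolded gadget_coloring_def, simplified]
  have "(f 0 3 = 1) = (f 1 3 = 2)" "(f 1 3 = 2) = (f 2 3 = 1)" "(f 2 3 = 1) = (f 3 3 = 2)"
    "(f 3 3 = 2) = (f 4 3 = 1)" "(f 4 3 = 1) = (f 5 3 = 2)" "(f 5 3 = 2) = (f 6 3 = 1)"
    "(f 6 3 = 1) = (f 7 3 = 2)"
    by (rule alternate; simp add: colors)+
  then show ?thesis by (simp only: tile_rel.simps)
qed

lemma tile_rel_of_gadget_coloring:
  assumes "gadget_coloring k f"
  shows "tile_rel k (f 3 0 = 1) (f 0 3 = 1) (f 3 7 = 2) (f 7 3 = 2)"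
proof (cases k)
  case Cross
  then show ?thesis by (intro tile_rel_cross[OF assms]) simp
next
  case Nand
  then show ?thesis by (intro tile_rel_cross[OF assms]) simp
next
  case Junction
  then show ?thesis using assms by (simp only: tile_rel_junction)
next
  case Disj
  then show ?thesis using assms by (simp only: tile_rel_disj)
next
  case Pass
  then show ?thesis using assms by (simp only: tile_rel_pass)
next
  case Cap
  then show ?thesis using assms by (simp add: gadget_coloring_def)
qed simp

subsection \<open>Completeness of the gadgets\<close>

definition port_coloring :: "bool \<Rightarrow> bool \<Rightarrow> bool \<Rightarrow> bool \<Rightarrow> (nat \<Rightarrow> nat \<Rightarrow> nat) \<Rightarrow> bool" where
  "port_coloring l t r b f \<longleftrightarrow> f 3 0 = (if l then 1 else 2) \<and> f 0 3 = (if t then 1 else 2) \<and>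
     f 3 7 = (if r then 2 else 1) \<and> f 7 3 = (if b then 2 else 1)"

definition cross_solution :: "bool \<Rightarrow> bool \<Rightarrow> nat list list" where
  "cross_solution l t = (if l then
     if t then
     [[1, 2, 3, 1, 3, 2, 1, 1],
      [2, 2, 1, 2, 1, 2, 2, 1],
      [3, 1, 3, 2, 3, 1, 3, 1],
      [1, 2, 1, 1, 1, 2, 1, 2],
      [3, 1, 3, 2, 3, 1, 3, 1],
      [2, 2, 1, 2, 1, 2, 2, 1],
      [1, 2, 3, 1, 3, 2, 1, 1],
      [1, 1, 1, 2, 1, 1, 1, 1]]
     else
     [[1, 2, 3, 2, 1, 2, 1, 1],
      [2, 1, 2, 1, 3, 2, 2, 1],
      [1, 3, 1, 3, 2, 1, 3, 1],
      [1, 2, 3, 1, 3, 2, 1, 2],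
      [3, 1, 2, 3, 1, 3, 1, 1],
      [2, 2, 3, 1, 2, 1, 2, 1],
      [1, 2, 1, 2, 3, 2, 1, 1],
      [1, 1, 1, 1, 1, 1, 1, 1]]
   else
     if t then
     [[2, 1, 2, 1, 3, 1, 2, 1],
      [1, 1, 3, 2, 1, 2, 1, 1],
      [3, 2, 1, 3, 2, 3, 2, 1],
      [2, 1, 3, 1, 3, 1, 2, 1],
      [2, 3, 2, 3, 1, 2, 3, 1],
      [1, 2, 1, 2, 3, 1, 1, 1],
      [2, 1, 3, 1, 2, 1, 2, 1],
      [1, 1, 1, 2, 1, 1, 1, 1]]
     else
     [[2, 1, 3, 2, 1, 2, 1, 1],
      [1, 1, 2, 1, 2, 1, 2, 1],
      [3, 2, 3, 2, 3, 2, 3, 1],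
      [2, 1, 1, 1, 1, 1, 2, 1],
      [3, 2, 3, 2, 3, 2, 3, 1],
      [1, 1, 2, 1, 2, 1, 1, 1],
      [2, 1, 3, 2, 3, 1, 2, 1],
      [1, 1, 1, 1, 1, 1, 1, 1]])"

definition disj_solution :: "bool \<Rightarrow> bool \<Rightarrow> bool \<Rightarrow> bool \<Rightarrow> nat \<Rightarrow> nat \<Rightarrow> nat" where
  "disj_solution l t r b p q =
     (if p = 3 then
        if q = 0 then (if l then 1 else 2) else if q = 1 then (if l then 2 else 3)
        else if q = 2 then (if l \<and> \<not> t then 3 else 1)
        else if q = 3 then (if l \<and> \<not> t then 1 else if b then 2 else 3)
        else (if r then 2 else 1)
      else if p = 0 \<or> p = 2 then (if t then 1 else 2) else if p = 1 then (if t then 2 else 1)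
      else if p = 4 then (if b then 3 else 2)
      else if p = 5 \<or> p = 7 then (if b then 2 else 1) else (if b then 1 else 2))"

definition wire_solution :: "bool \<Rightarrow> bool \<Rightarrow> bool \<Rightarrow> bool \<Rightarrow> nat \<Rightarrow> nat \<Rightarrow> nat" where
  "wire_solution l t r b p q =
     (if p = 3 \<and> q = 0 then (if l then 1 else 2) else if p = 3 \<and> q = 7 then (if r then 2 else 1)
      else if p = 7 then (if b then 2 else 1)
      else if (even (p + q) \<longleftrightarrow> t) then 2 else 1)"


lemma gadget_coloring_cross_solution:
  "gadget_coloring Cross (\<lambda>p q. cross_solution l t ! p ! q)"
  "\<not> (l \<and> t) \<Longrightarrow> gadget_coloring Nand (\<lambda>p q. cross_solution l t ! p ! q)"
  "port_coloring l t l t (\<lambda>p q. cross_solution l t ! p ! q)"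
  by (cases l; cases t; simp add: gadget_coloring_def port_coloring_def cross_solution_def
      cross_sites_def cross_right_def cross_down_def)+

lemma gadget_coloring_of_tile_rel:
  assumes "tile_rel k l t r b"
  shows "\<exists>f. gadget_coloring k f \<and> port_coloring l t r b f"
proof -
  have wire: "gadget_coloring k (wire_solution l t r b) \<and> port_coloring l t r b (wire_solution l t r b)"
    if "k = Free \<or> k = Junction \<or> k = Pass \<or> k = Cap"
    using that assms
    by (elim disjE; cases t; cases b; simp add: gadget_coloring_def port_coloring_def wire_solution_def)
  show ?thesis
  proof (cases k)
    case Cross
    then show ?thesis using assms gadget_coloring_cross_solution[of l t] by auto
  next
    case Nand
    then show ?thesis using assms gadget_coloring_cross_solution[of l t] by auto
  next
    case Disj
    then have "gadget_coloring k (disj_solution l t r b) \<and> port_coloring l t r b (disj_solution l t r b)"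
      using assms
      by (cases l; cases t; cases b) (simp_all add: gadget_coloring_def port_coloring_def disj_solution_def)
    then show ?thesis by blast
  qed (use wire in blast)+
qed

lemma tile_sites_bounds: "((p, q), cl) \<in> set (tile_sites k) \<Longrightarrow> p < 8 \<and> q < 8"
  by (cases k) (auto simp: cross_sites_def)

lemma tile_sites_range: "((p, q), (c, l)) \<in> set (tile_sites k) \<Longrightarrow> c \<in> {1, 2, 3} \<and> l \<le> 2"
  by (cases k) (auto simp: cross_sites_def)

lemma tile_right_bounds: "(p, q) \<in> set (tile_right k) \<Longrightarrow> p < 8 \<and> q < 7"
  by (cases k) (auto simp: cross_right_def)

lemma tile_down_bounds: "(p, q) \<in> set (tile_down k) \<Longrightarrow> p < 7 \<and> q < 8"
  by (cases k) (auto simp: cross_down_def)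

lemma distinct_tile_sites: "distinct (map fst (tile_sites k))"
  by (cases k) (simp_all add: cross_sites_def)

lemma tile_right_sites:
  assumes "(p, q) \<in> set (tile_right k)"
  shows "(p, q) \<in> fst ` set (tile_sites k)" "(p, Suc q) \<in> fst ` set (tile_sites k)"
proof -
  have "list_all (\<lambda>(p, q). (p, q) \<in> set (map fst (tile_sites k)) \<and>
      (p, Suc q) \<in> set (map fst (tile_sites k))) (tile_right k)"
    by (cases k; hypsubst; code_simp)
  then show "(p, q) \<in> fst ` set (tile_sites k)" "(p, Suc q) \<in> fst ` set (tile_sites k)"
    using assms by (auto simp only: list_all_iff set_map)
qed

lemma tile_down_sites:
  assumes "(p, q) \<in> set (tile_down k)"
  shows "(p, q) \<in> fst ` set (tile_sites k)" "(Suc p, q) \<in> fst ` set (tile_sites k)"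
proof -
  have "list_all (\<lambda>(p, q). (p, q) \<in> set (map fst (tile_sites k)) \<and>
      (Suc p, q) \<in> set (map fst (tile_sites k))) (tile_down k)"
    by (cases k; hypsubst; code_simp)
  then show "(p, q) \<in> fst ` set (tile_sites k)" "(Suc p, q) \<in> fst ` set (tile_sites k)"
    using assms by (auto simp only: list_all_iff set_map)
qed

lemma port_sites:
  "((3, 0), (3, 2)) \<in> set (tile_sites k)" "((3, 7), (3, 2)) \<in> set (tile_sites k)"
  "((0, 3), (3, 2)) \<in> set (tile_sites k) \<or> ((0, 3), (1, 0)) \<in> set (tile_sites k)"
  "((7, 3), (3, 2)) \<in> set (tile_sites k) \<or> ((7, 3), (1, 0)) \<in> set (tile_sites k)"
  by (cases k; simp add: cross_sites_def)+

lemma gadget_coloring_ports: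
  assumes "gadget_coloring k f"
  shows "f 3 0 = 1 \<or> f 3 0 = 2" "f 0 3 = 1 \<or> f 0 3 = 2" "f 3 7 = 1 \<or> f 3 7 = 2" "f 7 3 = 1 \<or> f 7 3 = 2"
proof -
  have "allowed c l (f p q)" if "((p, q), (c, l)) \<in> set (tile_sites k)" for p q c l
    using assms that by (auto simp: gadget_coloring_def list_all_iff)
  then show "f 3 0 = 1 \<or> f 3 0 = 2" "f 0 3 = 1 \<or> f 0 3 = 2" "f 3 7 = 1 \<or> f 3 7 = 2" "f 7 3 = 1 \<or> f 7 3 = 2"
    using port_sites[of k] by (metis allowed_simps(1,5))+
qed

end

section \<open>From boolean tilings to list colorings\<close>

definition tile_constraint :: "tile \<Rightarrow> nat \<Rightarrow> nat \<Rightarrow> nat \<times> nat" where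
  "tile_constraint k p q = (case map_of (tile_sites k) (p, q) of Some cl \<Rightarrow> cl | None \<Rightarrow> (1, 0))"

definition tile_site :: "tile \<Rightarrow> bool \<Rightarrow> bool \<Rightarrow> nat \<Rightarrow> nat \<Rightarrow> site" where
  "tile_site k last_row last_col p q =
     \<lparr>site_color = fst (tile_constraint k p q), pendants = snd (tile_constraint k p q),
      right_edge = ((p, q) \<in> set (tile_right k) \<or> p = 3 \<and> q = 7 \<and> \<not> last_col),
      down_edge = ((p, q) \<in> set (tile_down k) \<or> p = 7 \<and> q = 3 \<and> \<not> last_row)\<rparr>"

definition tile_picture :: "nat \<Rightarrow> nat \<Rightarrow> (nat \<Rightarrow> nat \<Rightarrow> tile) \<Rightarrow> nat \<Rightarrow> nat \<Rightarrow> site" where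
  "tile_picture m n \<kappa> i j =
     tile_site (\<kappa> (i div 8) (j div 8)) (Suc (i div 8) = m) (Suc (j div 8) = n) (i mod 8) (j mod 8)"

definition boolean_tiling ::
    "nat \<Rightarrow> nat \<Rightarrow> (nat \<Rightarrow> nat \<Rightarrow> tile) \<Rightarrow> (nat \<Rightarrow> nat \<Rightarrow> bool) \<Rightarrow> (nat \<Rightarrow> nat \<Rightarrow> bool) \<Rightarrow> bool" where
  "boolean_tiling m n \<kappa> h v \<longleftrightarrow>
     (\<forall>I<m. \<forall>J<n. tile_rel (\<kappa> I J) (h I J) (v I J) (h I (Suc J)) (v (Suc I) J))"

lemma tile_constraint_site: "((p, q), cl) \<in> set (tile_sites k) \<Longrightarrow> tile_constraint k p q = cl"
  unfolding tile_constraint_def using map_of_is_SomeI[OF distinct_tile_sites] by fastforce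

lemma tile_constraint_no_site: "(p, q) \<notin> fst ` set (tile_sites k) \<Longrightarrow> tile_constraint k p q = (1, 0)"
  unfolding tile_constraint_def by (simp add: map_of_eq_None_iff[THEN iffD2])

lemma tile_constraint_range: "fst (tile_constraint k p q) \<in> {1, 2, 3}" "snd (tile_constraint k p q) \<le> 2"
proof -
  have "fst (tile_constraint k p q) \<in> {1, 2, 3} \<and> snd (tile_constraint k p q) \<le> 2"
  proof (cases "(p, q) \<in> fst ` set (tile_sites k)")
    case True
    then obtain c l where "((p, q), (c, l)) \<in> set (tile_sites k)" by auto
    then show ?thesis using tile_constraint_site tile_sites_range by fastforce
  qed (simp add: tile_constraint_no_site)
  then show "fst (tile_constraint k p q) \<in> {1, 2, 3}" "snd (tile_constraint k p q) \<le> 2" by blast+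
qed

lemma picture_tile_picture:
  assumes "0 < m" "0 < n"
  shows "picture (m * 8) (n * 8) (tile_picture m n \<kappa>)"
proof
  fix i j
  show "site_color (tile_picture m n \<kappa> i j) \<in> {1, 2, 3}" "pendants (tile_picture m n \<kappa> i j) \<le> 2"
    using tile_constraint_range by (simp_all add: tile_picture_def tile_site_def)
  have last: "Suc k < N * 8 \<or> Suc (k div 8) = N \<and> k mod 8 = 7" if "k < N * 8" for k N :: nat
  proof (cases "Suc k = N * 8")
    case True
    then obtain N' where "N = Suc N'" by (cases N) auto
    then have "k = N' * 8 + 7" using True by simp
    then show ?thesis using \<open>N = Suc N'\<close> by simp
  qed (use that in linarith)
  show "Suc j < n * 8" if "j < n * 8" "right_edge (tile_picture m n \<kappa> i j)"
    using last[of j n] that tile_right_bounds[of "i mod 8" "j mod 8" "\<kappa> (i div 8) (j div 8)"]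
    by (auto simp: tile_picture_def tile_site_def)
  show "Suc i < m * 8" if "i < m * 8" "down_edge (tile_picture m n \<kappa> i j)"
    using last[of i m] that tile_down_bounds[of "i mod 8" "j mod 8" "\<kappa> (i div 8) (j div 8)"]
    by (auto simp: tile_picture_def tile_site_def)
qed (use assms in simp_all)

subsection \<open>List colorings of a tile picture\<close>

definition tile_coloring :: "tile \<Rightarrow> (nat \<Rightarrow> nat \<Rightarrow> nat) \<Rightarrow> bool" where
  "tile_coloring k g \<longleftrightarrow>
     (\<forall>p<8. \<forall>q<8. allowed (fst (tile_constraint k p q)) (snd (tile_constraint k p q)) (g p q)) \<and>
     (\<forall>p q. (p, q) \<in> set (tile_right k) \<longrightarrow> g p q \<noteq> g p (Suc q)) \<and>
     (\<forall>p q. (p, q) \<in> set (tile_down k) \<longrightarrow> g p q \<noteq> g (Suc p) q)"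

definition block :: "(nat \<Rightarrow> nat \<Rightarrow> 'a) \<Rightarrow> nat \<Rightarrow> nat \<Rightarrow> nat \<Rightarrow> nat \<Rightarrow> 'a" where
  "block f I J p q = f (I * 8 + p) (J * 8 + q)"

lemma tile_picture_block:
  assumes "p < 8" "q < 8"
  shows "tile_picture m n \<kappa> (I * 8 + p) (J * 8 + q) = tile_site (\<kappa> I J) (Suc I = m) (Suc J = n) p q"
  unfolding tile_picture_def using assms by (simp only: row_major_div_mod)

lemma gadget_coloring_of_tile_coloring:
  assumes "tile_coloring k g"
  shows "gadget_coloring k g"
proof -
  have "allowed c l (g p q)" if "((p, q), (c, l)) \<in> set (tile_sites k)" for p q c l
    using assms tile_sites_bounds[OF that] tile_constraint_site[OF that]
    unfolding tile_coloring_def by (metis fst_conv snd_conv)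
  then show ?thesis using assms by (auto simp: gadget_coloring_def tile_coloring_def list_all_iff)
qed

lemma tile_coloring_of_gadget_coloring:
  assumes g: "gadget_coloring k g"
  shows "tile_coloring k (\<lambda>p q. if (p, q) \<in> fst ` set (tile_sites k) then g p q else 1)" (is "tile_coloring k ?g")
  unfolding tile_coloring_def
proof (intro conjI allI impI ballI)
  fix p q :: nat
  show "allowed (fst (tile_constraint k p q)) (snd (tile_constraint k p q)) (?g p q)"
  proof (cases "(p, q) \<in> fst ` set (tile_sites k)")
    case True
    then obtain c l where site: "((p, q), (c, l)) \<in> set (tile_sites k)" by auto
    then have "allowed c l (g p q)" using g by (auto simp: gadget_coloring_def list_all_iff)
    then show ?thesis using True tile_constraint_site[OF site] by simp
  qed (simp add: tile_constraint_no_site allowed_def)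
next
  show "?g p q \<noteq> ?g p (Suc q)" if "(p, q) \<in> set (tile_right k)" for p q
    using g that tile_right_sites[OF that] by (auto simp: gadget_coloring_def list_all_iff)
  show "?g p q \<noteq> ?g (Suc p) q" if "(p, q) \<in> set (tile_down k)" for p q
    using g that tile_down_sites[OF that] by (auto simp: gadget_coloring_def list_all_iff)
qed

lemma list_coloring_tile_pictureD:
  assumes f: "list_coloring (m * 8) (n * 8) (tile_picture m n \<kappa>) f" and I: "I < m" and J: "J < n"
  shows "tile_coloring (\<kappa> I J) (block f I J)"
    and "Suc J < n \<Longrightarrow> block f I J 3 7 \<noteq> block f I (Suc J) 3 0"
    and "Suc I < m \<Longrightarrow> block f I J 7 3 \<noteq> block f (Suc I) J 0 3"
proof -
  have site: "allowed (fst (tile_constraint (\<kappa> I J) p q)) (snd (tile_constraint (\<kappa> I J) p q)) (block f I J p q)"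
    "(p, q) \<in> set (tile_right (\<kappa> I J)) \<or> p = 3 \<and> q = 7 \<and> Suc J \<noteq> n \<Longrightarrow> block f I J p q \<noteq> block f I J p (Suc q)"
    "(p, q) \<in> set (tile_down (\<kappa> I J)) \<or> p = 7 \<and> q = 3 \<and> Suc I \<noteq> m \<Longrightarrow> block f I J p q \<noteq> block f I J (Suc p) q"
    if p: "p < 8" and q: "q < 8" for p q
    using f[unfolded list_coloring_def, rule_format, OF row_major_less[OF I p] row_major_less[OF J q]]
    unfolding tile_picture_block[OF p q] by (auto simp: tile_site_def block_def)
  show "tile_coloring (\<kappa> I J) (block f I J)"
    unfolding tile_coloring_def
  proof (intro conjI allI impI ballI)
    show "block f I J p q \<noteq> block f I J p (Suc q)" if "(p, q) \<in> set (tile_right (\<kappa> I J))" for p q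
      using that site(2)[of p q] tile_right_bounds[OF that] by simp
    show "block f I J p q \<noteq> block f I J (Suc p) q" if "(p, q) \<in> set (tile_down (\<kappa> I J))" for p q
      using that site(3)[of p q] tile_down_bounds[OF that] by simp
  qed (rule site(1))
  show "block f I J 3 7 \<noteq> block f I (Suc J) 3 0" if "Suc J < n"
    using site(2)[of 3 7] that by (simp add: block_def add.commute)
  show "block f I J 7 3 \<noteq> block f (Suc I) J 0 3" if "Suc I < m"
    using site(3)[of 7 3] that by (simp add: block_def add.commute)
qed

lemma list_coloring_tile_pictureI:
  assumes tiles: "\<And>I J. I < m \<Longrightarrow> J < n \<Longrightarrow> tile_coloring (\<kappa> I J) (block f I J)"
    and right: "\<And>I J. I < m \<Longrightarrow> Suc J < n \<Longrightarrow> block f I J 3 7 \<noteq> block f I (Suc J) 3 0"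
    and down: "\<And>I J. Suc I < m \<Longrightarrow> J < n \<Longrightarrow> block f I J 7 3 \<noteq> block f (Suc I) J 0 3"
  shows "list_coloring (m * 8) (n * 8) (tile_picture m n \<kappa>) f"
  unfolding list_coloring_def
proof (intro allI impI)
  fix i j assume "i < m * 8" "j < n * 8"
  then obtain I p J q where I: "I < m" and p: "p < 8" and i: "i = I * 8 + p"
    and J: "J < n" and q: "q < 8" and j: "j = J * 8 + q"
    by (elim row_major_cases)
  have tile: "tile_coloring (\<kappa> I J) (block f I J)" using I J by (rule tiles)
  have "block f I J p q \<noteq> block f I J p (Suc q)"
    if "(p, q) \<in> set (tile_right (\<kappa> I J)) \<or> p = 3 \<and> q = 7 \<and> Suc J \<noteq> n"
    using that tile right[OF I] J by (auto simp: tile_coloring_def block_def)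
  moreover have "block f I J p q \<noteq> block f I J (Suc p) q"
    if "(p, q) \<in> set (tile_down (\<kappa> I J)) \<or> p = 7 \<and> q = 3 \<and> Suc I \<noteq> m"
    using that tile down[OF _ J] I by (auto simp: tile_coloring_def block_def)
  moreover have "allowed (fst (tile_constraint (\<kappa> I J) p q)) (snd (tile_constraint (\<kappa> I J) p q)) (block f I J p q)"
    using tile p q by (simp add: tile_coloring_def)
  ultimately show "allowed (site_color (tile_picture m n \<kappa> i j)) (pendants (tile_picture m n \<kappa> i j)) (f i j) \<and>
      (right_edge (tile_picture m n \<kappa> i j) \<longrightarrow> f i j \<noteq> f i (Suc j)) \<and>
      (down_edge (tile_picture m n \<kappa> i j) \<longrightarrow> f i j \<noteq> f (Suc i) j)"
    unfolding i j tile_picture_block[OF p q] by (simp add: tile_site_def block_def)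
qed

lemma list_coloring_imp_boolean_tiling:
  assumes f: "list_coloring (m * 8) (n * 8) (tile_picture m n \<kappa>) f"
  shows "\<exists>h v. boolean_tiling m n \<kappa> h v"
proof -
  define h where "h I J = (if J = 0 then block f I J 3 0 = 1 else block f I (J - 1) 3 7 = 2)" for I J
  define v where "v I J = (if I = 0 then block f I J 0 3 = 1 else block f (I - 1) J 7 3 = 2)" for I J
  have gadget: "gadget_coloring (\<kappa> I J) (block f I J)" if "I < m" "J < n" for I J
    using list_coloring_tile_pictureD(1)[OF f that] by (rule gadget_coloring_of_tile_coloring)
  have left: "h I J = (block f I J 3 0 = 1)" if "I < m" "J < n" for I J
  proof (cases J)
    case (Suc J')
    then show ?thesis
      using list_coloring_tile_pictureD(2)[OF f, of I J'] gadget_coloring_ports(1)[OF gadget[OF that]]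
        gadget_coloring_ports(3)[OF gadget[of I J']] that
      by (auto simp: h_def)
  qed (simp add: h_def)
  have upper: "v I J = (block f I J 0 3 = 1)" if "I < m" "J < n" for I J
  proof (cases I)
    case (Suc I')
    then show ?thesis
      using list_coloring_tile_pictureD(3)[OF f, of I' J] gadget_coloring_ports(2)[OF gadget[OF that]]
        gadget_coloring_ports(4)[OF gadget[of I' J]] that
      by (auto simp: v_def)
  qed (simp add: v_def)
  have "boolean_tiling m n \<kappa> h v"
    unfolding boolean_tiling_def
    using tile_rel_of_gadget_coloring[OF gadget] left upper by (simp add: h_def v_def)
  then show ?thesis by blast
qed

lemma tile_coloring_of_tile_rel:
  assumes "tile_rel k l t r b"
  shows "\<exists>g. tile_coloring k g \<and> port_coloring l t r b g"
proof -
  obtain g where g: "gadget_coloring k g" "port_coloring l t r b g"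
    using gadget_coloring_of_tile_rel[OF assms] by blast
  have "{(3, 0), (0, 3), (3, 7), (7, 3)} \<subseteq> fst ` set (tile_sites k)" using port_sites[of k] by force
  then have "port_coloring l t r b (\<lambda>p q. if (p, q) \<in> fst ` set (tile_sites k) then g p q else 1)"
    using g(2) by (simp add: port_coloring_def)
  then show ?thesis using tile_coloring_of_gadget_coloring[OF g(1)] by blast
qed

lemma tile_coloring_cong:
  assumes "tile_coloring k g" and eq: "\<And>p q. p < 8 \<Longrightarrow> q < 8 \<Longrightarrow> g' p q = g p q"
  shows "tile_coloring k g'"
proof -
  have "g' p q = g p q \<and> g' p (Suc q) = g p (Suc q)" if "(p, q) \<in> set (tile_right k)" for p q
    using tile_right_bounds[OF that] by (simp add: eq)
  moreover have "g' p q = g p q \<and> g' (Suc p) q = g (Suc p) q" if "(p, q) \<in> set (tile_down k)" for p q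
    using tile_down_bounds[OF that] by (simp add: eq)
  ultimately show ?thesis using assms(1) by (simp add: tile_coloring_def eq)
qed

lemma boolean_tiling_imp_list_coloring:
  assumes "boolean_tiling m n \<kappa> h v"
  shows "\<exists>f. list_coloring (m * 8) (n * 8) (tile_picture m n \<kappa>) f"
proof -
  have "\<exists>g. tile_coloring (\<kappa> I J) g \<and> port_coloring (h I J) (v I J) (h I (Suc J)) (v (Suc I) J) g"
    if "I < m" "J < n" for I J
    using assms that unfolding boolean_tiling_def by (intro tile_coloring_of_tile_rel) blast
  then obtain F where F: "tile_coloring (\<kappa> I J) (F I J)"
    "port_coloring (h I J) (v I J) (h I (Suc J)) (v (Suc I) J) (F I J)" if "I < m" "J < n" for I J
    by metis
  define f where "f i j = F (i div 8) (j div 8) (i mod 8) (j mod 8)" for i j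
  have block: "block f I J p q = F I J p q" if "p < 8" "q < 8" for I J p q
    unfolding block_def f_def using that by (simp only: row_major_div_mod)
  have "list_coloring (m * 8) (n * 8) (tile_picture m n \<kappa>) f"
  proof (rule list_coloring_tile_pictureI)
    fix I J
    show "tile_coloring (\<kappa> I J) (block f I J)" if "I < m" "J < n"
      using F(1)[OF that] block by (rule tile_coloring_cong)
    show "block f I J 3 7 \<noteq> block f I (Suc J) 3 0" if "I < m" "Suc J < n"
      using F(2)[of I J] F(2)[of I "Suc J"] that by (simp add: block port_coloring_def)
    show "block f I J 7 3 \<noteq> block f (Suc I) J 0 3" if "Suc I < m" "J < n"
      using F(2)[of I J] F(2)[of "Suc I" J] that by (simp add: block port_coloring_def)
  qed
  then show ?thesis by blast
qed

theorem list_coloring_iff_boolean_tiling: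
  "(\<exists>f. list_coloring (m * 8) (n * 8) (tile_picture m n \<kappa>) f) \<longleftrightarrow> (\<exists>h v. boolean_tiling m n \<kappa> h v)"
  using list_coloring_imp_boolean_tiling boolean_tiling_imp_list_coloring by blast

section \<open>From label tilings to boolean tilings\<close>

definition label_tiling :: "'l set \<Rightarrow> ('l \<Rightarrow> 'l \<Rightarrow> bool) \<Rightarrow> ('l \<Rightarrow> 'l \<Rightarrow> bool) \<Rightarrow> nat \<Rightarrow> nat \<Rightarrow>
    (nat \<Rightarrow> nat \<Rightarrow> 'l set) \<Rightarrow> (nat \<Rightarrow> nat \<Rightarrow> 'l) \<Rightarrow> bool" where
  "label_tiling \<Lambda> H V R W L s \<longleftrightarrow>
     (\<forall>i<R. \<forall>j<W. s i j \<in> \<Lambda> \<and> s i j \<in> L i j \<and> (Suc j < W \<longrightarrow> H (s i j) (s i (Suc j))) \<and>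
        (Suc i < R \<longrightarrow> V (s i j) (s (Suc i) j)))"

lemma label_tiling_bij_betw:
  assumes "bij_betw \<phi> \<Lambda>' \<Lambda>"
  shows "(\<exists>f. label_tiling \<Lambda> H V R W L f) \<longleftrightarrow>
    (\<exists>s. label_tiling \<Lambda>' (\<lambda>x y. H (\<phi> x) (\<phi> y)) (\<lambda>x y. V (\<phi> x) (\<phi> y)) R W (\<lambda>i j. \<phi> -` L i j) s)"
    (is "?lhs \<longleftrightarrow> ?rhs")
proof
  assume ?lhs
  then obtain f where f: "label_tiling \<Lambda> H V R W L f" by blast
  define s where "s i j = inv_into \<Lambda>' \<phi> (f i j)" for i j
  have "s i j \<in> \<Lambda>' \<and> \<phi> (s i j) = f i j" if "f i j \<in> \<Lambda>" for i j
    using that bij_betw_inv_into_right[OF assms] bij_betwE[OF bij_betw_inv_into[OF assms]]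
    unfolding s_def by auto
  then have "label_tiling \<Lambda>' (\<lambda>x y. H (\<phi> x) (\<phi> y)) (\<lambda>x y. V (\<phi> x) (\<phi> y)) R W (\<lambda>i j. \<phi> -` L i j) s"
    using f unfolding label_tiling_def by simp
  then show ?rhs by blast
next
  assume ?rhs
  then obtain s where "label_tiling \<Lambda>' (\<lambda>x y. H (\<phi> x) (\<phi> y)) (\<lambda>x y. V (\<phi> x) (\<phi> y)) R W (\<lambda>i j. \<phi> -` L i j) s"
    by blast
  then have "label_tiling \<Lambda> H V R W L (\<lambda>i j. \<phi> (s i j))"
    using bij_betwE[OF assms] unfolding label_tiling_def by simp
  then show ?lhs by blast
qed

text \<open>
  A cell with label set \<open>{..<m}\<close> becomes a block of \<open>3 m + 2\<close> by \<open>2 m + 2\<close> tiles; a wire that carries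
  a label \<open>x\<close> consists of \<open>m\<close> boolean wires of which number \<open>x\<close> is true. In the first \<open>m\<close> rows after row 0
  the label of the upper neighbor (vertical wires) meets the label of the cell (horizontal wires),
  in the next group of rows the label of the left neighbor (horizontal) meets the label of the cell
  (vertical). The last column collects the disjunction of the admissible labels.
\<close>

definition cell_tile ::
    "nat \<Rightarrow> (nat \<Rightarrow> nat \<Rightarrow> bool) \<Rightarrow> (nat \<Rightarrow> nat \<Rightarrow> bool) \<Rightarrow> nat set \<Rightarrow> nat \<Rightarrow> nat \<Rightarrow> tile" where
  "cell_tile m H V L a b =
     (if a = 0 then (if b < m then Cross else if b = 2 * m + 1 then Cap else Free)
      else if a \<le> m then
        (if b < m then (if V b (a - 1) then Cross else Nand)
         else if b = m then Cross
         else if b \<le> 2 * m then (if b = m + a then Junction else Cross)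
         else if a - 1 \<in> L then Disj else Pass)
      else if a = m + 1 then (if b \<le> m then Free else if b \<le> 2 * m then Cross else Cap)
      else if a \<le> 2 * m + 1 then
        (if b < m then (if H (a - (m + 2)) b then Cross else Nand)
         else if b = m then Free
         else if b \<le> 2 * m then (if b + 1 = a then Junction else Cross)
         else Cross)
      else
        (if b < m then (if 2 * m + 2 + b = a then Junction else Cross)
         else if b = m then Cross
         else if b \<le> 2 * m then (if m + 1 + b = a then Junction else Cross)
         else Free))"

definition expanded_tile ::
    "nat \<Rightarrow> (nat \<Rightarrow> nat \<Rightarrow> bool) \<Rightarrow> (nat \<Rightarrow> nat \<Rightarrow> bool) \<Rightarrow> (nat \<Rightarrow> nat \<Rightarrow> nat set) \<Rightarrow> nat \<Rightarrow> nat \<Rightarrow> tile" where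
  "expanded_tile m H V L I J = cell_tile m H V (L (I div (3 * m + 2)) (J div (2 * m + 2)))
     (I mod (3 * m + 2)) (J mod (2 * m + 2))"

lemma expanded_tile_block:
  assumes "a < 3 * m + 2" "b < 2 * m + 2"
  shows "expanded_tile m H V L (i * (3 * m + 2) + a) (j * (2 * m + 2) + b) = cell_tile m H V (L i j) a b"
  unfolding expanded_tile_def row_major_div_mod[OF assms(1)] row_major_div_mod[OF assms(2)] ..

subsection \<open>Reading off the labels\<close>

lemma constant_between:
  assumes "\<And>b. lo \<le> b \<Longrightarrow> b < hi \<Longrightarrow> f (Suc b) = f b" "lo \<le> b" "b \<le> hi"
  shows "f b = f lo"
  using assms(2,3)
proof (induction b rule: dec_induct)
  case (step n)
  then show ?case using assms(1)[of n] by simp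
qed simp

locale cell_wires =
  fixes m :: nat and H V :: "nat \<Rightarrow> nat \<Rightarrow> bool" and L :: "nat set" and h v :: "nat \<Rightarrow> nat \<Rightarrow> bool"
  assumes tiles: "\<And>a b. a < 3 * m + 2 \<Longrightarrow> b < 2 * m + 2 \<Longrightarrow>
    tile_rel (cell_tile m H V L a b) (h a b) (v a b) (h a (Suc b)) (v (Suc a) b)"
begin

definition label :: "nat \<Rightarrow> bool" where
  "label x = h (x + 1) 0"

lemma h_constant:
  assumes "\<And>b. lo \<le> b \<Longrightarrow> b < hi \<Longrightarrow> cell_tile m H V L a b \<in> {Cross, Nand, Junction}"
    and "a < 3 * m + 2" "hi \<le> 2 * m + 2" "lo \<le> b" "b \<le> hi"
  shows "h a b = h a lo"
proof (rule constant_between[of lo hi])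
  fix b assume b: "lo \<le> b" "b < hi"
  then have "b < 2 * m + 2" using assms(3) by simp
  from tiles[OF assms(2) this] assms(1)[OF b] show "h a (Suc b) = h a b" by auto
qed (use assms(4,5) in simp_all)

lemma v_constant:
  assumes "\<And>a. lo \<le> a \<Longrightarrow> a < hi \<Longrightarrow> cell_tile m H V L a b \<in> {Cross, Nand, Junction}"
    and "b < 2 * m + 2" "hi \<le> 3 * m + 2" "lo \<le> a" "a \<le> hi"
  shows "v a b = v lo b"
proof (rule constant_between[of lo hi "\<lambda>a. v a b"])
  fix a assume a: "lo \<le> a" "a < hi"
  then have "a < 3 * m + 2" using assms(3) by simp
  from tiles[OF this assms(2)] assms(1)[OF a] show "v (Suc a) b = v a b" by auto
qed (use assms(4,5) in simp_all)

lemma junction_wires_eq: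
  assumes "cell_tile m H V L a b = Junction" "a < 3 * m + 2" "b < 2 * m + 2"
  shows "h a b = v a b"
  using tiles[OF assms(2,3)] unfolding assms(1) tile_rel.simps by blast

lemma nand_wires_exclusive:
  assumes "cell_tile m H V L a b = Nand" "a < 3 * m + 2" "b < 2 * m + 2"
  shows "\<not> (h a b \<and> v a b)"
  using tiles[OF assms(2,3)] unfolding assms(1) tile_rel.simps by blast

lemma h_label_row:
  assumes "x < m" "b \<le> 2 * m + 1"
  shows "h (x + 1) b = label x"
  unfolding label_def
  by (rule h_constant[of 0 "2 * m + 1"]) (use assms in \<open>auto simp: cell_tile_def\<close>)

lemma v_label_column:
  assumes "x < m" "1 \<le> a" "a \<le> 3 * m + 2"
  shows "v a (m + 1 + x) = label x"
proof -
  have const: "v a (m + 1 + x) = v 1 (m + 1 + x)" if "1 \<le> a" "a \<le> 3 * m + 2" for a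
    by (rule v_constant[of _ "3 * m + 2"]) (use assms(1) that in \<open>auto simp: cell_tile_def\<close>)
  have "h (x + 1) (m + 1 + x) = v (x + 1) (m + 1 + x)"
    by (rule junction_wires_eq) (use assms(1) in \<open>simp_all add: cell_tile_def\<close>)
  then show ?thesis
    using const[OF assms(2,3)] const[of "x + 1"] h_label_row[of x "m + 1 + x"] assms(1) by simp
qed

lemma h_right_row:
  assumes "x < m" "m + 1 \<le> b" "b \<le> 2 * m + 2"
  shows "h (m + 2 + x) b = label x"
proof -
  have const: "h (m + 2 + x) b = h (m + 2 + x) (m + 1)" if "m + 1 \<le> b" "b \<le> 2 * m + 2" for b
    by (rule h_constant[of _ "2 * m + 2"]) (use assms(1) that in \<open>auto simp: cell_tile_def\<close>)
  have "h (m + 2 + x) (m + 1 + x) = v (m + 2 + x) (m + 1 + x)"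
    by (rule junction_wires_eq) (use assms(1) in \<open>simp_all add: cell_tile_def\<close>)
  then show ?thesis
    using const[OF assms(2,3)] const[of "m + 1 + x"] v_label_column[of x "m + 2 + x"] assms(1) by simp
qed

lemma h_down_row:
  assumes "x < m" "b \<le> 2 * m + 1"
  shows "h (2 * m + 2 + x) b = label x"
proof -
  have const: "h (2 * m + 2 + x) b = h (2 * m + 2 + x) 0" if "b \<le> 2 * m + 1" for b
    by (rule h_constant[of _ "2 * m + 1"]) (use assms(1) that in \<open>auto simp: cell_tile_def\<close>)
  have "h (2 * m + 2 + x) (m + 1 + x) = v (2 * m + 2 + x) (m + 1 + x)"
    by (rule junction_wires_eq) (use assms(1) in \<open>simp_all add: cell_tile_def\<close>)
  then show ?thesis
    using const[OF assms(2)] const[of "m + 1 + x"] v_label_column[of x "2 * m + 2 + x"] assms(1) by simp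
qed

lemma v_down_column:
  assumes "x < m" "m + 2 \<le> a" "a \<le> 3 * m + 2"
  shows "v a x = label x"
proof -
  have const: "v a x = v (m + 2) x" if "m + 2 \<le> a" "a \<le> 3 * m + 2" for a
    by (rule v_constant[of _ "3 * m + 2"]) (use assms(1) that in \<open>auto simp: cell_tile_def\<close>)
  have "h (2 * m + 2 + x) x = v (2 * m + 2 + x) x"
    by (rule junction_wires_eq) (use assms(1) in \<open>simp_all add: cell_tile_def\<close>)
  then show ?thesis
    using const[OF assms(2,3)] const[of "2 * m + 2 + x"] h_down_row[of x x] assms(1) by simp
qed

lemma H_left_label:
  assumes x: "x < m" and y: "y < m" and "h (m + 2 + y) 0" "label x"
  shows "H y x"
proof (rule ccontr)
  assume "\<not> H y x"
  then have "\<not> (h (m + 2 + y) x \<and> v (m + 2 + y) x)"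
    by (intro nand_wires_exclusive) (use x y in \<open>simp_all add: cell_tile_def\<close>)
  moreover have "h (m + 2 + y) x = h (m + 2 + y) 0"
    by (rule h_constant[of 0 m]) (use x y in \<open>auto simp: cell_tile_def\<close>)
  ultimately show False using v_down_column[of x "m + 2 + y"] assms by simp
qed

lemma V_upper_label:
  assumes x: "x < m" and y: "y < m" and "v 0 y" "label x"
  shows "V y x"
proof (rule ccontr)
  assume "\<not> V y x"
  then have "\<not> (h (x + 1) y \<and> v (x + 1) y)"
    by (intro nand_wires_exclusive) (use x y in \<open>simp_all add: cell_tile_def\<close>)
  moreover have "v (x + 1) y = v 0 y"
    by (rule v_constant[of 0 "m + 1"]) (use x y in \<open>auto simp: cell_tile_def\<close>)
  ultimately show False using h_label_row[of x y] assms by simp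
qed

lemma admissible_label: "\<exists>x<m. x \<in> L \<and> label x"
proof (rule ccontr)
  assume none: "\<not> (\<exists>x<m. x \<in> L \<and> label x)"
  have "\<not> v (a + 1) (2 * m + 1)" if "a \<le> m" for a
    using that
  proof (induction a)
    case 0
    have "cell_tile m H V L 0 (2 * m + 1) = Cap" by (simp add: cell_tile_def)
    then show ?case using tiles[of 0 "2 * m + 1"] by simp
  next
    case (Suc a)
    have "\<not> label a \<or> a \<notin> L" using none Suc.prems by auto
    moreover have "cell_tile m H V L (a + 1) (2 * m + 1) = (if a \<in> L then Disj else Pass)"
      using Suc.prems by (simp add: cell_tile_def)
    ultimately show ?case
      using tiles[of "a + 1" "2 * m + 1"] Suc h_label_row[of a "2 * m + 1"] by (auto split: if_splits)
  qed
  moreover have "cell_tile m H V L (m + 1) (2 * m + 1) = Cap" by (simp add: cell_tile_def)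
  ultimately show False using tiles[of "m + 1" "2 * m + 1"] by simp
qed

end

lemma cell_wires_of_boolean_tiling:
  assumes "boolean_tiling (R * (3 * m + 2)) (W * (2 * m + 2)) (expanded_tile m H V L) h v" "i < R" "j < W"
  shows "cell_wires m H V (L i j) (\<lambda>a b. h (i * (3 * m + 2) + a) (j * (2 * m + 2) + b))
    (\<lambda>a b. v (i * (3 * m + 2) + a) (j * (2 * m + 2) + b))"
proof
  fix a b assume a: "a < 3 * m + 2" and b: "b < 2 * m + 2"
  show "tile_rel (cell_tile m H V (L i j) a b) (h (i * (3 * m + 2) + a) (j * (2 * m + 2) + b))
      (v (i * (3 * m + 2) + a) (j * (2 * m + 2) + b)) (h (i * (3 * m + 2) + a) (j * (2 * m + 2) + Suc b))
      (v (i * (3 * m + 2) + Suc a) (j * (2 * m + 2) + b))"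
    using assms(1)[unfolded boolean_tiling_def, rule_format,
        OF row_major_less[OF assms(2) a] row_major_less[OF assms(3) b]]
    unfolding expanded_tile_block[OF a b] by simp
qed

lemma boolean_tiling_imp_label_tiling:
  assumes hv: "boolean_tiling (R * (3 * m + 2)) (W * (2 * m + 2)) (expanded_tile m H V L) h v"
  shows "\<exists>s. label_tiling {..<m} H V R W L s"
proof -
  let ?P = "3 * m + 2" and ?Q = "2 * m + 2"
  define label where "label i j = cell_wires.label (\<lambda>a b. h (i * ?P + a) (j * ?Q + b))" for i j
  note wires = cell_wires_of_boolean_tiling[OF hv]
  have "\<exists>x. x < m \<and> x \<in> L i j \<and> label i j x" if "i < R" "j < W" for i j
    using cell_wires.admissible_label[OF wires[OF that]] unfolding label_def by blast
  then obtain s where s: "s i j < m" "s i j \<in> L i j" "label i j (s i j)" if "i < R" "j < W" for i j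
    by metis
  have "H (s i j) (s i (Suc j))" if i: "i < R" and j: "Suc j < W" for i j
  proof -
    have j': "j < W" using j by simp
    have "h (i * ?P + (m + 2 + s i j)) (j * ?Q + (2 * m + 2))"
      using cell_wires.h_right_row[OF wires[OF i j'] s(1)[OF i j'], of "2 * m + 2"] s(3)[OF i j']
      by (simp add: label_def)
    moreover have "j * ?Q + (2 * m + 2) = Suc j * ?Q + 0" by simp
    ultimately have "h (i * ?P + (m + 2 + s i j)) (Suc j * ?Q + 0)" by metis
    then show ?thesis
      using cell_wires.H_left_label[OF wires[OF i j] s(1)[OF i j] s(1)[OF i j']] s(3)[OF i j]
      unfolding label_def by blast
  qed
  moreover have "V (s i j) (s (Suc i) j)" if i: "Suc i < R" and j: "j < W" for i j
  proof -
    have i': "i < R" using i by simp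
    have "v (i * ?P + (3 * m + 2)) (j * ?Q + s i j)"
      using cell_wires.v_down_column[OF wires[OF i' j] s(1)[OF i' j], of "3 * m + 2"] s(3)[OF i' j]
      by (simp add: label_def)
    moreover have "i * ?P + (3 * m + 2) = Suc i * ?P + 0" by simp
    ultimately have "v (Suc i * ?P + 0) (j * ?Q + s i j)" by metis
    then show ?thesis
      using cell_wires.V_upper_label[OF wires[OF i j] s(1)[OF i j] s(1)[OF i' j]] s(3)[OF i j]
      unfolding label_def by blast
  qed
  ultimately have "label_tiling {..<m} H V R W L s" unfolding label_tiling_def using s by simp
  then show ?thesis by blast
qed

subsection \<open>Setting the wires\<close>

definition cell_h :: "nat \<Rightarrow> (nat \<Rightarrow> bool) \<Rightarrow> (nat \<Rightarrow> bool) \<Rightarrow> nat \<Rightarrow> nat \<Rightarrow> bool" where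
  "cell_h m left x a b =
     (if 1 \<le> a \<and> a \<le> m then x (a - 1)
      else if m + 2 \<le> a \<and> a \<le> 2 * m + 1 then (if b \<le> m then left (a - (m + 2)) else x (a - (m + 2)))
      else if 2 * m + 2 \<le> a then x (a - (2 * m + 2)) else False)"

definition cell_v :: "nat \<Rightarrow> (nat \<Rightarrow> bool) \<Rightarrow> (nat \<Rightarrow> bool) \<Rightarrow> nat \<Rightarrow> nat \<Rightarrow> bool" where
  "cell_v m up x a b =
     (if b < m then (if a \<le> m + 1 then up b else x b)
      else if b = m then False
      else if b \<le> 2 * m then (if a = 0 then up (b - (m + 1)) else x (b - (m + 1)))
      else a = 0 \<or> (a \<le> m + 1 \<and> (\<exists>y<a - 1. x y)))"

lemma cell_row_cases:
  fixes a m :: nat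
  assumes "a < 3 * m + 2"
  obtains (top) "a = 0" | (label) y where "y < m" "a = y + 1" | (middle) "a = m + 1"
    | (right) y where "y < m" "a = m + 2 + y" | (down) y where "y < m" "a = 2 * m + 2 + y"
proof -
  have offset: "\<exists>y<m. a = c + y" if "c \<le> a" "a < c + m" for c
    using that by (intro exI[of _ "a - c"]) linarith
  have "a = 0 \<or> (1 \<le> a \<and> a < 1 + m) \<or> a = m + 1 \<or> (m + 2 \<le> a \<and> a < m + 2 + m) \<or>
      (2 * m + 2 \<le> a \<and> a < 2 * m + 2 + m)"
    using assms by linarith
  then show thesis
    using that offset[of 1] offset[of "m + 2"] offset[of "2 * m + 2"] by (metis add.commute)
qed

lemma cell_column_cases:
  fixes b m :: nat
  assumes "b < 2 * m + 2"
  obtains (down) "b < m" | (gap) "b = m" | (label) z where "z < m" "b = m + 1 + z" | (last) "b = 2 * m + 1"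
proof -
  have "b < m \<or> b = m \<or> (m + 1 \<le> b \<and> b < m + 1 + m) \<or> b = 2 * m + 1" using assms by linarith
  moreover have "\<exists>z<m. b = m + 1 + z" if "m + 1 \<le> b" "b < m + 1 + m"
    using that by (intro exI[of _ "b - (m + 1)"]) linarith
  ultimately show thesis using that by blast
qed

lemma tile_rel_cell_tile:
  assumes x: "x < m" "x \<in> L" and H: "\<And>y. y < m \<Longrightarrow> left y \<Longrightarrow> H y x"
    and V: "\<And>y. y < m \<Longrightarrow> up y \<Longrightarrow> V y x" and ab: "a < 3 * m + 2" "b < 2 * m + 2"
  shows "tile_rel (cell_tile m H V L a b) (cell_h m left (\<lambda>y. y = x) a b) (cell_v m up (\<lambda>y. y = x) a b)
    (if Suc b < 2 * m + 2 then cell_h m left (\<lambda>y. y = x) a (Suc b) else cell_h m (\<lambda>y. y = x) next_right a 0)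
    (if Suc a < 3 * m + 2 then cell_v m up (\<lambda>y. y = x) (Suc a) b else cell_v m (\<lambda>y. y = x) next_down 0 b)"
    (is ?rel)
proof -
  have m: "0 < m" using x by simp
  note defs = cell_tile_def cell_h_def cell_v_def
  from ab(1) show ?rel
  proof (cases rule: cell_row_cases)
    case top
    from ab(2) show ?thesis by (cases rule: cell_column_cases) (use top m in \<open>simp_all add: defs\<close>)
  next
    case (label y)
    have "(\<exists>z<Suc y. z = x) \<longleftrightarrow> (\<exists>z<y. z = x) \<or> y = x" by (auto simp: less_Suc_eq)
    with ab(2) show ?thesis
      by (cases rule: cell_column_cases) (use label V m x in \<open>auto simp: defs\<close>)
  next
    case middle
    from ab(2) show ?thesis by (cases rule: cell_column_cases) (use middle m x in \<open>auto simp: defs\<close>)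
  next
    case (right y)
    from ab(2) show ?thesis by (cases rule: cell_column_cases) (use right H m in \<open>auto simp: defs\<close>)
  next
    case (down y)
    from ab(2) show ?thesis by (cases rule: cell_column_cases) (use down m in \<open>auto simp: defs\<close>)
  qed
qed

definition left_label :: "(nat \<Rightarrow> nat \<Rightarrow> nat) \<Rightarrow> nat \<Rightarrow> nat \<Rightarrow> nat \<Rightarrow> bool" where
  "left_label s i j y \<longleftrightarrow> 0 < j \<and> y = s i (j - 1)"

definition upper_label :: "(nat \<Rightarrow> nat \<Rightarrow> nat) \<Rightarrow> nat \<Rightarrow> nat \<Rightarrow> nat \<Rightarrow> bool" where
  "upper_label s i j y \<longleftrightarrow> 0 < i \<and> y = s (i - 1) j"

definition expanded_h :: "nat \<Rightarrow> (nat \<Rightarrow> nat \<Rightarrow> nat) \<Rightarrow> nat \<Rightarrow> nat \<Rightarrow> bool" where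
  "expanded_h m s I J = (let i = I div (3 * m + 2); j = J div (2 * m + 2)
     in cell_h m (left_label s i j) (\<lambda>y. y = s i j) (I mod (3 * m + 2)) (J mod (2 * m + 2)))"

definition expanded_v :: "nat \<Rightarrow> (nat \<Rightarrow> nat \<Rightarrow> nat) \<Rightarrow> nat \<Rightarrow> nat \<Rightarrow> bool" where
  "expanded_v m s I J = (let i = I div (3 * m + 2); j = J div (2 * m + 2)
     in cell_v m (upper_label s i j) (\<lambda>y. y = s i j) (I mod (3 * m + 2)) (J mod (2 * m + 2)))"

lemma expanded_block:
  assumes "a < 3 * m + 2" "b < 2 * m + 2"
  shows "expanded_h m s (i * (3 * m + 2) + a) (j * (2 * m + 2) + b) =
      cell_h m (left_label s i j) (\<lambda>y. y = s i j) a b"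
    and "expanded_v m s (i * (3 * m + 2) + a) (j * (2 * m + 2) + b) =
      cell_v m (upper_label s i j) (\<lambda>y. y = s i j) a b"
  unfolding expanded_h_def expanded_v_def row_major_div_mod[OF assms(1)] row_major_div_mod[OF assms(2)] Let_def
  by (rule refl)+

lemma expanded_h_Suc:
  assumes "a < 3 * m + 2" "b < 2 * m + 2"
  shows "expanded_h m s (i * (3 * m + 2) + a) (Suc (j * (2 * m + 2) + b)) =
    (if Suc b < 2 * m + 2 then cell_h m (left_label s i j) (\<lambda>y. y = s i j) a (Suc b)
     else cell_h m (\<lambda>y. y = s i j) (\<lambda>y. y = s i (Suc j)) a 0)"
proof (cases "Suc b < 2 * m + 2")
  case True
  then show ?thesis using expanded_block(1)[OF assms(1) True, of s i j] by simp
next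
  case False
  then have "Suc (j * (2 * m + 2) + b) = Suc j * (2 * m + 2) + 0" using assms(2) by simp
  moreover have "left_label s i (Suc j) = (\<lambda>y. y = s i j)" by (simp add: left_label_def fun_eq_iff)
  ultimately show ?thesis
    using expanded_block(1)[OF assms(1), of 0 s i "Suc j"] False by (simp only: if_False)
qed

lemma expanded_v_Suc:
  assumes "a < 3 * m + 2" "b < 2 * m + 2"
  shows "expanded_v m s (Suc (i * (3 * m + 2) + a)) (j * (2 * m + 2) + b) =
    (if Suc a < 3 * m + 2 then cell_v m (upper_label s i j) (\<lambda>y. y = s i j) (Suc a) b
     else cell_v m (\<lambda>y. y = s i j) (\<lambda>y. y = s (Suc i) j) 0 b)"
proof (cases "Suc a < 3 * m + 2")
  case True
  then show ?thesis using expanded_block(2)[OF True assms(2), of s i j] by simp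
next
  case False
  then have "Suc (i * (3 * m + 2) + a) = Suc i * (3 * m + 2) + 0" using assms(1) by simp
  moreover have "upper_label s (Suc i) j = (\<lambda>y. y = s i j)" by (simp add: upper_label_def fun_eq_iff)
  ultimately show ?thesis
    using expanded_block(2)[OF _ assms(2), of 0 s "Suc i" j] False by (simp only: if_False)
qed

lemma label_tiling_imp_boolean_tiling:
  assumes s: "label_tiling {..<m} H V R W L s"
  shows "boolean_tiling (R * (3 * m + 2)) (W * (2 * m + 2)) (expanded_tile m H V L)
    (expanded_h m s) (expanded_v m s)"
  unfolding boolean_tiling_def
proof (intro allI impI)
  fix I J assume "I < R * (3 * m + 2)" "J < W * (2 * m + 2)"
  then obtain i a j b where i: "i < R" and a: "a < 3 * m + 2" and I: "I = i * (3 * m + 2) + a"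
    and j: "j < W" and b: "b < 2 * m + 2" and J: "J = j * (2 * m + 2) + b"
    by (elim row_major_cases)
  have "H y (s i j)" if "left_label s i j y" for y
    using s i j that unfolding label_tiling_def left_label_def by (cases j) auto
  moreover have "V y (s i j)" if "upper_label s i j y" for y
    using s i j that unfolding label_tiling_def upper_label_def by (cases i) auto
  moreover have "s i j < m" "s i j \<in> L i j" using s i j unfolding label_tiling_def by auto
  ultimately show "tile_rel (expanded_tile m H V L I J) (expanded_h m s I J) (expanded_v m s I J)
      (expanded_h m s I (Suc J)) (expanded_v m s (Suc I) J)"
    unfolding I J expanded_tile_block[OF a b] expanded_block[OF a b] expanded_h_Suc[OF a b] expanded_v_Suc[OF a b]
    by (intro tile_rel_cell_tile a b)
qed

theorem boolean_tiling_iff_label_tiling: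
  "(\<exists>h v. boolean_tiling (R * (3 * m + 2)) (W * (2 * m + 2)) (expanded_tile m H V L) h v) \<longleftrightarrow>
   (\<exists>s. label_tiling {..<m} H V R W L s)"
  using boolean_tiling_imp_label_tiling label_tiling_imp_boolean_tiling by blast

section \<open>Runs of a Turing machine\<close>

definition next_action :: "tm \<Rightarrow> nat \<Rightarrow> nat list \<Rightarrow> nat \<times> (nat \<times> int) list" where
  "next_action M q ss = (if q = 1 then (1, map (\<lambda>a. (a, 0)) ss) else tm_delta M q ss)"

definition wf_config :: "tm \<Rightarrow> tm_config \<Rightarrow> bool" where
  "wf_config M c \<longleftrightarrow> fst c < tm_states M \<and> length (snd c) = tm_tapes M \<and>
     (\<forall>k<tm_tapes M. \<forall>z. fst (snd c ! k) z < tm_symbols M)"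

definition reads :: "tm_config \<Rightarrow> nat list" where
  "reads c = map tape_read (snd c)"

lemma tape_read_fst_snd: "tape_read t = fst t (snd t)"
  by (cases t) simp

lemma tape_act_fst_snd:
  "fst (tape_act t a) = (fst t)(snd t := fst a)" "snd (tape_act t a) = snd t + snd a"
  by (cases t; cases a; simp)+

lemma tm_step_next_action:
  "tm_step M c = (case next_action M (fst c) (reads c) of (q, acts) \<Rightarrow> (q, map2 tape_act (snd c) acts))"
proof (cases "fst c = 1")
  case True
  have "map2 tape_act ts (map (\<lambda>a. (a, 0)) (map tape_read ts)) = ts" for ts
    by (induction ts) (simp_all add: prod_eq_iff tape_act_fst_snd tape_read_fst_snd)
  then show ?thesis using True by (cases c) (simp add: next_action_def reads_def)
next
  case False
  then show ?thesis by (cases c) (simp add: next_action_def reads_def)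
qed

lemma reads_wf:
  assumes "wf_config M c"
  shows "length (reads c) = tm_tapes M" "set (reads c) \<subseteq> {..<tm_symbols M}"
    "\<And>k. k < tm_tapes M \<Longrightarrow> reads c ! k = fst (snd c ! k) (snd (snd c ! k))"
proof -
  have wf: "length (snd c) = tm_tapes M" "\<And>k z. k < tm_tapes M \<Longrightarrow> fst (snd c ! k) z < tm_symbols M"
    using assms unfolding wf_config_def by auto
  show length: "length (reads c) = tm_tapes M" using wf(1) by (simp add: reads_def)
  show nth: "reads c ! k = fst (snd c ! k) (snd (snd c ! k))" if "k < tm_tapes M" for k
    using that wf(1) by (simp add: reads_def tape_read_fst_snd)
  show "set (reads c) \<subseteq> {..<tm_symbols M}"
    using wf(2) nth length by (auto simp: set_conv_nth)
qed

lemma valid_tm_next_action: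
  assumes M: "valid_tm M" and c: "wf_config M c" and action: "next_action M (fst c) (reads c) = (q, acts)"
  shows "q < tm_states M" "length acts = tm_tapes M"
    "\<And>k. k < tm_tapes M \<Longrightarrow> fst (acts ! k) < tm_symbols M \<and> snd (acts ! k) \<in> {-1, 0, 1}"
proof -
  note reads = reads_wf[OF c]
  have c_state: "fst c < tm_states M" using c by (simp add: wf_config_def)
  have "q < tm_states M \<and> length acts = tm_tapes M \<and>
      (\<forall>(a, d)\<in>set acts. a < tm_symbols M \<and> d \<in> {-1, 0, 1})"
  proof (cases "fst c = 1")
    case True
    then have "q = 1" "acts = map (\<lambda>a. (a, 0)) (reads c)" using action by (auto simp: next_action_def)
    then show ?thesis using True c_state reads(1,2) by auto
  next
    case False
    then have "tm_delta M (fst c) (reads c) = (q, acts)" using action by (simp add: next_action_def)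
    then show ?thesis using M c_state reads(1,2) unfolding valid_tm_def by fastforce
  qed
  then show "q < tm_states M" "length acts = tm_tapes M"
    and "\<And>k. k < tm_tapes M \<Longrightarrow> fst (acts ! k) < tm_symbols M \<and> snd (acts ! k) \<in> {-1, 0, 1}"
    by (auto simp: case_prod_beta all_set_conv_all_nth)
qed

lemma wf_config_tm_step:
  assumes M: "valid_tm M" and c: "wf_config M c"
  shows "wf_config M (tm_step M c)"
proof -
  obtain q acts where action: "next_action M (fst c) (reads c) = (q, acts)" by force
  show ?thesis
    using c valid_tm_next_action[OF M c action]
    by (simp add: wf_config_def tm_step_next_action action tape_act_fst_snd)
qed

definition run :: "tm \<Rightarrow> bool list \<Rightarrow> nat \<Rightarrow> tm_config" where
  "run M y t = (tm_step M ^^ t) (tm_init M y)"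

definition head_pos :: "tm \<Rightarrow> bool list \<Rightarrow> nat \<Rightarrow> nat \<Rightarrow> int" where
  "head_pos M y t k = snd (snd (run M y t) ! k)"

definition content :: "tm \<Rightarrow> bool list \<Rightarrow> nat \<Rightarrow> nat \<Rightarrow> int \<Rightarrow> nat" where
  "content M y t k = fst (snd (run M y t) ! k)"

lemma run_simps: "run M y 0 = tm_init M y" "run M y (Suc t) = tm_step M (run M y t)"
  by (simp_all add: run_def)

lemma tm_init_nth:
  assumes "valid_tm M" "k < tm_tapes M"
  shows "snd (tm_init M y) ! k = word_tape (if k = 0 then y else [])"
  using assms by (cases k) (auto simp: tm_init_def)

lemma wf_run:
  assumes "valid_tm M"
  shows "wf_config M (run M y t)"
proof (induction t)
  case 0
  have "fst (word_tape z) i < 3" for z i by (auto simp: word_tape_def bit_symbol_def)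
  moreover have "3 \<le> tm_symbols M" "2 \<le> tm_states M" "2 \<le> tm_tapes M" using assms by (auto simp: valid_tm_def)
  ultimately show ?case
    unfolding run_simps wf_config_def using tm_init_nth[OF assms]
    by (auto simp: tm_init_def intro: less_le_trans)
next
  case (Suc t)
  then show ?case unfolding run_simps by (rule wf_config_tm_step[OF assms])
qed

lemma run_Suc:
  assumes M: "valid_tm M" and action: "next_action M (fst (run M y t)) (reads (run M y t)) = (q, acts)"
  shows "fst (run M y (Suc t)) = q"
    and "\<And>k z. k < tm_tapes M \<Longrightarrow>
      content M y (Suc t) k z = (if z = head_pos M y t k then fst (acts ! k) else content M y t k z)"
    and "\<And>k. k < tm_tapes M \<Longrightarrow> head_pos M y (Suc t) k = head_pos M y t k + snd (acts ! k)"
    and "\<And>k. k < tm_tapes M \<Longrightarrow> snd (acts ! k) \<in> {-1, 0, 1}"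
proof -
  have "length (snd (run M y t)) = tm_tapes M" using wf_run[OF M] by (simp add: wf_config_def)
  moreover note valid_tm_next_action[OF M wf_run[OF M] action]
  ultimately show "fst (run M y (Suc t)) = q"
    "\<And>k z. k < tm_tapes M \<Longrightarrow>
      content M y (Suc t) k z = (if z = head_pos M y t k then fst (acts ! k) else content M y t k z)"
    "\<And>k. k < tm_tapes M \<Longrightarrow> head_pos M y (Suc t) k = head_pos M y t k + snd (acts ! k)"
    "\<And>k. k < tm_tapes M \<Longrightarrow> snd (acts ! k) \<in> {-1, 0, 1}"
    by (simp_all add: run_simps tm_step_next_action action head_pos_def content_def tape_act_fst_snd)
qed

lemma abs_head_pos_le:
  assumes M: "valid_tm M" and k: "k < tm_tapes M"
  shows "\<bar>head_pos M y t k\<bar> \<le> int t"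
proof (induction t)
  case 0
  then show ?case using tm_init_nth[OF assms, of y] by (simp add: head_pos_def run_simps word_tape_def)
next
  case (Suc t)
  obtain q acts where "next_action M (fst (run M y t)) (reads (run M y t)) = (q, acts)" by force
  from run_Suc(3,4)[OF M this k] show ?case using Suc by auto
qed

lemma head_pos_0: "valid_tm M \<Longrightarrow> k < tm_tapes M \<Longrightarrow> head_pos M y 0 k = 0"
  using abs_head_pos_le[of M k y 0] by simp

lemma content_0:
  assumes "valid_tm M" "k < tm_tapes M"
  shows "content M y 0 k z =
    (if k = 0 \<and> 0 \<le> z \<and> z < int (length y) then bit_symbol (y ! nat z) else 0)"
  using tm_init_nth[OF assms, of y] by (simp add: content_def run_simps word_tape_def)

lemma content_less:
  assumes "valid_tm M" "k < tm_tapes M"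
  shows "content M y t k z < tm_symbols M"
  using wf_run[OF assms(1), of y t] assms(2) unfolding wf_config_def content_def by blast

lemma reads_run:
  assumes "valid_tm M" "k < tm_tapes M"
  shows "reads (run M y t) ! k = content M y t k (head_pos M y t k)"
  using reads_wf(3)[OF wf_run[OF assms(1)] assms(2)] by (simp add: content_def head_pos_def)

lemma run_halted:
  assumes "fst (run M y t) = 1" "t \<le> t'"
  shows "run M y t' = run M y t"
  using assms(2)
proof (induction t' rule: dec_induct)
  case (step t')
  have "fst (run M y t') = 1" using step assms(1) by simp
  then have "tm_step M (run M y t') = run M y t'" by (cases "run M y t'") simp
  then show ?case using step by (simp add: run_simps)
qed simp

definition accepts_at :: "tm \<Rightarrow> bool list \<Rightarrow> nat \<Rightarrow> bool" where
  "accepts_at M y t \<longleftrightarrow> fst (run M y t) = 1 \<and> content M y t 1 0 = bit_symbol True \<and> content M y t 1 1 = 0"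

lemma accepts_at_iff:
  assumes out: "tm_outputs_within M y t z" and "t \<le> T"
  shows "accepts_at M y T \<longleftrightarrow> z = [True]"
proof -
  have halted: "fst (run M y t) = 1" and bits: "\<And>i. i < length z \<Longrightarrow> content M y t 1 (int i) = bit_symbol (z ! i)"
    and blank: "content M y t 1 (int (length z)) = 0"
    using out unfolding tm_outputs_within_def run_def content_def by (auto simp: case_prod_beta)
  have "accepts_at M y T \<longleftrightarrow> accepts_at M y t"
    using run_halted[OF halted \<open>t \<le> T\<close>] by (simp add: accepts_at_def content_def)
  also have "\<dots> \<longleftrightarrow> z = [True]"
  proof (cases z)
    case Nil
    then show ?thesis using blank by (simp add: accepts_at_def bit_symbol_def)
  next
    case (Cons b bs)
    have "content M y t 1 0 = bit_symbol b" using bits[of 0] Cons by simp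
    moreover have "content M y t 1 1 = 0 \<longleftrightarrow> bs = []"
      using bits[of 1] blank Cons by (cases bs) (auto simp: bit_symbol_def)
    ultimately show ?thesis using halted Cons by (auto simp: accepts_at_def bit_symbol_def)
  qed
  finally show ?thesis .
qed

section \<open>The tableau of a verifier\<close>

text \<open>
  The initial row has cells with a blank, with a bit of the input or with an unconstrained symbol of the
  certificate (\<open>Wild\<close>), and the cell just before the input (\<open>Pre\<close>); the final row has the two output
  cells that must hold the bit 1 and a blank (\<open>Acc_One\<close>, \<open>Acc_Blank\<close>). The two flags of a cell mark
  the first and the last column.
\<close>

datatype cell_kind = Blank | Zero | One | Wild | Pre | Mid | Acc_One | Acc_Blank

type_synonym cell = "cell_kind \<times> bool \<times> bool"

text \<open>
  A label records the contents of the cell on every tape, whether the heads are on the cell, on its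
  left neighbor and on its right neighbor, and the state together with the symbols under all heads.
  The flag \<open>wild\<close> marks the cells of the certificate, in which no bit may follow a blank.
\<close>

record label =
  contents :: "nat list"
  heads :: "bool list"
  left_heads :: "bool list"
  right_heads :: "bool list"
  state :: nat
  scanned :: "nat list"
  wild :: bool

definition labels :: "tm \<Rightarrow> label set" where
  "labels M = {l. length (contents l) = tm_tapes M \<and> length (heads l) = tm_tapes M \<and>
     length (left_heads l) = tm_tapes M \<and> length (right_heads l) = tm_tapes M \<and>
     length (scanned l) = tm_tapes M \<and> set (contents l) \<subseteq> {..<tm_symbols M} \<and>
     set (scanned l) \<subseteq> {..<tm_symbols M} \<and> state l < tm_states M \<and>
     (\<forall>k<tm_tapes M. heads l ! k \<longrightarrow> scanned l ! k = contents l ! k)}"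

definition hcompatible :: "label \<Rightarrow> label \<Rightarrow> bool" where
  "hcompatible a b \<longleftrightarrow> state a = state b \<and> scanned a = scanned b \<and> right_heads a = heads b \<and>
     left_heads b = heads a \<and> (wild a \<and> wild b \<and> contents a ! 0 = 0 \<longrightarrow> contents b ! 0 = 0)"

definition vcompatible :: "tm \<Rightarrow> label \<Rightarrow> label \<Rightarrow> bool" where
  "vcompatible M a b \<longleftrightarrow> (case next_action M (state a) (scanned a) of (q, acts) \<Rightarrow>
     state b = q \<and> (\<forall>k<tm_tapes M.
       contents b ! k = (if heads a ! k then fst (acts ! k) else contents a ! k) \<and>
       (heads b ! k \<longleftrightarrow> (snd (acts ! k) = 0 \<and> heads a ! k) \<or> (snd (acts ! k) = 1 \<and> left_heads a ! k) \<or>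
         (snd (acts ! k) = -1 \<and> right_heads a ! k))))"

definition input_kind :: "cell_kind \<Rightarrow> bool" where
  "input_kind c \<longleftrightarrow> c \<in> {Blank, Zero, One, Wild, Pre}"

definition input_symbol :: "cell_kind \<Rightarrow> nat" where
  "input_symbol c = (if c = Zero then bit_symbol False else if c = One then bit_symbol True else 0)"

fun admissible :: "tm \<Rightarrow> cell \<Rightarrow> label \<Rightarrow> bool" where
  "admissible M (c, leftmost, rightmost) l \<longleftrightarrow>
     (leftmost \<longrightarrow> (\<forall>k<tm_tapes M. \<not> heads l ! k \<and> \<not> left_heads l ! k)) \<and>
     (rightmost \<longrightarrow> (\<forall>k<tm_tapes M. \<not> right_heads l ! k)) \<and>
     (wild l \<longleftrightarrow> c = Wild) \<and>
     (input_kind c \<longrightarrow> state l = 0 \<and> (\<forall>k<tm_tapes M. right_heads l ! k = (c = Pre)) \<and>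
        (\<forall>k. 0 < k \<longrightarrow> k < tm_tapes M \<longrightarrow> contents l ! k = 0) \<and>
        (if c = Wild then contents l ! 0 < 3 else contents l ! 0 = input_symbol c)) \<and>
     (c = Acc_One \<longrightarrow> state l = 1 \<and> contents l ! 1 = bit_symbol True) \<and>
     (c = Acc_Blank \<longrightarrow> contents l ! 1 = 0)"

definition bit_cell :: "bool \<Rightarrow> cell_kind" where
  "bit_cell b = (if b then One else Zero)"

definition tableau_width :: "bool list \<Rightarrow> nat \<Rightarrow> nat \<Rightarrow> nat" where
  "tableau_width e n U = U + 2 + length e + n + U + 1"

definition tableau_kind :: "bool list \<Rightarrow> nat \<Rightarrow> nat \<Rightarrow> nat \<Rightarrow> nat \<Rightarrow> cell_kind" where
  "tableau_kind e n U i j =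
     (if i = 0 then
        if j < U + 1 then Blank else if j = U + 1 then Pre
        else if j < U + 2 + length e then bit_cell (e ! (j - (U + 2)))
        else if j < U + 2 + length e + n then Wild else Blank
      else if i = U + 1 then (if j = U + 2 then Acc_One else if j = U + 3 then Acc_Blank else Mid)
      else Mid)"

definition tableau_cell :: "bool list \<Rightarrow> nat \<Rightarrow> nat \<Rightarrow> nat \<Rightarrow> nat \<Rightarrow> cell" where
  "tableau_cell e n U i j = (tableau_kind e n U i j, j = 0, Suc j = tableau_width e n U)"

definition is_tableau :: "tm \<Rightarrow> bool list \<Rightarrow> nat \<Rightarrow> nat \<Rightarrow> (nat \<Rightarrow> nat \<Rightarrow> label) \<Rightarrow> bool" where
  "is_tableau M e n U = label_tiling (labels M) hcompatible (vcompatible M) (U + 2) (tableau_width e n U)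
     (\<lambda>i j. Collect (admissible M (tableau_cell e n U i j)))"

lemma finite_labels: "finite (labels M)"
proof (rule finite_subset)
  let ?symbols = "{xs. set xs \<subseteq> {..<tm_symbols M} \<and> length xs = tm_tapes M}"
  let ?flags = "{xs :: bool list. set xs \<subseteq> UNIV \<and> length xs = tm_tapes M}"
  let ?mk = "\<lambda>(cs, hs, ls, rs, q, ss, w). \<lparr>contents = cs, heads = hs, left_heads = ls, right_heads = rs,
    state = q, scanned = ss, wild = w\<rparr>"
  let ?tuples = "?symbols \<times> ?flags \<times> ?flags \<times> ?flags \<times> {..<tm_states M} \<times> ?symbols \<times> (UNIV :: bool set)"
  show "labels M \<subseteq> ?mk ` ?tuples"
  proof
    fix l assume "l \<in> labels M"
    then show "l \<in> ?mk ` ?tuples"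
      by (intro image_eqI[of _ _ "(contents l, heads l, left_heads l, right_heads l, state l, scanned l, wild l)"])
        (auto simp: labels_def)
  qed
  show "finite (?mk ` ?tuples)"
    by (intro finite_imageI finite_cartesian_product finite_lists_length_eq) simp_all
qed

text \<open>
  The tableau has \<open>U + 2\<close> rows; the input \<open>e\<close> is followed by a certificate of length at most \<open>n\<close>, and the
  margin of width \<open>U + 1\<close> on both sides keeps the heads inside.
\<close>

locale verifier_tableau =
  fixes M :: tm and e :: "bool list" and n U :: nat
  assumes valid: "valid_tm M" and length_e: "2 \<le> length e"
begin

abbreviation K :: nat where "K \<equiv> tm_tapes M"
abbreviation W :: nat where "W \<equiv> tableau_width e n U"
abbreviation kind :: "nat \<Rightarrow> nat \<Rightarrow> cell_kind" where "kind \<equiv> tableau_kind e n U"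
abbreviation certificate_column :: "nat \<Rightarrow> nat" where "certificate_column k \<equiv> U + 2 + length e + k"

definition pos :: "nat \<Rightarrow> int" where
  "pos j = int j - int (U + 2)"

lemma tapes_ge_2: "2 \<le> K"
  using valid by (simp add: valid_tm_def)

lemma pos_Suc: "pos (Suc j) = pos j + 1"
  by (simp add: pos_def)

lemma pos_beyond_last: "Suc j = W \<Longrightarrow> pos j + 1 > int (U + 1)"
  using length_e unfolding tableau_width_def pos_def by linarith

lemma input_kind_row_0: "input_kind (kind 0 j)"
  by (simp add: tableau_kind_def input_kind_def bit_cell_def)

lemma kind_eq_Pre: "kind 0 j = Pre \<longleftrightarrow> j = U + 1"
  by (auto simp: tableau_kind_def bit_cell_def)

lemma kind_certificate_column: "k < n \<Longrightarrow> kind 0 (certificate_column k) = Wild"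
  by (simp add: tableau_kind_def)

lemma kind_eq_Wild:
  assumes "kind i j = Wild"
  obtains k where "i = 0" "k < n" "j = certificate_column k"
proof
  show "i = 0" "j - (U + 2 + length e) < n" "j = certificate_column (j - (U + 2 + length e))"
    using assms by (auto simp: tableau_kind_def bit_cell_def split: if_splits)
qed

lemma content_row_0:
  "content M y 0 0 (pos j) =
    (if U + 2 \<le> j \<and> j - (U + 2) < length y then bit_symbol (y ! (j - (U + 2))) else 0)"
proof -
  have "0 \<le> pos j \<and> pos j < int (length y) \<longleftrightarrow> U + 2 \<le> j \<and> j - (U + 2) < length y"
    "nat (pos j) = j - (U + 2)"
    unfolding pos_def by linarith+
  then show ?thesis using content_0[OF valid, of 0 y "pos j"] tapes_ge_2 by simp
qed

lemma content_certificate_column: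
  "content M (e @ w) 0 0 (pos (certificate_column k)) = (if k < length w then bit_symbol (w ! k) else 0)"
  unfolding content_row_0 by (simp add: nth_append)

lemma content_input:
  assumes "length w \<le> n" "kind 0 j \<noteq> Wild"
  shows "content M (e @ w) 0 0 (pos j) = input_symbol (kind 0 j)"
proof -
  have "\<not> (U + 2 + length e \<le> j \<and> j < U + 2 + length e + n)"
    using assms(2) by (auto simp: tableau_kind_def)
  then consider (left) "j < U + 2" | (input) "U + 2 \<le> j" "j < U + 2 + length e"
    | (right) "U + 2 + length e + n \<le> j"
    by linarith
  then show ?thesis
  proof cases
    case left
    then show ?thesis by (auto simp: content_row_0 tableau_kind_def input_symbol_def)
  next
    case input
    then have "j - (U + 2) < length e" by linarith
    then show ?thesis
      using input unfolding content_row_0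
      by (simp add: tableau_kind_def nth_append input_symbol_def bit_cell_def bit_symbol_def)
  next
    case right
    then have "\<not> j - (U + 2) < length (e @ w)" using assms(1) by simp
    moreover have "kind 0 j = Blank" using right by (simp add: tableau_kind_def)
    ultimately show ?thesis by (auto simp: content_row_0 input_symbol_def)
  qed
qed

subsection \<open>The tableau of an accepting run\<close>

definition run_label :: "bool list \<Rightarrow> nat \<Rightarrow> nat \<Rightarrow> label" where
  "run_label w i j =
     \<lparr>contents = map (\<lambda>k. content M (e @ w) i k (pos j)) [0..<K],
      heads = map (\<lambda>k. head_pos M (e @ w) i k = pos j) [0..<K],
      left_heads = map (\<lambda>k. head_pos M (e @ w) i k = pos j - 1) [0..<K],
      right_heads = map (\<lambda>k. head_pos M (e @ w) i k = pos j + 1) [0..<K],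
      state = fst (run M (e @ w) i), scanned = reads (run M (e @ w) i), wild = (kind i j = Wild)\<rparr>"

lemma run_label_labels: "run_label w i j \<in> labels M"
  using reads_wf(1,2)[OF wf_run[OF valid]] wf_run[OF valid, of "e @ w" i] content_less[OF valid] reads_run[OF valid]
  by (auto simp: labels_def run_label_def wf_config_def)

lemma contents_run_label_0: "contents (run_label w i j) ! 0 = content M (e @ w) i 0 (pos j)"
  using tapes_ge_2 by (simp add: run_label_def)

lemma hcompatible_run_label: "hcompatible (run_label w i j) (run_label w i (Suc j))"
proof -
  have "contents (run_label w i (Suc j)) ! 0 = 0"
    if wild: "kind i j = Wild" "kind i (Suc j) = Wild" and blank: "contents (run_label w i j) ! 0 = 0"
  proof -
    from wild(1) obtain k where k: "i = 0" "j = certificate_column k" by (rule kind_eq_Wild)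
    have "\<not> k < length w"
      using blank unfolding contents_run_label_0 k content_certificate_column
      by (simp add: bit_symbol_def split: if_splits)
    moreover have "Suc j = certificate_column (Suc k)" using k by simp
    ultimately show ?thesis
      unfolding contents_run_label_0 k(1) by (simp only: content_certificate_column) simp
  qed
  then show ?thesis by (auto simp: hcompatible_def run_label_def pos_Suc)
qed

lemma vcompatible_run_label: "vcompatible M (run_label w i j) (run_label w (Suc i) j)"
proof -
  obtain q acts where action: "next_action M (fst (run M (e @ w) i)) (reads (run M (e @ w) i)) = (q, acts)"
    by force
  note step = run_Suc[OF valid action]
  have "contents (run_label w (Suc i) j) ! k =
        (if heads (run_label w i j) ! k then fst (acts ! k) else contents (run_label w i j) ! k) \<and>
      (heads (run_label w (Suc i) j) ! k \<longleftrightarrow> (snd (acts ! k) = 0 \<and> heads (run_label w i j) ! k) \<or>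
        (snd (acts ! k) = 1 \<and> left_heads (run_label w i j) ! k) \<or>
        (snd (acts ! k) = -1 \<and> right_heads (run_label w i j) ! k))" if k: "k < K" for k
  proof -
    have "snd (acts ! k) = -1 \<or> snd (acts ! k) = 0 \<or> snd (acts ! k) = 1" using step(4)[OF k] by auto
    then show ?thesis using k step(2,3)[OF k] by (auto simp: run_label_def)
  qed
  then show ?thesis using action step(1) by (simp add: vcompatible_def run_label_def)
qed

lemma admissible_run_label:
  assumes w: "length w \<le> n" and acc: "accepts_at M (e @ w) (U + 1)" and i: "i < U + 2"
  shows "admissible M (tableau_cell e n U i j) (run_label w i j)"
proof -
  have bound: "\<bar>head_pos M (e @ w) i k\<bar> \<le> int (U + 1)" if "k < K" for k
    using abs_head_pos_le[OF valid that, of "e @ w" i] i by linarith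
  have "\<not> heads (run_label w i 0) ! k \<and> \<not> left_heads (run_label w i 0) ! k" if "k < K" for k
    using bound[OF that] that by (auto simp: run_label_def pos_def)
  moreover have "\<not> right_heads (run_label w i j) ! k" if "Suc j = W" "k < K" for k
    using bound[OF that(2)] pos_beyond_last[OF that(1)] that(2) by (auto simp: run_label_def)
  moreover have "state (run_label w i j) = 0 \<and> (\<forall>k<K. right_heads (run_label w i j) ! k = (kind i j = Pre)) \<and>
      (\<forall>k. 0 < k \<longrightarrow> k < K \<longrightarrow> contents (run_label w i j) ! k = 0) \<and>
      (if kind i j = Wild then contents (run_label w i j) ! 0 < 3
       else contents (run_label w i j) ! 0 = input_symbol (kind i j))" if "input_kind (kind i j)"
  proof -
    have first_row: "i = 0" using that by (auto simp: tableau_kind_def input_kind_def split: if_splits)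
    have "contents (run_label w 0 j) ! 0 < 3"
      unfolding contents_run_label_0 content_row_0 by (simp add: bit_symbol_def)
    then show ?thesis
      unfolding first_row contents_run_label_0 using content_input[OF w]
      by (auto simp: run_label_def run_simps tm_init_def head_pos_0[OF valid] content_0[OF valid] kind_eq_Pre pos_def)
  qed
  moreover have "i = U + 1 \<and> j = U + 2" if "kind i j = Acc_One"
    using that by (auto simp: tableau_kind_def bit_cell_def split: if_splits)
  moreover have "i = U + 1 \<and> j = U + 3" if "kind i j = Acc_Blank"
    using that by (auto simp: tableau_kind_def bit_cell_def split: if_splits)
  moreover have "fst (run M (e @ w) (U + 1)) = 1" "contents (run_label w (U + 1) (U + 2)) ! 1 = bit_symbol True"
    "contents (run_label w (U + 1) (U + 3)) ! 1 = 0"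
    using acc tapes_ge_2 by (simp_all add: accepts_at_def run_label_def pos_def)
  ultimately show ?thesis
    unfolding tableau_cell_def admissible.simps by (auto simp: run_label_def)
qed

lemma is_tableau_run_label:
  assumes "length w \<le> n" "accepts_at M (e @ w) (U + 1)"
  shows "is_tableau M e n U (run_label w)"
  unfolding is_tableau_def label_tiling_def
  using assms run_label_labels hcompatible_run_label vcompatible_run_label admissible_run_label by simp

end
subsection \<open>The accepting run of a tableau\<close>

locale labeled_tableau = verifier_tableau +
  fixes f :: "nat \<Rightarrow> nat \<Rightarrow> label"
  assumes f: "is_tableau M e n U f"
begin

lemma
  assumes "i < U + 2" "j < W"
  shows labels: "f i j \<in> labels M"
    and admissible: "admissible M (kind i j, j = 0, Suc j = W) (f i j)"
    and hcompatible: "Suc j < W \<Longrightarrow> hcompatible (f i j) (f i (Suc j))"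
    and vcompatible: "Suc i < U + 2 \<Longrightarrow> vcompatible M (f i j) (f (Suc i) j)"
  using f assms unfolding is_tableau_def label_tiling_def tableau_cell_def by blast+

lemma W_pos: "0 < W"
  by (simp add: tableau_width_def)

lemma row_constant:
  assumes "i < U + 2" "j < W"
  shows "state (f i j) = state (f i 0) \<and> scanned (f i j) = scanned (f i 0)"
  using assms(2)
proof (induction j)
  case (Suc j)
  then show ?case using hcompatible[OF assms(1), of j] by (simp add: hcompatible_def)
qed simp

lemma neighbor_heads:
  assumes "i < U + 2" "Suc j < W"
  shows "right_heads (f i j) = heads (f i (Suc j))" "left_heads (f i (Suc j)) = heads (f i j)"
  using hcompatible[OF assms(1), of j] assms(2) by (simp_all add: hcompatible_def)

lemma admissible_row_0:
  assumes "j < W"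
  shows "state (f 0 j) = 0" "\<And>k. k < K \<Longrightarrow> right_heads (f 0 j) ! k \<longleftrightarrow> j = U + 1"
    "\<And>k. 0 < k \<Longrightarrow> k < K \<Longrightarrow> contents (f 0 j) ! k = 0"
    "kind 0 j \<noteq> Wild \<Longrightarrow> contents (f 0 j) ! 0 = input_symbol (kind 0 j)"
    "wild (f 0 j) \<longleftrightarrow> kind 0 j = Wild" "kind 0 j = Wild \<Longrightarrow> contents (f 0 j) ! 0 < 3"
  using admissible[of 0 j] assms input_kind_row_0[of j] kind_eq_Pre[of j] by simp_all

abbreviation certificate_symbol :: "nat \<Rightarrow> nat" where
  "certificate_symbol k \<equiv> contents (f 0 (certificate_column k)) ! 0"

definition certificate :: "bool list" where
  "certificate = map (\<lambda>k. certificate_symbol k = bit_symbol True)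
     [0..<LEAST k. k = n \<or> certificate_symbol k = 0]"

lemma certificate_column_less: "k < n \<Longrightarrow> certificate_column k < W"
  by (simp add: tableau_width_def)

lemma length_certificate_le: "length certificate \<le> n"
  unfolding certificate_def by (simp add: Least_le)

lemma certificate_symbol_eq:
  assumes "k < n"
  shows "certificate_symbol k = (if k < length certificate then bit_symbol (certificate ! k) else 0)"
proof (cases "k < length certificate")
  case True
  then have "certificate_symbol k \<noteq> 0"
    unfolding certificate_def using not_less_Least by fastforce
  moreover have "certificate_symbol k < 3"
    using admissible_row_0(6)[OF certificate_column_less kind_certificate_column] assms by blast
  moreover have "certificate ! k = (certificate_symbol k = bit_symbol True)"
    using True by (simp add: certificate_def)
  ultimately show ?thesis using True by (auto simp: bit_symbol_def)
next
  case False
  let ?least = "length certificate"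
  have start: "?least = n \<or> certificate_symbol ?least = 0"
    unfolding certificate_def length_map length_upt diff_zero by (rule LeastI[of _ n]) simp
  from False have "?least \<le> k" by simp
  then have "certificate_symbol k = 0"
    using assms
  proof (induction k rule: dec_induct)
    case base
    then show ?case using start by simp
  next
    case (step k)
    then have k: "k < n" "Suc k < n" by simp_all
    have "wild (f 0 (certificate_column k))" "wild (f 0 (certificate_column (Suc k)))"
      using admissible_row_0(5) certificate_column_less kind_certificate_column k by blast+
    moreover have "hcompatible (f 0 (certificate_column k)) (f 0 (Suc (certificate_column k)))"
      using hcompatible[of 0 "certificate_column k"] certificate_column_less[OF k(2)] by simp
    ultimately show ?case using step k by (simp add: hcompatible_def)
  qed
  then show ?thesis using False by simp
qed

abbreviation word :: "bool list" where
  "word \<equiv> e @ certificate"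

lemma contents_row_0:
  assumes "j < W" "k < K"
  shows "contents (f 0 j) ! k = content M word 0 k (pos j)"
proof (cases "k = 0")
  case False
  then show ?thesis using admissible_row_0(3)[OF assms(1)] assms(2) content_0[OF valid] by simp
next
  case True
  show ?thesis
  proof (cases "kind 0 j = Wild")
    case True
    then obtain i where "i < n" "j = certificate_column i" by (rule kind_eq_Wild)
    then show ?thesis
      unfolding \<open>k = 0\<close> using certificate_symbol_eq content_certificate_column by simp
  next
    case False
    then show ?thesis
      unfolding \<open>k = 0\<close> using admissible_row_0(4)[OF assms(1)] content_input[OF length_certificate_le] by simp
  qed
qed

lemma heads_row_0:
  assumes "j < W" "k < K"
  shows "heads (f 0 j) ! k \<longleftrightarrow> head_pos M word 0 k = pos j"
proof (cases j)
  case 0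
  then show ?thesis
    using admissible[of 0 0] W_pos assms(2) head_pos_0[OF valid assms(2)] by (simp add: pos_def)
next
  case (Suc i)
  then have "heads (f 0 j) ! k \<longleftrightarrow> i = U + 1"
    using neighbor_heads(1)[of 0 i] admissible_row_0(2)[of i k] assms by simp
  then show ?thesis using Suc head_pos_0[OF valid assms(2)] by (auto simp: pos_def)
qed

definition row_agrees :: "nat \<Rightarrow> bool" where
  "row_agrees i \<longleftrightarrow> state (f i 0) = fst (run M word i) \<and> (\<forall>j<W. \<forall>k<K.
     contents (f i j) ! k = content M word i k (pos j) \<and> (heads (f i j) ! k \<longleftrightarrow> head_pos M word i k = pos j))"

context
  fixes i :: nat
  assumes i: "i \<le> U" and agrees: "row_agrees i"
begin

lemma head_inside: "k < K \<Longrightarrow> \<bar>head_pos M word i k\<bar> \<le> int U"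
  using abs_head_pos_le[OF valid, of k word i] i by simp

lemma scanned_row: "scanned (f i 0) = reads (run M word i)"
proof (rule nth_equalityI)
  have "f i 0 \<in> labels M" using labels i W_pos by simp
  then show length: "length (scanned (f i 0)) = length (reads (run M word i))"
    using reads_wf(1)[OF wf_run[OF valid]] by (simp add: labels_def)
  fix k assume "k < length (scanned (f i 0))"
  then have k: "k < K" using length reads_wf(1)[OF wf_run[OF valid]] by simp
  define j where "j = nat (head_pos M word i k + int (U + 2))"
  have j: "j < W" "pos j = head_pos M word i k"
    using head_inside[OF k] length_e unfolding j_def tableau_width_def pos_def by linarith+
  then have "heads (f i j) ! k" "contents (f i j) ! k = reads (run M word i) ! k"
    using agrees k reads_run[OF valid k] by (simp_all add: row_agrees_def)
  moreover have "f i j \<in> labels M" using labels i j(1) by simp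
  ultimately show "scanned (f i 0) ! k = reads (run M word i) ! k"
    using row_constant[of i j] i j(1) k by (simp add: labels_def)
qed

lemma left_heads_row:
  assumes "j < W" "k < K"
  shows "left_heads (f i j) ! k \<longleftrightarrow> head_pos M word i k = pos j - 1"
proof (cases j)
  case 0
  have "\<not> left_heads (f i 0) ! k" using admissible[of i 0] i W_pos assms(2) by simp
  then show ?thesis using 0 head_inside[OF assms(2)] by (auto simp: pos_def)
next
  case (Suc j')
  then show ?thesis
    using neighbor_heads(2)[of i j'] agrees i assms by (simp add: row_agrees_def pos_Suc)
qed

lemma right_heads_row:
  assumes "j < W" "k < K"
  shows "right_heads (f i j) ! k \<longleftrightarrow> head_pos M word i k = pos j + 1"
proof (cases "Suc j = W")
  case True
  have "\<not> right_heads (f i j) ! k" using admissible[of i j] i assms True by simp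
  then show ?thesis using pos_beyond_last[OF True] head_inside[OF assms(2)] by auto
next
  case False
  then show ?thesis
    using neighbor_heads(1)[of i j] agrees i assms by (simp add: row_agrees_def pos_Suc)
qed

lemma row_agrees_step: "row_agrees (Suc i)"
proof -
  obtain q acts where action: "next_action M (fst (run M word i)) (reads (run M word i)) = (q, acts)"
    by force
  note step = run_Suc[OF valid action]
  have "next_action M (state (f i j)) (scanned (f i j)) = (q, acts)" if "j < W" for j
    using row_constant[of i j] scanned_row agrees action i that by (simp add: row_agrees_def)
  then have below: "state (f (Suc i) j) = q \<and> (\<forall>k<K.
      contents (f (Suc i) j) ! k = (if heads (f i j) ! k then fst (acts ! k) else contents (f i j) ! k) \<and>
      (heads (f (Suc i) j) ! k \<longleftrightarrow> (snd (acts ! k) = 0 \<and> heads (f i j) ! k) \<or>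
        (snd (acts ! k) = 1 \<and> left_heads (f i j) ! k) \<or> (snd (acts ! k) = -1 \<and> right_heads (f i j) ! k)))"
    if "j < W" for j
    using vcompatible[of i j] i that by (simp add: vcompatible_def)
  have "contents (f (Suc i) j) ! k = content M word (Suc i) k (pos j) \<and>
      (heads (f (Suc i) j) ! k \<longleftrightarrow> head_pos M word (Suc i) k = pos j)" if j: "j < W" and k: "k < K" for j k
  proof -
    have now: "contents (f i j) ! k = content M word i k (pos j)"
      "heads (f i j) ! k \<longleftrightarrow> head_pos M word i k = pos j"
      using agrees j k by (simp_all add: row_agrees_def)
    note below_k = conjunct2[OF below[OF j], rule_format, OF k]
    have "contents (f (Suc i) j) ! k = content M word (Suc i) k (pos j)"
      unfolding conjunct1[OF below_k] step(2)[OF k] now by (simp only: eq_commute)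
    moreover have "snd (acts ! k) = -1 \<or> snd (acts ! k) = 0 \<or> snd (acts ! k) = 1" using step(4)[OF k] by auto
    then have "heads (f (Suc i) j) ! k \<longleftrightarrow> head_pos M word (Suc i) k = pos j"
      unfolding conjunct2[OF below_k] step(3)[OF k] now(2) left_heads_row[OF j k] right_heads_row[OF j k]
      by (elim disjE) auto
    ultimately show ?thesis by blast
  qed
  then show ?thesis using below[OF W_pos] step(1) by (simp add: row_agrees_def)
qed

end

lemma row_agrees: "i < U + 2 \<Longrightarrow> row_agrees i"
proof (induction i)
  case 0
  show ?case
    using admissible_row_0(1)[OF W_pos] contents_row_0 heads_row_0
    by (simp add: row_agrees_def run_simps tm_init_def)
qed (simp add: row_agrees_step)

lemma accepts_certificate: "accepts_at M word (U + 1)"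
proof -
  have columns: "U + 2 < W" "U + 3 < W" using length_e unfolding tableau_width_def by linarith+
  have "kind (U + 1) (U + 2) = Acc_One" "kind (U + 1) (U + 3) = Acc_Blank"
    by (simp_all add: tableau_kind_def)
  then have "state (f (U + 1) (U + 2)) = 1" "contents (f (U + 1) (U + 2)) ! 1 = bit_symbol True"
    "contents (f (U + 1) (U + 3)) ! 1 = 0"
    using admissible[of "U + 1" "U + 2"] admissible[of "U + 1" "U + 3"] columns by simp_all
  moreover have "fst (run M word (U + 1)) = state (f (U + 1) (U + 2))"
    "content M word (U + 1) 1 (pos j) = contents (f (U + 1) j) ! 1" if "j < W" for j
    using row_agrees[of "U + 1"] row_constant[of "U + 1" "U + 2"] columns(1) that tapes_ge_2
    by (simp_all add: row_agrees_def)
  from this[OF columns(1)] this[OF columns(2)]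
  have "fst (run M word (U + 1)) = state (f (U + 1) (U + 2))"
    "content M word (U + 1) 1 0 = contents (f (U + 1) (U + 2)) ! 1"
    "content M word (U + 1) 1 1 = contents (f (U + 1) (U + 3)) ! 1"
    by (simp_all add: pos_def)
  ultimately show ?thesis by (simp add: accepts_at_def)
qed

end

theorem is_tableau_iff_accepts:
  assumes "valid_tm M" "2 \<le> length e"
  shows "(\<exists>f. is_tableau M e n U f) \<longleftrightarrow> (\<exists>w. length w \<le> n \<and> accepts_at M (e @ w) (U + 1))"
proof
  assume "\<exists>f. is_tableau M e n U f"
  then obtain f where "is_tableau M e n U f" by blast
  with assms interpret labeled_tableau M e n U f by unfold_locales
  show "\<exists>w. length w \<le> n \<and> accepts_at M (e @ w) (U + 1)"
    using length_certificate_le accepts_certificate by blast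
next
  interpret verifier_tableau M e n U using assms by unfold_locales
  assume "\<exists>w. length w \<le> n \<and> accepts_at M (e @ w) (U + 1)"
  then show "\<exists>f. is_tableau M e n U f" using is_tableau_run_label by blast
qed

lemma poly_nat_mono: "x \<le> y \<Longrightarrow> poly (p :: nat poly) x \<le> poly p y"
  by (induction p) (auto intro: add_mono mult_mono)

lemma encode_pair_append: "encode_pair x w = encode_pair x [] @ w"
  by (simp add: encode_pair_def)

lemma length_encode_pair: "length (encode_pair x []) = 2 * length x + 2"
  by (induction x) (auto simp: encode_pair_def)

theorem NP_tableau:
  assumes "L \<in> NP"
  obtains M and p U :: "nat poly" where
    "\<And>x. x \<in> L \<longleftrightarrow> (\<exists>f. is_tableau M (encode_pair x []) (poly p (length x)) (poly U (length x)) f)"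
proof -
  from assms obtain F and p :: "nat poly" where "polytime_computable F"
    and L: "\<And>x. x \<in> L \<longleftrightarrow> (\<exists>w. length w \<le> poly p (length x) \<and> F (encode_pair x w) = [True])"
    unfolding NP_def by blast
  then obtain M and q :: "nat poly" where M: "valid_tm M"
    and out: "\<And>y. tm_outputs_within M y (poly q (length y)) (F y)"
    unfolding polytime_computable_def by blast
  define U where "U = pcompose q ([:2, 2:] + p)"
  have "x \<in> L \<longleftrightarrow> (\<exists>f. is_tableau M (encode_pair x []) (poly p (length x)) (poly U (length x)) f)" for x
  proof -
    let ?e = "encode_pair x []" and ?n = "poly p (length x)" and ?U = "poly U (length x)"
    have "F (encode_pair x w) = [True] \<longleftrightarrow> accepts_at M (?e @ w) (?U + 1)" if w: "length w \<le> ?n" for w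
      unfolding encode_pair_append[of x w]
    proof (rule accepts_at_iff[OF out, symmetric])
      have "length (?e @ w) \<le> 2 + 2 * length x + ?n" using w by (simp add: length_encode_pair)
      then have "poly q (length (?e @ w)) \<le> poly q (2 + 2 * length x + ?n)" by (rule poly_nat_mono)
      also have "\<dots> = ?U" by (simp add: U_def poly_pcompose mult.commute)
      finally show "poly q (length (?e @ w)) \<le> ?U + 1" by simp
    qed
    then have "x \<in> L \<longleftrightarrow> (\<exists>w. length w \<le> ?n \<and> accepts_at M (?e @ w) (?U + 1))" unfolding L by blast
    also have "\<dots> \<longleftrightarrow> (\<exists>f. is_tableau M ?e ?n ?U f)"
      by (rule is_tableau_iff_accepts[OF M, symmetric]) (simp add: length_encode_pair)
    finally show ?thesis .
  qed
  then show thesis by (rule that)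
qed

theorem NP_label_tiling:
  assumes "L \<in> NP"
  obtains m :: nat and H V A and p U :: "nat poly" where
    "\<And>x. x \<in> L \<longleftrightarrow> (\<exists>s. label_tiling {..<m} H V (poly U (length x) + 2)
       (tableau_width (encode_pair x []) (poly p (length x)) (poly U (length x)))
       (\<lambda>i j. A (tableau_cell (encode_pair x []) (poly p (length x)) (poly U (length x)) i j)) s)"
proof -
  obtain M and p U :: "nat poly" where L:
    "\<And>x. x \<in> L \<longleftrightarrow> (\<exists>f. is_tableau M (encode_pair x []) (poly p (length x)) (poly U (length x)) f)"
    using assms by (rule NP_tableau) blast
  obtain \<phi> where \<phi>: "bij_betw \<phi> {..<card (labels M)} (labels M)"
    using ex_bij_betw_nat_finite[OF finite_labels] unfolding atLeast0LessThan by blast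
  show thesis
  proof (rule that[of "card (labels M)" "\<lambda>x y. hcompatible (\<phi> x) (\<phi> y)" "\<lambda>x y. vcompatible M (\<phi> x) (\<phi> y)"
        U p "\<lambda>c. \<phi> -` Collect (admissible M c)"])
  qed (simp only: L is_tableau_def label_tiling_bij_betw[OF \<phi>])
qed

section \<open>A loop language for multi-tape machines\<close>

datatype 'c sym = Bit bool | Mark 'c

instance sym :: (finite) finite
proof
  have "(UNIV :: 'a sym set) \<subseteq> range Bit \<union> range Mark"
    using sym.exhaust by blast
  then show "finite (UNIV :: 'a sym set)" by (rule finite_subset) simp
qed

datatype 'c cmd = Skip | Append nat "'c sym" | Incr nat | Seq "'c cmd" "'c cmd" | For nat "'c sym \<Rightarrow> 'c cmd"

type_synonym 'c store = "nat \<Rightarrow> 'c sym list"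

fun binary_inc :: "'c sym list \<Rightarrow> 'c sym list" where
  "binary_inc [] = [Bit True]"
| "binary_inc (a # xs) =
     (if a = Bit True then Bit False # binary_inc xs
      else if a = Bit False then Bit True # xs else a # xs)"

primrec exec :: "'c cmd \<Rightarrow> 'c store \<Rightarrow> 'c store" where
  "exec Skip \<sigma> = \<sigma>"
| "exec (Append i a) \<sigma> = \<sigma>(i := \<sigma> i @ [a])"
| "exec (Incr i) \<sigma> = \<sigma>(i := binary_inc (\<sigma> i))"
| "exec (Seq c d) \<sigma> = exec d (exec c \<sigma>)"
| "exec (For i b) \<sigma> = fold (\<lambda>a. exec (b a)) (\<sigma> i) \<sigma>"

primrec fold_time :: "('a \<Rightarrow> 's \<Rightarrow> 's) \<Rightarrow> ('a \<Rightarrow> 's \<Rightarrow> nat) \<Rightarrow> 'a list \<Rightarrow> 's \<Rightarrow> nat" where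
  "fold_time e t [] s = 0"
| "fold_time e t (a # as) s = t a s + 2 + fold_time e t as (e a s)"

fun inc_time :: "'c sym list \<Rightarrow> nat" where
  "inc_time [] = 1"
| "inc_time (a # xs) = (if a = Bit True then Suc (inc_time xs) else 2 + length xs)"

primrec time :: "'c cmd \<Rightarrow> 'c store \<Rightarrow> nat" where
  "time Skip \<sigma> = 1"
| "time (Append i a) \<sigma> = 1"
| "time (Incr i) \<sigma> = length (\<sigma> i) + 2 + inc_time (\<sigma> i)"
| "time (Seq c d) \<sigma> = 1 + time c \<sigma> + time d (exec c \<sigma>)"
| "time (For i b) \<sigma> =
     length (\<sigma> i) + 3 + fold_time (\<lambda>a. exec (b a)) (\<lambda>a. time (b a)) (\<sigma> i) \<sigma>"

primrec registers :: "'c cmd \<Rightarrow> nat set" where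
  "registers Skip = {}"
| "registers (Append i a) = {i}"
| "registers (Incr i) = {i}"
| "registers (Seq c d) = registers c \<union> registers d"
| "registers (For i b) = insert i (\<Union>a. registers (b a))"

primrec wf_cmd :: "'c cmd \<Rightarrow> bool" where
  "wf_cmd Skip \<longleftrightarrow> True"
| "wf_cmd (Append i a) \<longleftrightarrow> True"
| "wf_cmd (Incr i) \<longleftrightarrow> True"
| "wf_cmd (Seq c d) \<longleftrightarrow> wf_cmd c \<and> wf_cmd d"
| "wf_cmd (For i b) \<longleftrightarrow> (\<forall>a. i \<notin> registers (b a) \<and> wf_cmd (b a))"

lemma fold_exec_other:
  assumes "\<And>a s. exec (b a) s j = s j"
  shows "fold (\<lambda>a. exec (b a)) xs \<sigma> j = \<sigma> j"
  using assms by (induction xs arbitrary: \<sigma>) auto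

lemma exec_other: "j \<notin> registers c \<Longrightarrow> exec c \<sigma> j = \<sigma> j"
  by (induction c arbitrary: \<sigma>) (auto simp: fold_exec_other)

subsection \<open>The control of a program\<close>

datatype 'c instr = Do "'c cmd" | Rewind nat "'c sym \<Rightarrow> 'c cmd" | Scan nat "'c sym \<Rightarrow> 'c cmd"
  | Advance nat "'c sym \<Rightarrow> 'c cmd" | Rewind_Incr nat | Carry nat | Forward nat

fun dispatch ::
    "'c instr list \<Rightarrow> (nat \<Rightarrow> 'c sym option) \<Rightarrow> 'c instr list \<times> nat \<times> 'c sym option \<times> int" where
  "dispatch [] rd = ([], 0, rd 0, 0)"
| "dispatch (Do Skip # K) rd = (K, 0, rd 0, 0)"
| "dispatch (Do (Append i a) # K) rd = (K, i, Some a, 1)"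
| "dispatch (Do (Incr i) # K) rd = (Rewind_Incr i # K, i, rd i, -1)"
| "dispatch (Do (Seq c d) # K) rd = (Do c # Do d # K, 0, rd 0, 0)"
| "dispatch (Do (For i b) # K) rd = (Rewind i b # K, i, rd i, -1)"
| "dispatch (Rewind i b # K) rd =
     (if rd i = None then (Scan i b # K, i, None, 1) else (Rewind i b # K, i, rd i, -1))"
| "dispatch (Scan i b # K) rd =
     (case rd i of None \<Rightarrow> (K, i, None, 0) | Some a \<Rightarrow> (Do (b a) # Advance i b # K, i, Some a, 0))"
| "dispatch (Advance i b # K) rd = (Scan i b # K, i, rd i, 1)"
| "dispatch (Rewind_Incr i # K) rd =
     (if rd i = None then (Carry i # K, i, None, 1) else (Rewind_Incr i # K, i, rd i, -1))"
| "dispatch (Carry i # K) rd =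
     (if rd i = None then (K, i, Some (Bit True), 1)
      else if rd i = Some (Bit True) then (Carry i # K, i, Some (Bit False), 1)
      else if rd i = Some (Bit False) then (Forward i # K, i, Some (Bit True), 1)
      else (Forward i # K, i, rd i, 1))"
| "dispatch (Forward i # K) rd = (if rd i = None then (K, i, None, 0) else (Forward i # K, i, rd i, 1))"

primrec control_points :: "'c cmd \<Rightarrow> 'c instr list set" where
  "control_points Skip = {[Do Skip]}"
| "control_points (Append i a) = {[Do (Append i a)]}"
| "control_points (Incr i) = {[Do (Incr i)], [Rewind_Incr i], [Carry i], [Forward i]}"
| "control_points (Seq c d) =
     {[Do (Seq c d)]} \<union> (\<lambda>p. p @ [Do d]) ` control_points c \<union> control_points d"
| "control_points (For i b) = {[Do (For i b)], [Rewind i b], [Scan i b], [Advance i b]} \<union>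
     (\<Union>a. (\<lambda>p. p @ [Advance i b]) ` control_points (b a))"

lemma finite_control_points: "finite (control_points c)" for c :: "'c::finite cmd"
  by (induction c) auto

lemma Do_in_control_points: "[Do c] \<in> control_points c"
  by (cases c) auto

lemma dispatch_move: "dispatch K rd = (K', i, w, d) \<Longrightarrow> d \<in> {-1, 0, 1}"
  by (cases "(K, rd)" rule: dispatch.cases) (auto split: if_splits option.splits)

lemma dispatch_cong:
  assumes "rd 0 = rd' 0" "rd (fst (snd (dispatch K rd))) = rd' (fst (snd (dispatch K rd)))"
  shows "dispatch K rd = dispatch K rd'"
  using assms
  by (cases "(K, rd)" rule: dispatch.cases) (auto split: if_splits option.splits dest: sym)

definition dispatches_into ::
    "'c instr list \<Rightarrow> 'c instr list set \<Rightarrow> nat set \<Rightarrow> (nat \<Rightarrow> 'c sym option) \<Rightarrow> bool" where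
  "dispatches_into p P I rd \<longleftrightarrow>
     (\<exists>p'\<in>P. \<exists>i\<in>I. \<exists>w d. \<forall>K. dispatch (p @ K) rd = (p' @ K, i, w, d))"

lemma dispatches_into_append:
  assumes "dispatches_into p P I rd"
  shows "dispatches_into (p @ q) ((\<lambda>p. p @ q) ` P) I rd"
  using assms unfolding dispatches_into_def by fastforce

lemma dispatches_into_mono:
  assumes "dispatches_into p P I rd" "P \<subseteq> P'" "I \<subseteq> I'"
  shows "dispatches_into p P' I' rd"
  using assms unfolding dispatches_into_def by (meson subsetD)

lemma dispatches_intoI:
  assumes "\<And>K. dispatch (p @ K) rd = (p' @ K, i, w, d)" "p' \<in> P" "i \<in> I"
  shows "dispatches_into p P I rd"
  using assms unfolding dispatches_into_def by blast

definition closed_control :: "'c cmd \<Rightarrow> bool" where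
  "closed_control c \<longleftrightarrow> (\<forall>p\<in>control_points c. \<forall>rd.
     dispatches_into p (insert [] (control_points c)) (insert 0 (registers c)) rd)"

lemma closed_control_Incr: "closed_control (Incr i)"
proof -
  have "dispatches_into p (insert [] (control_points (Incr i))) (insert 0 (registers (Incr i))) rd"
    if "p \<in> control_points (Incr i)" for p rd
    using that by (cases "rd i = None"; cases "rd i = Some (Bit True)"; cases "rd i = Some (Bit False)")
      (auto simp: dispatches_into_def)
  then show ?thesis unfolding closed_control_def by blast
qed

lemma closed_control_Seq:
  assumes "closed_control c" "closed_control d"
  shows "closed_control (Seq c d)"
  unfolding closed_control_def
proof (intro ballI allI)
  fix p rd assume "p \<in> control_points (Seq c d)"
  then consider (start) "p = [Do (Seq c d)]" | (left) q where "q \<in> control_points c" "p = q @ [Do d]"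
    | (right) "p \<in> control_points d"
    by auto
  then show "dispatches_into p (insert [] (control_points (Seq c d))) (insert 0 (registers (Seq c d))) rd"
  proof cases
    case start
    then show ?thesis
      using Do_in_control_points[of c] by (intro dispatches_intoI[where p' = "[Do c, Do d]"]) auto
  next
    case left
    then have "dispatches_into q (insert [] (control_points c)) (insert 0 (registers c)) rd"
      using assms(1) unfolding closed_control_def by blast
    then show ?thesis
      unfolding left(2) using Do_in_control_points[of d]
      by (intro dispatches_into_mono[OF dispatches_into_append]) auto
  next
    case right
    then have "dispatches_into p (insert [] (control_points d)) (insert 0 (registers d)) rd"
      using assms(2) unfolding closed_control_def by blast
    then show ?thesis by (rule dispatches_into_mono) auto
  qed
qed

lemma closed_control_For:
  assumes "\<And>a. closed_control (b a)"
  shows "closed_control (For i b)"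
  unfolding closed_control_def
proof (intro ballI allI)
  fix p rd assume "p \<in> control_points (For i b)"
  then consider (move) "p \<in> {[Do (For i b)], [Rewind i b], [Advance i b]}" | (scan) "p = [Scan i b]"
    | (body) a q where "q \<in> control_points (b a)" "p = q @ [Advance i b]"
    by auto
  then show "dispatches_into p (insert [] (control_points (For i b))) (insert 0 (registers (For i b))) rd"
  proof cases
    case move
    then show ?thesis by (cases "rd i = None") (auto simp: dispatches_into_def)
  next
    case scan
    have "[Do (b a), Advance i b] \<in> control_points (For i b)" for a
      using Do_in_control_points[of "b a"] by (auto intro!: image_eqI)
    then show ?thesis using scan by (cases "rd i") (auto intro: dispatches_intoI)
  next
    case body
    then have "dispatches_into q (insert [] (control_points (b a))) (insert 0 (registers (b a))) rd"
      using assms unfolding closed_control_def by blast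
    then show ?thesis
      unfolding body(2) by (intro dispatches_into_mono[OF dispatches_into_append]) auto
  qed
qed

lemma closed_control: "closed_control c"
proof (induction c)
  case (Incr i)
  show ?case by (rule closed_control_Incr)
next
  case (Seq c d)
  then show ?case by (rule closed_control_Seq)
next
  case (For i b)
  then show ?case by (intro closed_control_For) simp
qed (simp_all add: closed_control_def dispatches_into_def)

subsection \<open>Execution times\<close>

type_synonym 'a tapes = "nat \<Rightarrow> (int \<Rightarrow> 'a) \<times> int"

fun write_step :: "('q \<Rightarrow> (nat \<Rightarrow> 'a) \<Rightarrow> 'q \<times> nat \<times> 'a \<times> int) \<Rightarrow> 'q \<times> 'a tapes \<Rightarrow> 'q \<times> 'a tapes" where
  "write_step f (q, T) = (case f q (\<lambda>j. fst (T j) (snd (T j))) of (q', i, w, d) \<Rightarrow>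
     (q', T(i := ((fst (T i))(snd (T i) := w), snd (T i) + d))))"

definition list_tape :: "'a list \<Rightarrow> int \<Rightarrow> 'a option" where
  "list_tape xs = (\<lambda>z. if 0 \<le> z \<and> z < int (length xs) then Some (xs ! nat z) else None)"

definition tapes_of :: "'c store \<Rightarrow> (nat \<Rightarrow> int) \<Rightarrow> 'c sym option tapes" where
  "tapes_of \<sigma> h = (\<lambda>j. (list_tape (\<sigma> j), h j))"

definition heads_at_end :: "nat set \<Rightarrow> 'c store \<Rightarrow> (nat \<Rightarrow> int) \<Rightarrow> nat \<Rightarrow> int" where
  "heads_at_end I \<sigma> h = (\<lambda>j. if j \<in> I then int (length (\<sigma> j)) else h j)"

definition reaches ::
    "'c instr list \<times> 'c sym option tapes \<Rightarrow> nat \<Rightarrow> 'c instr list \<times> 'c sym option tapes \<Rightarrow> bool" where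
  "reaches s n s' \<longleftrightarrow> (write_step dispatch ^^ n) s = s'"

lemma reaches_trans [trans]: "reaches s m s' \<Longrightarrow> reaches s' n s'' \<Longrightarrow> reaches s (m + n) s''"
  by (auto simp: reaches_def funpow_add add.commute[of m n])

lemma list_tape_snoc: "(list_tape xs)(int (length xs) := Some a) = list_tape (xs @ [a])"
  by (auto simp: list_tape_def nth_append fun_eq_iff)

lemma list_tape_nth: "i < length xs \<Longrightarrow> list_tape xs (int i) = Some (xs ! i)"
  by (auto simp: list_tape_def)

lemma list_tape_outside [simp]: "list_tape xs (int (length xs)) = None" "list_tape xs (-1) = None"
  by (auto simp: list_tape_def)

lemma list_tape_middle:
  "list_tape (ys @ a # xs) (int (length ys)) = Some a"
  "(list_tape (ys @ a # xs))(int (length ys) := Some a') = list_tape (ys @ a' # xs)"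
  by (auto simp: list_tape_def fun_eq_iff nth_append nth_Cons')

lemma heads_at_end_absorb: "heads_at_end I \<sigma> (heads_at_end J \<sigma> h) = heads_at_end (I \<union> J) \<sigma> h"
  by (auto simp: heads_at_end_def)

lemma reaches_step:
  assumes "dispatch K (\<lambda>j. list_tape (\<sigma> j) (h j)) = (K', i, w, d)"
    and "(list_tape (\<sigma> i))(h i := w) = list_tape (\<sigma>' i)"
    and "\<And>j. j \<noteq> i \<Longrightarrow> \<sigma>' j = \<sigma> j" "\<And>j. j \<noteq> i \<Longrightarrow> h' j = h j" "h' i = h i + d"
  shows "reaches (K, tapes_of \<sigma> h) 1 (K', tapes_of \<sigma>' h')"
proof -
  have "(tapes_of \<sigma> h)(i := (list_tape (\<sigma>' i), h i + d)) = tapes_of \<sigma>' h'"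
    using assms(3-5) by (auto simp: tapes_of_def fun_eq_iff)
  then show ?thesis using assms(1,2) by (simp add: reaches_def tapes_of_def)
qed

lemma reaches_move:
  assumes "dispatch K (\<lambda>j. list_tape (\<sigma> j) (h j)) = (K', i, list_tape (\<sigma> i) (h i), d)"
    and "\<And>j. j \<noteq> i \<Longrightarrow> h' j = h j" "h' i = h i + d"
  shows "reaches (K, tapes_of \<sigma> h) 1 (K', tapes_of \<sigma> h')"
  using assms by (intro reaches_step) auto

lemma reaches_rewind:
  assumes step: "\<And>rd. dispatch (r # K) rd =
     (if rd i = None then (s # K, i, None, 1) else (r # K, i, rd i, -1))"
    and "n \<le> length (\<sigma> i)"
  shows "reaches (r # K, tapes_of \<sigma> (h(i := int n - 1))) (Suc n) (s # K, tapes_of \<sigma> (h(i := 0)))"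
  using assms(2)
proof (induction n)
  case 0
  show ?case
    unfolding One_nat_def[symmetric] by (rule reaches_move[where i = i and d = 1]) (simp_all add: step)
next
  case (Suc n)
  have "reaches (r # K, tapes_of \<sigma> (h(i := int (Suc n) - 1))) 1 (r # K, tapes_of \<sigma> (h(i := int n - 1)))"
    by (rule reaches_move[where i = i and d = "-1"]) (use Suc.prems in \<open>simp_all add: step list_tape_nth\<close>)
  also have "reaches \<dots> (Suc n) (s # K, tapes_of \<sigma> (h(i := 0)))"
    by (rule Suc.IH) (use Suc.prems in simp)
  finally show ?case by (simp only: plus_1_eq_Suc)
qed

lemma reaches_forward:
  assumes "n \<le> length (\<sigma> i)"
  shows "reaches (Forward i # K, tapes_of \<sigma> (h(i := int (length (\<sigma> i) - n)))) (Suc n)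
    (K, tapes_of \<sigma> (h(i := int (length (\<sigma> i)))))"
  using assms
proof (induction n)
  case 0
  show ?case
    unfolding One_nat_def[symmetric] by (rule reaches_move[where i = i and d = 0]) simp_all
next
  case (Suc n)
  let ?k = "length (\<sigma> i) - Suc n"
  have k: "?k < length (\<sigma> i)" using Suc.prems by simp
  have "reaches (Forward i # K, tapes_of \<sigma> (h(i := int ?k))) 1
      (Forward i # K, tapes_of \<sigma> (h(i := int (length (\<sigma> i) - n))))"
    by (rule reaches_move[where i = i and d = 1])
      (use Suc.prems in \<open>simp_all add: list_tape_nth[OF k] del: of_nat_diff\<close>)
  also have "reaches \<dots> (Suc n) (K, tapes_of \<sigma> (h(i := int (length (\<sigma> i)))))"
    by (rule Suc.IH) (use Suc.prems in simp)
  finally show ?case by (simp only: plus_1_eq_Suc)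
qed

lemma reaches_carry:
  assumes "\<sigma> i = ys @ xs"
  shows "reaches (Carry i # K, tapes_of \<sigma> (h(i := int (length ys)))) (inc_time xs)
    (K, tapes_of (\<sigma>(i := ys @ binary_inc xs)) (h(i := int (length (ys @ binary_inc xs)))))"
  using assms
proof (induction xs arbitrary: ys \<sigma>)
  case Nil
  then show ?case
    by (simp only: inc_time.simps binary_inc.simps)
      (rule reaches_step[where i = i and d = 1 and w = "Some (Bit True)"], simp_all add: list_tape_snoc)
next
  case (Cons a xs)
  show ?case
  proof (cases "a = Bit True")
    case True
    let ?s = "\<sigma>(i := ys @ Bit False # xs)"
    have "reaches (Carry i # K, tapes_of \<sigma> (h(i := int (length ys)))) 1
        (Carry i # K, tapes_of ?s (h(i := int (length (ys @ [Bit False])))))"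
      by (rule reaches_step[where i = i and d = 1 and w = "Some (Bit False)"])
        (use Cons.prems True in \<open>simp_all add: list_tape_middle\<close>)
    also have "reaches \<dots> (inc_time xs) (K, tapes_of (?s(i := (ys @ [Bit False]) @ binary_inc xs))
        (h(i := int (length ((ys @ [Bit False]) @ binary_inc xs)))))"
      by (rule Cons.IH) simp
    finally show ?thesis using True by (simp del: fun_upd_apply)
  next
    case False
    let ?a = "if a = Bit False then Bit True else a"
    let ?s = "\<sigma>(i := ys @ ?a # xs)"
    have "reaches (Carry i # K, tapes_of \<sigma> (h(i := int (length ys)))) 1
        (Forward i # K, tapes_of ?s (h(i := int (length (?s i) - length xs))))"
      by (rule reaches_step[where i = i and d = 1 and w = "Some ?a"])
        (use Cons.prems False in \<open>simp_all add: list_tape_middle\<close>)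
    also have "reaches \<dots> (Suc (length xs)) (K, tapes_of ?s (h(i := int (length (?s i)))))"
      by (rule reaches_forward) simp
    finally show ?thesis using False by (simp del: fun_upd_apply add: fun_upd_same add_ac split: if_splits)
  qed
qed

text \<open>Between commands every head used by the program stands just after the contents of its tape.\<close>

definition executes :: "'c cmd \<Rightarrow> bool" where
  "executes c \<longleftrightarrow> (\<forall>\<sigma> h K. reaches (Do c # K, tapes_of \<sigma> (heads_at_end (registers c) \<sigma> h)) (time c \<sigma>)
     (K, tapes_of (exec c \<sigma>) (heads_at_end (registers c) (exec c \<sigma>) h)))"

lemma executes_Skip: "executes Skip"
  unfolding executes_def exec.simps registers.simps time.simps
  by (intro allI reaches_move[where i = 0 and d = 0]) simp_all

lemma executes_Append: "executes (Append i a)"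
  unfolding executes_def exec.simps registers.simps time.simps
  by (intro allI reaches_step[where i = i and d = 1 and w = "Some a"])
    (simp_all add: heads_at_end_def list_tape_snoc)

lemma executes_Incr: "executes (Incr i)"
  unfolding executes_def
proof (intro allI)
  fix \<sigma> :: "'c store" and h K
  let ?h = "heads_at_end {i} \<sigma> h" and ?\<sigma>' = "\<sigma>(i := binary_inc (\<sigma> i))"
  have "reaches (Do (Incr i) # K, tapes_of \<sigma> ?h) 1
      (Rewind_Incr i # K, tapes_of \<sigma> (?h(i := int (length (\<sigma> i)) - 1)))"
    by (rule reaches_move[where i = i and d = "-1"]) (simp_all add: heads_at_end_def)
  also have "reaches \<dots> (Suc (length (\<sigma> i))) (Carry i # K, tapes_of \<sigma> (?h(i := 0)))"
    by (rule reaches_rewind) simp_all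
  also have "reaches \<dots> (inc_time (\<sigma> i)) (K, tapes_of ?\<sigma>' (?h(i := int (length (binary_inc (\<sigma> i))))))"
    using reaches_carry[of \<sigma> i "[]" "\<sigma> i" K ?h] by simp
  also have "?h(i := int (length (binary_inc (\<sigma> i)))) = heads_at_end {i} ?\<sigma>' h"
    by (auto simp: heads_at_end_def)
  finally show "reaches (Do (Incr i) # K, tapes_of \<sigma> (heads_at_end (registers (Incr i)) \<sigma> h)) (time (Incr i) \<sigma>)
      (K, tapes_of (exec (Incr i) \<sigma>) (heads_at_end (registers (Incr i)) (exec (Incr i) \<sigma>) h))"
    by (simp add: numeral_2_eq_2 del: fun_upd_apply)
qed

lemma executes_Seq:
  fixes c d :: "'c cmd"
  assumes c: "executes c" and d: "executes d"
  shows "executes (Seq c d)"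
  unfolding executes_def
proof (intro allI)
  fix \<sigma> :: "'c store" and h K
  let ?I = "registers c" and ?J = "registers d" and ?s = "exec c \<sigma>"
  have "reaches (Do (Seq c d) # K, tapes_of \<sigma> (heads_at_end (?I \<union> ?J) \<sigma> h)) 1
      (Do c # Do d # K, tapes_of \<sigma> (heads_at_end ?I \<sigma> (heads_at_end ?J \<sigma> h)))"
    by (rule reaches_move[where i = 0 and d = 0]) (simp_all add: heads_at_end_absorb)
  also have "reaches \<dots> (time c \<sigma>) (Do d # K, tapes_of ?s (heads_at_end ?I ?s (heads_at_end ?J \<sigma> h)))"
    using c unfolding executes_def by blast
  also have "heads_at_end ?I ?s (heads_at_end ?J \<sigma> h) = heads_at_end ?J ?s (heads_at_end ?I ?s h)"
    by (auto simp: heads_at_end_def exec_other)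
  also have "reaches (Do d # K, tapes_of ?s (heads_at_end ?J ?s (heads_at_end ?I ?s h))) (time d ?s)
      (K, tapes_of (exec d ?s) (heads_at_end ?J (exec d ?s) (heads_at_end ?I ?s h)))"
    using d unfolding executes_def by blast
  also have "heads_at_end ?J (exec d ?s) (heads_at_end ?I ?s h) = heads_at_end (?I \<union> ?J) (exec d ?s) h"
    by (auto simp: heads_at_end_def exec_other)
  finally show "reaches (Do (Seq c d) # K, tapes_of \<sigma> (heads_at_end (registers (Seq c d)) \<sigma> h))
      (time (Seq c d) \<sigma>) (K, tapes_of (exec (Seq c d) \<sigma>) (heads_at_end (registers (Seq c d)) (exec (Seq c d) \<sigma>) h))"
    by simp
qed

lemma reaches_scan:
  fixes b :: "'c sym \<Rightarrow> 'c cmd"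
  defines "J \<equiv> \<Union>a. registers (b a)"
  assumes i: "i \<notin> J" and body: "\<And>a. executes (b a)" and "s i = ys @ xs"
  shows "reaches (Scan i b # K, tapes_of s (heads_at_end J s (h(i := int (length ys)))))
    (Suc (fold_time (\<lambda>a. exec (b a)) (\<lambda>a. time (b a)) xs s))
    (K, tapes_of (fold (\<lambda>a. exec (b a)) xs s)
      (heads_at_end J (fold (\<lambda>a. exec (b a)) xs s) (h(i := int (length (s i))))))"
  using assms(4)
proof (induction xs arbitrary: s ys)
  case Nil
  have "reaches (Scan i b # K, tapes_of s (heads_at_end J s (h(i := int (length ys))))) 1
      (K, tapes_of s (heads_at_end J s (h(i := int (length (s i))))))"
    by (rule reaches_move[where i = i and d = 0]) (use Nil i in \<open>simp_all add: heads_at_end_def\<close>)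
  then show ?case by (simp del: fun_upd_apply)
next
  case (Cons a xs)
  let ?h = "h(i := int (length ys))" and ?s = "exec (b a) s"
  have unchanged: "?s i = s i" using i by (simp add: exec_other J_def)
  have split: "heads_at_end (registers (b a)) s (heads_at_end J s ?h) = heads_at_end J s ?h"
    by (auto simp: heads_at_end_def J_def)
  have "reaches (Scan i b # K, tapes_of s (heads_at_end J s ?h)) 1
      (Do (b a) # Advance i b # K, tapes_of s (heads_at_end (registers (b a)) s (heads_at_end J s ?h)))"
    unfolding split by (rule reaches_move[where i = i and d = 0])
      (use Cons.prems i in \<open>simp_all add: heads_at_end_def list_tape_middle\<close>)
  also have "reaches \<dots> (time (b a) s)
      (Advance i b # K, tapes_of ?s (heads_at_end (registers (b a)) ?s (heads_at_end J s ?h)))"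
    using body unfolding executes_def by blast
  also have "heads_at_end (registers (b a)) ?s (heads_at_end J s ?h) = heads_at_end J ?s ?h"
    by (auto simp: heads_at_end_def exec_other J_def)
  also have "reaches (Advance i b # K, tapes_of ?s (heads_at_end J ?s ?h)) 1
      (Scan i b # K, tapes_of ?s (heads_at_end J ?s (h(i := int (length (ys @ [a]))))))"
    by (rule reaches_move[where i = i and d = 1]) (use i in \<open>simp_all add: heads_at_end_def\<close>)
  also have "reaches \<dots> (Suc (fold_time (\<lambda>a. exec (b a)) (\<lambda>a. time (b a)) xs ?s))
      (K, tapes_of (fold (\<lambda>a. exec (b a)) xs ?s)
        (heads_at_end J (fold (\<lambda>a. exec (b a)) xs ?s) (h(i := int (length (?s i))))))"
    by (rule Cons.IH) (use unchanged Cons.prems in simp)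
  finally show ?case unfolding unchanged by (simp add: numeral_2_eq_2 del: fun_upd_apply)
qed

lemma executes_For:
  fixes b :: "'c sym \<Rightarrow> 'c cmd"
  assumes i: "\<And>a. i \<notin> registers (b a)" and body: "\<And>a. executes (b a)"
  shows "executes (For i b)"
  unfolding executes_def
proof (intro allI)
  fix \<sigma> :: "'c store" and h K
  let ?J = "\<Union>a. registers (b a)"
  let ?h = "heads_at_end (insert i ?J) \<sigma> h" and ?s = "fold (\<lambda>a. exec (b a)) (\<sigma> i) \<sigma>"
  have unchanged: "?s i = \<sigma> i" using i by (intro fold_exec_other exec_other)
  have "reaches (Do (For i b) # K, tapes_of \<sigma> ?h) 1 (Rewind i b # K, tapes_of \<sigma> (?h(i := int (length (\<sigma> i)) - 1)))"
    by (rule reaches_move[where i = i and d = "-1"]) (simp_all add: heads_at_end_def)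
  also have "reaches \<dots> (Suc (length (\<sigma> i))) (Scan i b # K, tapes_of \<sigma> (?h(i := 0)))"
    by (rule reaches_rewind) simp_all
  also have "?h(i := 0) = heads_at_end ?J \<sigma> (h(i := int (length ([] :: 'c sym list))))"
    using i by (auto simp: heads_at_end_def fun_eq_iff)
  also have "reaches (Scan i b # K, tapes_of \<sigma> \<dots>)
      (Suc (fold_time (\<lambda>a. exec (b a)) (\<lambda>a. time (b a)) (\<sigma> i) \<sigma>))
      (K, tapes_of ?s (heads_at_end ?J ?s (h(i := int (length (\<sigma> i))))))"
    by (rule reaches_scan) (use i body in auto)
  also have "heads_at_end ?J ?s (h(i := int (length (\<sigma> i)))) = heads_at_end (insert i ?J) ?s h"
    using i unchanged by (auto simp: heads_at_end_def fun_eq_iff)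
  finally show "reaches (Do (For i b) # K, tapes_of \<sigma> (heads_at_end (registers (For i b)) \<sigma> h))
      (time (For i b) \<sigma>) (K, tapes_of (exec (For i b) \<sigma>) (heads_at_end (registers (For i b)) (exec (For i b) \<sigma>) h))"
    by (simp add: numeral_3_eq_3 del: fun_upd_apply)
qed

lemma executes_if_wf_cmd: "wf_cmd c \<Longrightarrow> executes c"
  by (induction c) (simp_all add: executes_Skip executes_Append executes_Incr executes_Seq executes_For)

subsection \<open>Compilation to Turing machines\<close>

lemma bij_betw_lessThan_two_values:
  assumes "finite Q" "a \<in> Q" "b \<in> Q" "a \<noteq> b"
  shows "\<exists>f. bij_betw f Q {..<card Q} \<and> f a = 0 \<and> f b = 1"
proof -
  have "card {a, b} \<le> card Q" using assms by (intro card_mono) auto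
  then have "2 \<le> card Q" using assms(4) by simp
  then have target: "{..<card Q} = {0, 1} \<union> {2..<card Q}" by auto
  have source: "{a, b} \<union> (Q - {a, b}) = Q" using assms by auto
  have "card (Q - {a, b}) = card {2..<card Q}"
    using assms by (simp add: card_Diff_subset)
  then obtain g where g: "bij_betw g (Q - {a, b}) {2..<card Q}"
    using assms(1) by (metis finite_Diff finite_atLeastLessThan finite_same_card_bij)
  let ?f = "\<lambda>q. if q \<in> {a, b} then (if q = a then 0 else 1) else g q"
  have "bij_betw ?f ({a, b} \<union> (Q - {a, b})) ({0, 1} \<union> {2..<card Q})"
  proof (rule bij_betw_disjoint_Un)
    show "bij_betw (\<lambda>q. if q = a then 0 else (1::nat)) {a, b} {0, 1}"
      using assms(4) by (auto simp: bij_betw_def)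
  qed (use g in auto)
  then show ?thesis
    unfolding source target using assms(4) by (intro exI[of _ ?f]) auto
qed

fun symbol_code :: "'c::finite sym option \<Rightarrow> nat" where
  "symbol_code None = 0"
| "symbol_code (Some (Bit b)) = bit_symbol b"
| "symbol_code (Some (Mark c)) = 3 + to_nat_on UNIV c"

lemma symbol_code_less: "symbol_code s < 3 + CARD('c)" for s :: "'c::finite sym option"
proof (cases s rule: symbol_code.cases)
  case (3 c)
  then show ?thesis using bij_betwE[OF to_nat_on_finite[of "UNIV :: 'c set"]] by simp
qed (auto simp: bit_symbol_def)

lemma inj_symbol_code: "inj (symbol_code :: 'c::finite sym option \<Rightarrow> nat)"
proof (rule injI)
  have "inj (to_nat_on (UNIV :: 'c set))" by (rule inj_on_to_nat_on) simp
  then show "s = t" if "symbol_code s = symbol_code t" for s t :: "'c sym option"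
    using that
    by (cases s rule: symbol_code.cases; cases t rule: symbol_code.cases)
      (auto simp: bit_symbol_def dest: injD split: if_splits)
qed

definition init_store :: "bool list \<Rightarrow> 'c store" where
  "init_store x = (\<lambda>i. if i = 0 then map Bit x else [])"

locale single_write_machine =
  fixes Q :: "'q set" and start stop :: 'q and R :: nat
    and \<delta> :: "'q \<Rightarrow> (nat \<Rightarrow> 'c::finite sym option) \<Rightarrow> 'q \<times> nat \<times> 'c sym option \<times> int"
  assumes finite_states: "finite Q" and start: "start \<in> Q" and stop: "stop \<in> Q"
    and start_neq_stop: "start \<noteq> stop" and two_tapes: "2 \<le> R"
    and closed: "q \<in> Q \<Longrightarrow> \<delta> q rd = (q', i, w, d) \<Longrightarrow> q' \<in> Q \<and> i < R \<and> d \<in> {-1, 0, 1}"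
    and local: "q \<in> Q \<Longrightarrow> (\<And>j. j < R \<Longrightarrow> rd j = rd' j) \<Longrightarrow> \<delta> q rd = \<delta> q rd'"
    and stopped: "write_step \<delta> (stop, T) = (stop, T)"
begin

definition number :: "'q \<Rightarrow> nat" where
  "number = (SOME f. bij_betw f Q {..<card Q} \<and> f start = 0 \<and> f stop = 1)"

definition machine :: tm where
  "machine = \<lparr>tm_tapes = R, tm_states = card Q, tm_symbols = 3 + CARD('c), tm_delta = (\<lambda>q ss.
     case \<delta> (inv_into Q number q) (\<lambda>j. inv symbol_code (ss ! j)) of (q', i, w, d) \<Rightarrow>
       (number q', map (\<lambda>j. if j = i then (symbol_code w, d) else (ss ! j, 0)) [0..<R]))\<rparr>"

definition encode_tapes :: "'c sym option tapes \<Rightarrow> tape list" where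
  "encode_tapes T = map (\<lambda>j. (\<lambda>z. symbol_code (fst (T j) z), snd (T j))) [0..<R]"

fun encode_config :: "'q \<times> 'c sym option tapes \<Rightarrow> tm_config" where
  "encode_config (q, T) = (number q, encode_tapes T)"

lemma bij_betw_number: "bij_betw number Q {..<card Q}"
  and number_start: "number start = 0"
  and number_stop: "number stop = 1"
  using someI_ex[OF bij_betw_lessThan_two_values[OF finite_states start stop start_neq_stop]]
  unfolding number_def by blast+

lemma inv_number: "q \<in> Q \<Longrightarrow> inv_into Q number (number q) = q"
  by (rule bij_betw_inv_into_left[OF bij_betw_number])

lemma number_less: "q \<in> Q \<Longrightarrow> number q < card Q"
  using bij_betwE[OF bij_betw_number] by blast

lemma inv_number_in: "k < card Q \<Longrightarrow> inv_into Q number k \<in> Q"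
  using bij_betw_imp_surj_on[OF bij_betw_number] by (intro inv_into_into) auto

lemma valid_machine: "valid_tm machine"
  unfolding valid_tm_def
proof (intro conjI allI impI)
  have "card {start, stop} \<le> card Q" using finite_states start stop by (intro card_mono) auto
  then show "2 \<le> tm_states machine" using start_neq_stop by (simp add: machine_def)
  fix q ss assume q: "q < tm_states machine"
    and ss: "length ss = tm_tapes machine \<and> set ss \<subseteq> {..<tm_symbols machine}"
  obtain q' i w d where step: "\<delta> (inv_into Q number q) (\<lambda>j. inv symbol_code (ss ! j)) = (q', i, w, d)"
    by (metis prod_cases4)
  have "inv_into Q number q \<in> Q" using inv_number_in q by (simp add: machine_def)
  from closed[OF this step] have "q' \<in> Q \<and> d \<in> {-1, 0, 1}" by blast
  moreover have "ss ! j < 3 + CARD('c)" if "j < R" for j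
    using ss that by (auto simp: machine_def subset_iff)
  ultimately show "case tm_delta machine q ss of (q', as) \<Rightarrow> q' < tm_states machine \<and>
      length as = tm_tapes machine \<and> (\<forall>(a, d)\<in>set as. a < tm_symbols machine \<and> d \<in> {-1, 0, 1})"
    using symbol_code_less[of w] number_less by (auto simp: machine_def step)
qed (use two_tapes in \<open>simp_all add: machine_def\<close>)

lemma write_step_closed: "q \<in> Q \<Longrightarrow> fst (write_step \<delta> (q, T)) \<in> Q"
  using closed by (auto split: prod.splits)

lemma tm_step_machine:
  assumes "q \<in> Q"
  shows "tm_step machine (encode_config (q, T)) = encode_config (write_step \<delta> (q, T))"
proof (cases "q = stop")
  case True
  then show ?thesis using number_stop stopped by simp
next
  case False
  have running: "number q \<noteq> 1"
    using False assms stop number_stop bij_betw_imp_inj_on[OF bij_betw_number] by (metis inj_onD)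
  let ?rd = "\<lambda>j. fst (T j) (snd (T j))"
  obtain q' i w d where step: "\<delta> q ?rd = (q', i, w, d)" by (metis prod_cases4)
  let ?T' = "T(i := ((fst (T i))(snd (T i) := w), snd (T i) + d))"
  let ?acts = "map (\<lambda>j. if j = i then (symbol_code w, d) else (symbol_code (?rd j), 0)) [0..<R]"
  have reads: "map tape_read (encode_tapes T) ! j = symbol_code (?rd j)" if "j < R" for j
    using that by (simp add: encode_tapes_def)
  then have "\<delta> q (\<lambda>j. inv symbol_code (map tape_read (encode_tapes T) ! j)) = \<delta> q ?rd"
    by (intro local[OF assms]) (simp only: inv_f_f[OF inj_symbol_code])
  then have "tm_delta machine (number q) (map tape_read (encode_tapes T)) = (number q', ?acts)"
    using reads by (simp add: machine_def inv_number[OF assms] step)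
  moreover have "map2 tape_act (encode_tapes T) ?acts = encode_tapes ?T'"
    by (rule nth_equalityI) (auto simp: encode_tapes_def fun_eq_iff)
  ultimately show ?thesis using running by (simp add: step)
qed

lemma funpow_tm_step_machine:
  assumes "q \<in> Q"
  shows "(tm_step machine ^^ t) (encode_config (q, T)) = encode_config ((write_step \<delta> ^^ t) (q, T)) \<and>
    fst ((write_step \<delta> ^^ t) (q, T)) \<in> Q"
proof (induction t)
  case (Suc t)
  obtain q' T' where "(write_step \<delta> ^^ t) (q, T) = (q', T')" by force
  then show ?case using Suc tm_step_machine[of q' T'] write_step_closed[of q' T'] by (simp del: write_step.simps)
qed (use assms in simp)

lemma tm_init_machine: "tm_init machine x = encode_config (start, tapes_of (init_store x) (\<lambda>_. 0))"
proof -
  have "word_tape x # replicate (R - 1) (word_tape []) = encode_tapes (tapes_of (init_store x) (\<lambda>_. 0))"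
  proof (rule nth_equalityI)
    fix j assume "j < length (word_tape x # replicate (R - 1) (word_tape []))"
    then have "j < R" using two_tapes by simp
    then show "(word_tape x # replicate (R - 1) (word_tape [])) ! j =
        encode_tapes (tapes_of (init_store x) (\<lambda>_. 0)) ! j"
      by (cases j)
        (auto simp: encode_tapes_def word_tape_def tapes_of_def init_store_def list_tape_def fun_eq_iff)
  qed (use two_tapes in \<open>simp add: encode_tapes_def\<close>)
  then show ?thesis by (simp add: tm_init_def number_start machine_def)
qed

theorem polytime_computable_if_stops:
  assumes "\<And>x. \<exists>t T. t \<le> poly p (length x) \<and> (write_step \<delta> ^^ t) (start, tapes_of (init_store x) (\<lambda>_. 0)) = (stop, T) \<and>
    fst (T 1) = list_tape (map Bit (f x))"
  shows "polytime_computable f"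
proof -
  have "tm_outputs_within machine x (poly p (length x)) (f x)" for x
  proof -
    from assms obtain t T where t: "t \<le> poly p (length x)"
      and run: "(write_step \<delta> ^^ t) (start, tapes_of (init_store x) (\<lambda>_. 0)) = (stop, T)"
      and out: "fst (T 1) = list_tape (map Bit (f x))" by blast
    have "(write_step \<delta> ^^ r) (stop, T) = (stop, T)" for r
      by (induction r) (simp_all add: stopped del: write_step.simps)
    moreover have "poly p (length x) = (poly p (length x) - t) + t" using t by simp
    ultimately have "(write_step \<delta> ^^ poly p (length x)) (start, tapes_of (init_store x) (\<lambda>_. 0)) = (stop, T)"
      using run by (metis comp_apply funpow_add)
    then have "(tm_step machine ^^ poly p (length x)) (tm_init machine x) = encode_config (stop, T)"
      using funpow_tm_step_machine[OF start] by (simp only: tm_init_machine)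
    then show ?thesis
      using two_tapes out by (simp add: tm_outputs_within_def number_stop encode_tapes_def list_tape_def)
  qed
  then show ?thesis using valid_machine unfolding polytime_computable_def by blast
qed

end

definition program_states :: "'c cmd \<Rightarrow> 'c instr list set" where
  "program_states c = insert [] (insert [Forward 0, Do c] (control_points c))"

lemma dispatch_program_states:
  assumes "registers c \<subseteq> {..<R}" "2 \<le> R"
    and K: "K \<in> program_states c" and step: "dispatch K rd = (K', i, w, d)"
  shows "K' \<in> program_states c \<and> i < R \<and> d \<in> {-1, 0, 1}"
proof -
  from K consider (entry) "K = [] \<or> K = [Forward 0, Do c]" | (control) "K \<in> control_points c"
    unfolding program_states_def by blast
  then have "K' \<in> program_states c \<and> i < R"
  proof cases
    case entry
    then show ?thesis
      using step assms(2) Do_in_control_points[of c] by (auto simp: program_states_def split: if_splits)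
  next
    case control
    then have "dispatches_into K (insert [] (control_points c)) (insert 0 (registers c)) rd"
      using closed_control[of c] unfolding closed_control_def by blast
    then have "dispatches_into K (program_states c) {..<R} rd"
      using assms(1,2) by (elim dispatches_into_mono) (auto simp: program_states_def)
    then show ?thesis
      using step unfolding dispatches_into_def by (metis Pair_inject append_Nil2 lessThan_iff)
  qed
  then show ?thesis using dispatch_move[OF step] by blast
qed

lemma reaches_exec:
  fixes c :: "'c cmd"
  assumes "wf_cmd c"
  obtains T where "fst (T 1) = list_tape (exec c (init_store x) 1)"
    "reaches ([Forward 0, Do c], tapes_of (init_store x) (\<lambda>_. 0)) (Suc (length x) + time c (init_store x)) ([], T)"
proof
  let ?\<sigma> = "init_store x :: 'c store" and ?h = "(\<lambda>_. 0)(0 := int (length x))"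
  let ?T = "tapes_of (exec c ?\<sigma>) (heads_at_end (registers c) (exec c ?\<sigma>) ?h)"
  have origin: "(\<lambda>_. 0)(0 := int (length (?\<sigma> 0) - length x)) = (\<lambda>_. 0)"
    by (auto simp: init_store_def fun_eq_iff)
  have "reaches ([Forward 0, Do c], tapes_of ?\<sigma> ((\<lambda>_. 0)(0 := int (length (?\<sigma> 0) - length x)))) (Suc (length x))
      ([Do c], tapes_of ?\<sigma> ((\<lambda>_. 0)(0 := int (length (?\<sigma> 0)))))"
    by (rule reaches_forward) (simp add: init_store_def)
  also have "(\<lambda>_. 0)(0 := int (length (?\<sigma> 0))) = heads_at_end (registers c) ?\<sigma> ?h"
    by (auto simp: heads_at_end_def init_store_def fun_eq_iff)
  also have "reaches ([Do c], tapes_of ?\<sigma> \<dots>) (time c ?\<sigma>) ([], ?T)"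
    using executes_if_wf_cmd[OF assms] unfolding executes_def by blast
  finally show "reaches ([Forward 0, Do c], tapes_of ?\<sigma> (\<lambda>_. 0)) (Suc (length x) + time c ?\<sigma>) ([], ?T)"
    unfolding origin .
  show "fst (?T 1) = list_tape (exec c ?\<sigma> 1)" by (simp add: tapes_of_def)
qed

theorem polytime_computable_exec:
  fixes c :: "'c::finite cmd"
  assumes wf: "wf_cmd c" and registers: "registers c \<subseteq> {..<R}" "2 \<le> R"
    and out: "\<And>x. exec c (init_store x) 1 = map Bit (f x)"
    and time: "\<And>x. time c (init_store x) \<le> poly p (length x)"
  shows "polytime_computable f"
proof -
  let ?start = "[Forward 0, Do c]"
  note closed = dispatch_program_states[OF registers]
  interpret single_write_machine "program_states c" ?start "[]" R dispatch
  proof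
    show "dispatch K rd = dispatch K rd'"
      if "K \<in> program_states c" "\<And>j. j < R \<Longrightarrow> rd j = rd' j" for K and rd rd' :: "nat \<Rightarrow> 'c sym option"
      using closed[OF that(1)] that(2) registers(2) by (intro dispatch_cong) (auto simp: prod_eq_iff)
  qed (use closed registers(2) in \<open>auto simp: program_states_def finite_control_points fun_eq_iff\<close>)
  show ?thesis
  proof (rule polytime_computable_if_stops)
    fix x
    obtain T where "fst (T 1) = list_tape (exec c (init_store x) 1)"
      "reaches (?start, tapes_of (init_store x) (\<lambda>_. 0)) (Suc (length x) + time c (init_store x)) ([], T)"
      using wf by (rule reaches_exec)
    moreover have "Suc (length x) + time c (init_store x) \<le> poly ([:1, 1:] + p) (length x)"
      using time[of x] by simp
    ultimately show "\<exists>t T. t \<le> poly ([:1, 1:] + p) (length x) \<and>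
        (write_step dispatch ^^ t) (?start, tapes_of (init_store x) (\<lambda>_. 0)) = ([], T) \<and>
        fst (T 1) = list_tape (map Bit (f x))"
      unfolding out reaches_def by (intro exI conjI)
  qed
qed

section \<open>Composing polynomial-time programs\<close>

lemma finite_registers: "finite (registers c)" for c :: "'c::finite cmd"
  by (induction c) auto

lemma length_binary_inc: "length (binary_inc xs) \<le> Suc (length xs)"
  by (induction xs rule: binary_inc.induct) auto

lemma inc_time_le: "inc_time xs \<le> length xs + 1"
  by (induction xs rule: inc_time.induct) auto

lemma length_exec: "length (exec c \<sigma> i) \<le> length (\<sigma> i) + time c \<sigma>"
proof (induction c arbitrary: \<sigma>)
  case (Incr j)
  then show ?case using length_binary_inc[of "\<sigma> j"] by (simp add: le_SucI)
next
  case (Seq c d)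
  show ?case using Seq.IH(1)[of \<sigma>] Seq.IH(2)[of "exec c \<sigma>"] by simp
next
  case (For j b)
  have "length (fold (\<lambda>a. exec (b a)) xs s i) \<le>
      length (s i) + fold_time (\<lambda>a. exec (b a)) (\<lambda>a. time (b a)) xs s" for xs s
  proof (induction xs arbitrary: s)
    case (Cons a xs)
    have "length (exec (b a) s i) \<le> length (s i) + time (b a) s" using For.IH[of "b a"] by blast
    then show ?case using Cons.IH[of "exec (b a) s"] by simp
  qed simp
  from this[of "\<sigma> j" \<sigma>] show ?case by simp
qed auto

definition polytime :: "'c cmd \<Rightarrow> bool" where
  "polytime c \<longleftrightarrow> wf_cmd c \<and>
     (\<exists>K d. \<forall>\<sigma> Z. (\<forall>i. length (\<sigma> i) \<le> Z) \<longrightarrow> time c \<sigma> \<le> K * (Z + 1) ^ d)"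

lemma polytime_computable_program:
  fixes c :: "'c::finite cmd"
  assumes "polytime c" and "\<And>x. exec c (init_store x) 1 = map Bit (f x)"
  shows "polytime_computable f"
proof -
  from assms(1) obtain K d where wf: "wf_cmd c"
    and time: "\<And>\<sigma> Z. (\<And>i. length (\<sigma> i) \<le> Z) \<Longrightarrow> time c \<sigma> \<le> K * (Z + 1) ^ d"
    unfolding polytime_def by blast
  obtain R where "\<forall>i\<in>registers c. i < R"
    using finite_registers[of c] unfolding finite_nat_set_iff_bounded by blast
  moreover have "time c (init_store x) \<le> poly (smult K ([:1, 1:] ^ d)) (length x)" for x
    using time[of "init_store x" "length x"] by (simp add: init_store_def poly_power add.commute)
  ultimately show ?thesis
    by (intro polytime_computable_exec[OF wf _ _ assms(2), where R = "R + 2" and p = "smult K ([:1, 1:] ^ d)"])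
      fastforce+
qed

lemma power_bound_mono: "K \<le> K' \<Longrightarrow> d \<le> d' \<Longrightarrow> K * (Z + 1) ^ d \<le> K' * ((Z::nat) + 1) ^ d'"
  by (intro mult_le_mono power_increasing) auto

lemma power_bound_compose:
  fixes K k L l Z Y :: nat
  assumes "Y \<le> Z + K * (Z + 1) ^ k"
  shows "L * (Y + 1) ^ l \<le> (L * (K + 1) ^ l) * (Z + 1) ^ ((k + 1) * l)"
proof -
  have "K * (Z + 1) ^ k \<le> K * (Z + 1) ^ (k + 1)" by (rule power_bound_mono) auto
  moreover have "(Z + 1) ^ 1 \<le> (Z + 1) ^ (k + 1)" by (rule power_increasing) auto
  ultimately have "Y + 1 \<le> (K + 1) * (Z + 1) ^ (k + 1)"
    using assms unfolding add_mult_distrib power_one_right by linarith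
  then have "(Y + 1) ^ l \<le> ((K + 1) * (Z + 1) ^ (k + 1)) ^ l" by (rule power_mono) simp
  also have "\<dots> = (K + 1) ^ l * (Z + 1) ^ ((k + 1) * l)" by (simp only: power_mult_distrib power_mult)
  finally show ?thesis unfolding mult.assoc by (rule mult_le_mono2)
qed

lemma polytime_Seq:
  assumes "polytime c" "polytime d"
  shows "polytime (Seq c d)"
proof -
  from assms obtain K k L l where wf: "wf_cmd c" "wf_cmd d"
    and c: "\<And>\<sigma> Z. (\<And>i. length (\<sigma> i) \<le> Z) \<Longrightarrow> time c \<sigma> \<le> K * (Z + 1) ^ k"
    and d: "\<And>\<sigma> Z. (\<And>i. length (\<sigma> i) \<le> Z) \<Longrightarrow> time d \<sigma> \<le> L * (Z + 1) ^ l"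
    unfolding polytime_def by blast
  let ?K = "1 + K + L * (K + 1) ^ l" and ?d = "k + (k + 1) * l"
  have "time (Seq c d) \<sigma> \<le> ?K * (Z + 1) ^ ?d" if Z: "\<And>i. length (\<sigma> i) \<le> Z" for \<sigma> Z
  proof -
    have time_c: "time c \<sigma> \<le> K * (Z + 1) ^ k" using c Z by blast
    have "length (exec c \<sigma> i) \<le> Z + K * (Z + 1) ^ k" for i
      using length_exec[of c \<sigma> i] Z[of i] time_c by linarith
    from d[OF this] have "time d (exec c \<sigma>) \<le> (L * (K + 1) ^ l) * (Z + 1) ^ ((k + 1) * l)"
      by (rule le_trans[OF _ power_bound_compose[OF order_refl]])
    moreover have "K * (Z + 1) ^ k \<le> K * (Z + 1) ^ ?d"
      "(L * (K + 1) ^ l) * (Z + 1) ^ ((k + 1) * l) \<le> (L * (K + 1) ^ l) * (Z + 1) ^ ?d"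
      by (rule power_bound_mono; simp)+
    moreover have "1 \<le> (Z + 1) ^ ?d" by simp
    ultimately have "1 + time c \<sigma> + time d (exec c \<sigma>) \<le> ?K * (Z + 1) ^ ?d"
      using time_c unfolding add_mult_distrib by linarith
    then show ?thesis by simp
  qed
  then show ?thesis unfolding polytime_def using wf by (metis wf_cmd.simps(4))
qed

subsection \<open>Generators\<close>

text \<open>
  The command only appends to register \<open>r\<close> and only reads the registers in \<open>I\<close>; this is what keeps
  nested loops polynomial.
\<close>

definition generates_within ::
    "'c cmd \<Rightarrow> nat \<Rightarrow> nat set \<Rightarrow> ('c store \<Rightarrow> 'c sym list) \<Rightarrow> nat \<Rightarrow> nat \<Rightarrow> bool" where
  "generates_within c r I v K d \<longleftrightarrow> (\<forall>\<sigma> Z ys. (\<forall>i\<in>I. length (\<sigma> i) \<le> Z) \<longrightarrow>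
     exec c (\<sigma>(r := ys)) = \<sigma>(r := ys @ v \<sigma>) \<and> time c (\<sigma>(r := ys)) \<le> K * (Z + 1) ^ d)"

definition generates :: "'c cmd \<Rightarrow> nat \<Rightarrow> nat set \<Rightarrow> ('c store \<Rightarrow> 'c sym list) \<Rightarrow> bool" where
  "generates c r I v \<longleftrightarrow> r \<notin> I \<and> finite I \<and> wf_cmd c \<and> registers c \<subseteq> insert r I \<and>
     (\<exists>K d. generates_within c r I v K d)"

lemma generates_withinD:
  assumes "generates_within c r I v K d" "\<forall>i\<in>I. length (\<sigma> i) \<le> Z"
  shows "exec c (\<sigma>(r := ys)) = \<sigma>(r := ys @ v \<sigma>)" "time c (\<sigma>(r := ys)) \<le> K * (Z + 1) ^ d"
  using assms unfolding generates_within_def by blast+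

lemma generatesI:
  assumes "r \<notin> I" "finite I" "wf_cmd c" "registers c \<subseteq> insert r I"
    and "\<And>\<sigma> Z ys. \<forall>i\<in>I. length (\<sigma> i) \<le> Z \<Longrightarrow>
      exec c (\<sigma>(r := ys)) = \<sigma>(r := ys @ v \<sigma>) \<and> time c (\<sigma>(r := ys)) \<le> K * (Z + 1) ^ d"
  shows "generates c r I v"
proof -
  have "generates_within c r I v K d" unfolding generates_within_def using assms(5) by blast
  then show ?thesis unfolding generates_def using assms(1-4) by blast
qed

lemma generates_mono:
  assumes "generates c r I v" "I \<subseteq> J" "r \<notin> J" "finite J"
  shows "generates c r J v"
proof -
  from assms(1) obtain K d where c: "wf_cmd c" "registers c \<subseteq> insert r I"
    and within: "generates_within c r I v K d"
    unfolding generates_def by blast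
  show ?thesis
  proof (rule generatesI[OF assms(3,4) c(1)])
    show "registers c \<subseteq> insert r J" using c(2) assms(2) by blast
    fix \<sigma> :: "nat \<Rightarrow> 'a sym list" and Z ys assume "\<forall>i\<in>J. length (\<sigma> i) \<le> Z"
    then have "\<forall>i\<in>I. length (\<sigma> i) \<le> Z" using assms(2) by blast
    from generates_withinD[OF within this]
    show "exec c (\<sigma>(r := ys)) = \<sigma>(r := ys @ v \<sigma>) \<and> time c (\<sigma>(r := ys)) \<le> K * (Z + 1) ^ d" by blast
  qed
qed

lemma generates_exec:
  assumes "generates c r I v"
  shows "exec c \<sigma> = \<sigma>(r := \<sigma> r @ v \<sigma>)"
proof -
  from assms obtain K d where within: "generates_within c r I v K d" and "finite I"
    unfolding generates_def by blast
  then have "\<forall>i\<in>I. length (\<sigma> i) \<le> (\<Sum>i\<in>I. length (\<sigma> i))" by (intro ballI member_le_sum) auto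
  from generates_withinD(1)[OF within this, of "\<sigma> r"] show ?thesis by simp
qed

lemma generates_polytime:
  assumes "generates c r I v"
  shows "polytime c"
proof -
  from assms obtain K d where wf: "wf_cmd c" and within: "generates_within c r I v K d"
    unfolding generates_def by blast
  have "time c \<sigma> \<le> K * (Z + 1) ^ d" if "\<forall>i. length (\<sigma> i) \<le> Z" for \<sigma> Z
    using generates_withinD(2)[OF within, of \<sigma> Z "\<sigma> r"] that by simp
  then show ?thesis unfolding polytime_def using wf by blast
qed

lemma generates_Skip: "r \<notin> I \<Longrightarrow> finite I \<Longrightarrow> generates Skip r I (\<lambda>_. [])"
  by (rule generatesI[where K = 1 and d = 0]) auto

lemma generates_Append: "r \<notin> I \<Longrightarrow> finite I \<Longrightarrow> generates (Append r a) r I (\<lambda>_. [a])"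
  by (rule generatesI[where K = 1 and d = 0]) auto

lemma generates_Seq:
  fixes c d :: "'c cmd"
  assumes "generates c r I v" "generates d r I w"
  shows "generates (Seq c d) r I (\<lambda>\<sigma>. v \<sigma> @ w \<sigma>)"
proof -
  from assms obtain K k L l where "r \<notin> I" "finite I"
    and c: "wf_cmd c" "registers c \<subseteq> insert r I" "generates_within c r I v K k"
    and d: "wf_cmd d" "registers d \<subseteq> insert r I" "generates_within d r I w L l"
    unfolding generates_def by blast
  show ?thesis
  proof (rule generatesI[where K = "1 + K + L" and d = "k + l"])
    fix \<sigma> :: "'c store" and Z ys assume Z: "\<forall>i\<in>I. length (\<sigma> i) \<le> Z"
    note run_c = generates_withinD[OF c(3) Z, of ys] and run_d = generates_withinD[OF d(3) Z, of "ys @ v \<sigma>"]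
    have "K * (Z + 1) ^ k \<le> K * (Z + 1) ^ (k + l)" "L * (Z + 1) ^ l \<le> L * (Z + 1) ^ (k + l)"
      "1 \<le> (Z + 1) ^ (k + l)"
      by (rule power_bound_mono; simp)+ simp
    then have "1 + time c (\<sigma>(r := ys)) + time d (\<sigma>(r := ys @ v \<sigma>)) \<le> (1 + K + L) * (Z + 1) ^ (k + l)"
      using run_c(2) run_d(2) unfolding add_mult_distrib by linarith
    then show "exec (Seq c d) (\<sigma>(r := ys)) = \<sigma>(r := ys @ v \<sigma> @ w \<sigma>) \<and>
      time (Seq c d) (\<sigma>(r := ys)) \<le> (1 + K + L) * (Z + 1) ^ (k + l)" using run_c(1) run_d(1) by simp
  qed (use \<open>r \<notin> I\<close> \<open>finite I\<close> c d in auto)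
qed

lemma fold_time_le:
  assumes "\<And>a s. a \<in> set xs \<Longrightarrow> P s \<Longrightarrow> t a s \<le> T \<and> P (e a s)" "P s"
  shows "fold_time e t xs s \<le> length xs * (T + 2)"
  using assms
proof (induction xs arbitrary: s)
  case (Cons a xs)
  then have "fold_time e t xs (e a s) \<le> length xs * (T + 2)" by simp
  moreover have "t a s \<le> T" using Cons.prems by simp
  ultimately show ?case by simp
qed simp

lemma generates_For:
  fixes b :: "'c::finite sym \<Rightarrow> 'c cmd"
  assumes i: "i \<notin> J" "i \<noteq> r" and b: "\<And>a. generates (b a) r J (v a)"
  shows "generates (For i b) r (insert i J) (\<lambda>\<sigma>. concat (map (\<lambda>a. v a \<sigma>) (\<sigma> i)))"
proof -
  have "\<forall>a. \<exists>K d. generates_within (b a) r J (v a) K d" using b unfolding generates_def by blast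
  then obtain K d where within: "\<And>a. generates_within (b a) r J (v a) (K a) (d a)" by metis
  define L l where "L = (\<Sum>a\<in>UNIV. K a)" and "l = (\<Sum>a\<in>UNIV. d a)"
  have bound: "K a * (Z + 1) ^ d a \<le> L * (Z + 1) ^ l" for a Z
    by (rule power_bound_mono) (unfold L_def l_def, (rule member_le_sum; simp)+)
  have J: "r \<notin> J" "finite J" "\<And>a. wf_cmd (b a)" "\<And>a. registers (b a) \<subseteq> insert r J"
    using b unfolding generates_def by blast+
  show ?thesis
  proof (rule generatesI[where K = "L + 6" and d = "l + 1"])
    fix \<sigma> :: "'c store" and Z ys assume "\<forall>j\<in>insert i J. length (\<sigma> j) \<le> Z"
    then have Z: "\<forall>j\<in>J. length (\<sigma> j) \<le> Z" and len: "length (\<sigma> i) \<le> Z" by auto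
    let ?T = "L * (Z + 1) ^ l"
    have body: "exec (b a) (\<sigma>(r := zs)) = \<sigma>(r := zs @ v a \<sigma>)" "time (b a) (\<sigma>(r := zs)) \<le> ?T" for a zs
      using generates_withinD[OF within[of a] Z, of zs] bound[of a Z] by (blast, linarith)
    have "fold (\<lambda>a. exec (b a)) xs (\<sigma>(r := zs)) = \<sigma>(r := zs @ concat (map (\<lambda>a. v a \<sigma>) xs))" for xs zs
      by (induction xs arbitrary: zs) (simp_all add: body(1))
    moreover have "fold_time (\<lambda>a. exec (b a)) (\<lambda>a. time (b a)) (\<sigma> i) (\<sigma>(r := ys)) \<le> length (\<sigma> i) * (?T + 2)"
      by (rule fold_time_le[where P = "\<lambda>s. \<exists>zs. s = \<sigma>(r := zs)"]) (use body in blast)+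
    then have "length (\<sigma> i) + 3 + fold_time (\<lambda>a. exec (b a)) (\<lambda>a. time (b a)) (\<sigma> i) (\<sigma>(r := ys)) \<le>
        Z + 3 + Z * (?T + 2)"
      using len mult_le_mono1[OF len, of "?T + 2"] by linarith
    moreover have "Z * ?T \<le> L * (Z + 1) ^ (l + 1)" "(Z + 1) ^ 1 \<le> (Z + 1) ^ (l + 1)"
      by (simp, rule power_increasing) auto
    then have "Z + 3 + Z * (?T + 2) \<le> (L + 6) * (Z + 1) ^ (l + 1)"
      unfolding add_mult_distrib distrib_left power_one_right by linarith
    ultimately show "exec (For i b) (\<sigma>(r := ys)) = \<sigma>(r := ys @ concat (map (\<lambda>a. v a \<sigma>) (\<sigma> i))) \<and>
        time (For i b) (\<sigma>(r := ys)) \<le> (L + 6) * (Z + 1) ^ (l + 1)"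
      using i(2) by simp
  qed (use i J in auto)
qed

definition seqs :: "'c cmd list \<Rightarrow> 'c cmd" where
  "seqs cs = foldr Seq cs Skip"

lemma generates_seqs:
  assumes "r \<notin> I" "finite I" "\<And>k. k \<in> set ks \<Longrightarrow> generates (f k) r I (v k)"
  shows "generates (seqs (map f ks)) r I (\<lambda>\<sigma>. concat (map (\<lambda>k. v k \<sigma>) ks))"
  using assms(3)
proof (induction ks)
  case Nil
  show ?case using generates_Skip[OF assms(1,2)] by (simp add: seqs_def)
next
  case (Cons k ks)
  then have "generates (Seq (f k) (seqs (map f ks))) r I (\<lambda>\<sigma>. v k \<sigma> @ concat (map (\<lambda>k. v k \<sigma>) ks))"
    by (intro generates_Seq) auto
  then show ?case by (simp add: seqs_def)
qed

datatype 'c token = Lit "'c sym" | Each nat "'c sym \<Rightarrow> 'c sym list"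

primrec token_cmd :: "nat \<Rightarrow> 'c token \<Rightarrow> 'c cmd" where
  "token_cmd r (Lit a) = Append r a"
| "token_cmd r (Each i f) = For i (\<lambda>a. seqs (map (Append r) (f a)))"

primrec token_word :: "'c store \<Rightarrow> 'c token \<Rightarrow> 'c sym list" where
  "token_word \<sigma> (Lit a) = [a]"
| "token_word \<sigma> (Each i f) = concat (map f (\<sigma> i))"

primrec token_registers :: "'c token \<Rightarrow> nat set" where
  "token_registers (Lit a) = {}"
| "token_registers (Each i f) = {i}"

definition print :: "nat \<Rightarrow> 'c token list \<Rightarrow> 'c cmd" where
  "print r ts = seqs (map (token_cmd r) ts)"

definition words :: "'c token list \<Rightarrow> 'c store \<Rightarrow> 'c sym list" where
  "words ts \<sigma> = concat (map (token_word \<sigma>) ts)"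

lemma words_simps:
  "words [] \<sigma> = []" "words (t # ts) \<sigma> = token_word \<sigma> t @ words ts \<sigma>"
  "words (ts @ us) \<sigma> = words ts \<sigma> @ words us \<sigma>" "words (map Lit xs) \<sigma> = xs"
  by (simp_all add: words_def comp_def)

lemma words_concat: "words (concat tss) \<sigma> = concat (map (\<lambda>ts. words ts \<sigma>) tss)"
  by (induction tss) (simp_all add: words_simps)

lemma generates_token:
  fixes t :: "'c::finite token"
  assumes "r \<notin> I" "finite I" "token_registers t \<subseteq> I"
  shows "generates (token_cmd r t) r I (\<lambda>\<sigma>. token_word \<sigma> t)"
proof (cases t)
  case (Lit a)
  then show ?thesis using generates_Append[OF assms(1,2)] by simp
next
  case (Each i f)
  have "generates (seqs (map (Append r) (f a))) r {} (\<lambda>\<sigma>. concat (map (\<lambda>k. [k]) (f a)))" for a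
    by (rule generates_seqs) (auto intro: generates_Append)
  then have "generates (For i (\<lambda>a. seqs (map (Append r) (f a)))) r {i} (\<lambda>\<sigma>. concat (map f (\<sigma> i)))"
    using Each assms(1,3) generates_For[of i "{}" r "\<lambda>a. seqs (map (Append r) (f a))" "\<lambda>a \<sigma>. f a"] by auto
  then show ?thesis using Each assms by (auto intro: generates_mono)
qed

lemma generates_print:
  fixes ts :: "'c::finite token list"
  assumes "r \<notin> I" "finite I" "\<And>t. t \<in> set ts \<Longrightarrow> token_registers t \<subseteq> I"
  shows "generates (print r ts) r I (words ts)"
  unfolding print_def words_def
  by (intro generates_seqs generates_token assms)

subsection \<open>Unary polynomials and binary counting\<close>

text \<open>
  Nested loops over registers \<open>b, b + 1, \<dots>\<close> that hold copies of the input length compute its powers; a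
  single register would not do, because a loop must not use the register it runs over.
\<close>

primrec copies :: "nat \<Rightarrow> nat \<Rightarrow> 'c cmd" where
  "copies b 0 = Skip"
| "copies b (Suc k) = Seq (copies b k) (print (b + k) [Each 0 (\<lambda>_. [Bit True])])"

primrec nest :: "nat \<Rightarrow> nat \<Rightarrow> nat \<Rightarrow> 'c cmd" where
  "nest b r 0 = Append r (Bit True)"
| "nest b r (Suc k) = For (b + k) (\<lambda>_. nest b r k)"

definition unary_poly :: "nat \<Rightarrow> nat \<Rightarrow> nat poly \<Rightarrow> 'c cmd" where
  "unary_poly b r p = seqs (map (\<lambda>i. seqs (map (\<lambda>_. nest b r i) [0..<coeff p i])) [0..<Suc (degree p)])"

definition count :: "nat \<Rightarrow> nat \<Rightarrow> 'c cmd" where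
  "count i r = For i (\<lambda>_. Incr r)"

lemma generates_print_input_length:
  assumes "0 < r"
  shows "generates (print r [Each 0 (\<lambda>_. [Bit True])] :: 'c::finite cmd) r {0}
    (\<lambda>\<sigma>. replicate (length (\<sigma> 0)) (Bit True))"
proof -
  have "words [Each 0 (\<lambda>_. [Bit True])] = (\<lambda>\<sigma> :: 'c store. replicate (length (\<sigma> 0)) (Bit True))"
    by (rule HOL.ext) (simp add: words_simps map_replicate_const)
  then show ?thesis using assms generates_print[of r "{0}" "[Each 0 (\<lambda>_. [Bit True])] :: 'c token list"] by simp
qed

lemma polytime_copies:
  assumes "0 < b"
  shows "polytime (copies b k :: 'c::finite cmd)"
proof (induction k)
  case 0
  show ?case using generates_polytime[OF generates_Skip[of 0 "{}"]] by simp
next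
  case (Suc k)
  have "0 < b + k" using assms by simp
  from generates_polytime[OF generates_print_input_length[OF this]] show ?case
    using polytime_Seq[OF Suc] by simp
qed

lemma exec_copies:
  fixes \<sigma> :: "'c::finite store"
  assumes "0 < b"
  shows "exec (copies b k) \<sigma> =
    (\<lambda>i. if b \<le> i \<and> i < b + k then \<sigma> i @ replicate (length (\<sigma> 0)) (Bit True) else \<sigma> i)"
proof (induction k)
  case (Suc k)
  have "0 < b + k" using assms by simp
  then have "exec (copies b (Suc k)) \<sigma> = (exec (copies b k) \<sigma>)
      (b + k := exec (copies b k) \<sigma> (b + k) @ replicate (length (exec (copies b k) \<sigma> 0)) (Bit True))"
    using generates_exec[OF generates_print_input_length] by (simp only: copies.simps exec.simps)
  then show ?case using assms by (intro HOL.ext) (simp add: Suc less_Suc_eq)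
qed (auto intro!: HOL.ext)

lemma generates_nest:
  assumes "r < b"
  shows "generates (nest b r k :: 'c::finite cmd) r {b..<b + k}
    (\<lambda>\<sigma>. replicate (\<Prod>j<k. length (\<sigma> (b + j))) (Bit True))"
proof (induction k)
  case 0
  show ?case using generates_Append[of r "{}"] by simp
next
  case (Suc k)
  have concat_replicate: "concat (map (\<lambda>a. replicate n (Bit True)) xs) = replicate (length xs * n) (Bit True)"
    for n and xs :: "'c sym list"
    by (induction xs) (auto simp: replicate_add)
  have "insert (b + k) {b..<b + k} = {b..<b + Suc k}" by auto
  moreover have "generates (For (b + k) (\<lambda>_. nest b r k) :: 'c cmd) r (insert (b + k) {b..<b + k})
      (\<lambda>\<sigma>. concat (map (\<lambda>a. replicate (\<Prod>j<k. length (\<sigma> (b + j))) (Bit True)) (\<sigma> (b + k))))"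
    by (rule generates_For) (use assms Suc in simp_all)
  ultimately show ?case by (simp only: nest.simps concat_replicate prod.lessThan_Suc mult.commute)
qed

lemma generates_unary_poly:
  assumes "r < b" "degree p \<le> k"
  shows "generates (unary_poly b r p :: 'c::finite cmd) r {b..<b + k}
    (\<lambda>\<sigma>. replicate (\<Sum>i\<le>degree p. coeff p i * (\<Prod>j<i. length (\<sigma> (b + j)))) (Bit True))"
proof -
  have concat_replicates: "concat (map (\<lambda>i. replicate (f i) (Bit True :: 'c sym)) [0..<n]) =
      replicate (\<Sum>i<n. f i) (Bit True)" for f n
    by (induction n) (auto simp: replicate_add)
  have r: "r \<notin> {b..<b + k}" using assms(1) by auto
  have "generates (unary_poly b r p :: 'c cmd) r {b..<b + k}
     (\<lambda>\<sigma>. concat (map (\<lambda>i. concat (map (\<lambda>_. replicate (\<Prod>j<i. length (\<sigma> (b + j))) (Bit True))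
       [0..<coeff p i])) [0..<Suc (degree p)]))"
    unfolding unary_poly_def
    by (intro generates_seqs[OF r] generates_mono[OF generates_nest[OF assms(1)] _ r]) (use assms(2) in auto)
  then show ?thesis unfolding concat_replicates sum_constant card_lessThan lessThan_Suc_atMost by simp
qed

lemma unary_poly_value:
  assumes "degree p \<le> k" "\<And>j. j < k \<Longrightarrow> length (\<sigma> (b + j)) = n"
  shows "(\<Sum>i\<le>degree p. coeff p i * (\<Prod>j<i. length (\<sigma> (b + j)))) = poly p n"
proof -
  have "(\<Prod>j<i. length (\<sigma> (b + j))) = n ^ i" if "i \<le> degree p" for i
    using that assms by simp
  then show ?thesis unfolding poly_altdef by (intro sum.cong) auto
qed

lemma binary_inc_word: "binary_inc (map Bit (binary_word k)) = map Bit (binary_word (Suc k))"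
proof (induction k rule: less_induct)
  case (less k)
  show ?case
  proof (cases "k = 0")
    case True
    then show ?thesis by (simp add: binary_word.simps)
  next
    case False
    have "binary_word k = odd k # binary_word (k div 2)"
      "binary_word (Suc k) = odd (Suc k) # binary_word (Suc k div 2)"
      using False by (subst binary_word.simps; simp)+
    then show ?thesis using less.IH[of "k div 2"] False by (cases "odd k") simp_all
  qed
qed

lemma exec_count:
  assumes "i \<noteq> r" "\<sigma> r = []"
  shows "exec (count i r) \<sigma> = \<sigma>(r := map Bit (binary_word (length (\<sigma> i))))"
proof -
  have "fold (\<lambda>_. exec (Incr r)) xs (\<sigma>(r := map Bit (binary_word k))) =
      \<sigma>(r := map Bit (binary_word (k + length xs)))" for xs :: "'a sym list" and k
    by (induction xs arbitrary: k)
      (simp_all only: fold_simps exec.simps fun_upd_same fun_upd_upd binary_inc_word list.size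
        add_0_right add_Suc_right add_Suc)
  moreover have "\<sigma>(r := map Bit (binary_word 0)) = \<sigma>"
    using assms(2) by (subst binary_word.simps) (simp add: fun_upd_idem)
  ultimately have "fold (\<lambda>_. exec (Incr r)) (\<sigma> i) \<sigma> = \<sigma>(r := map Bit (binary_word (0 + length (\<sigma> i))))"
    by metis
  then show ?thesis by (simp only: count_def exec.simps add_0)
qed

lemma fold_time_Incr_le:
  "fold_time (\<lambda>_. exec (Incr r)) (\<lambda>_. time (Incr r)) xs s \<le>
    length xs * (2 * (length (s r) + length xs) + 5)"
proof (induction xs arbitrary: s)
  case (Cons a xs)
  let ?s = "exec (Incr r) s" and ?T = "2 * (length (s r) + length (a # xs)) + 5"
  have "length (?s r) \<le> Suc (length (s r))" using length_binary_inc by simp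
  then have "length xs * (2 * (length (?s r) + length xs) + 5) \<le> length xs * ?T"
    by (intro mult_le_mono2) simp
  with Cons.IH[of ?s]
  have rest: "fold_time (\<lambda>_. exec (Incr r)) (\<lambda>_. time (Incr r)) xs ?s \<le> length xs * ?T" by (rule le_trans)
  have "time (Incr r) s + 2 \<le> ?T" using inc_time_le[of "s r"] by simp
  moreover have "length (a # xs) = Suc (length xs)" by simp
  ultimately show ?case
    unfolding fold_time.simps using add_mono[OF _ rest, of "time (Incr r) s + 2" ?T] by (simp only: mult_Suc)
qed simp

lemma polytime_count:
  assumes "i \<noteq> r"
  shows "polytime (count i r)"
proof -
  have "time (count i r) \<sigma> \<le> 14 * (Z + 1) ^ 2" if Z: "\<And>i. length (\<sigma> i) \<le> Z" for \<sigma> Z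
  proof -
    have "length (\<sigma> i) * (2 * (length (\<sigma> r) + length (\<sigma> i)) + 5) \<le> Z * (2 * (Z + Z) + 5)"
      using Z[of i] Z[of r] by (intro mult_le_mono add_le_mono mult_le_mono2 add_mono) auto
    then have "time (count i r) \<sigma> \<le> Z + 3 + Z * (2 * (Z + Z) + 5)"
      using fold_time_Incr_le[of r "\<sigma> i" \<sigma>] Z[of i] by (simp add: count_def)
    also have "\<dots> \<le> 14 * (Z + 1) ^ 2" by (simp add: power2_eq_square algebra_simps)
    finally show ?thesis .
  qed
  moreover have "wf_cmd (count i r)" using assms by (simp add: count_def)
  ultimately show ?thesis unfolding polytime_def by blast
qed

section \<open>Serializing the graph\<close>

lemma map_upt_add: "map f [0..<a + b] = map f [0..<a] @ map (\<lambda>k. f (a + k)) [0..<b]"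
proof -
  have "[a..<a + b] = map (\<lambda>k. a + k) [0..<b]" by (rule nth_equalityI) simp_all
  then show ?thesis using upt_add_eq_append[of 0 a b] by (simp add: comp_def)
qed

lemma concat_row_major:
  "concat (map f [0..<m * n]) = concat (map (\<lambda>i. concat (map (\<lambda>j. f (i * n + j)) [0..<n])) [0..<m])"
proof (induction m)
  case (Suc m)
  have "map f [0..<Suc m * n] = map f [0..<m * n] @ map (\<lambda>j. f (m * n + j)) [0..<n]"
    using map_upt_add[of f "m * n" n] by (simp add: add.commute)
  then show ?case using Suc by simp
qed simp

lemma concat_map_row_major:
  "concat (map (\<lambda>i. map (f i) [0..<n]) [0..<m]) = map (\<lambda>k. f (k div n) (k mod n)) [0..<m * n]"
proof -
  have "map (\<lambda>k. f (k div n) (k mod n)) [0..<m * n] =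
      concat (map (\<lambda>i. concat (map (\<lambda>j. [f ((i * n + j) div n) ((i * n + j) mod n)]) [0..<n])) [0..<m])"
    using concat_row_major[of "\<lambda>k. [f (k div n) (k mod n)]" m n] by (simp only: concat_map_singleton)
  also have "\<dots> = concat (map (\<lambda>i. map (f i) [0..<n]) [0..<m])"
    unfolding concat_map_singleton
    by (intro arg_cong[of _ _ concat] map_cong refl) (simp only: row_major_div_mod set_upt atLeastLessThan_iff)
  finally show ?thesis by (rule sym)
qed

lemma upt_Suc_Suc: "[0..<Suc (Suc r)] = 0 # map Suc [0..<r] @ [Suc r]"
  by (simp add: map_Suc_upt upt_conv_Cons)

lemma trim_concat:
  assumes "2 \<le> N" and len: "\<And>u. length (f u) = L" and "d \<le> L" "t \<le> L"
  shows "take (N * L - d - t) (drop d (concat (map f [0..<N]))) =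
    concat (map (\<lambda>u. if u = 0 then drop d (f u) else if Suc u = N then take (L - t) (f u) else f u) [0..<N])"
proof -
  obtain r where N: "N = Suc (Suc r)" using le_Suc_ex[OF assms(1)] by auto
  have upt: "[0..<N] = 0 # map Suc [0..<r] @ [Suc r]" unfolding N by (rule upt_Suc_Suc)
  define inner where "inner = concat (map f (map Suc [0..<r]))"
  have "length inner = r * L"
    by (simp add: inner_def length_concat comp_def len sum_list_triv)
  then have "N * L - d - t = length (drop d (f 0) @ inner) + (L - t)" using assms(3,4) by (simp add: N len)
  moreover have "drop d (concat (map f [0..<N])) = (drop d (f 0) @ inner) @ f (Suc r)"
    using assms(3) by (simp add: upt inner_def len)
  ultimately have "take (N * L - d - t) (drop d (concat (map f [0..<N]))) =
      (drop d (f 0) @ inner) @ take (L - t) (f (Suc r))"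
    by (simp only: take_append) simp
  moreover have "inner = concat (map
      (\<lambda>u. if u = 0 then drop d (f u) else if Suc u = N then take (L - t) (f u) else f u) (map Suc [0..<r]))"
    unfolding inner_def by (intro arg_cong[of _ _ concat] map_cong refl) (auto simp: N)
  ultimately show ?thesis by (simp add: upt) (simp add: N)
qed

text \<open>
  Reading the adjacency matrix in rows of length one more than the number of vertices aligns its
  diagonals, so that the entries of a banded matrix sit at fixed positions of each row.
\<close>

definition shifted_entry :: "nat \<Rightarrow> nat \<Rightarrow> (nat \<Rightarrow> nat \<Rightarrow> bool) \<Rightarrow> nat \<Rightarrow> nat \<Rightarrow> bool" where
  "shifted_entry N d P u e \<longleftrightarrow> d \<le> u + e \<and> u + e - d < N \<and> P u (u + e - d)"

definition shifted_row :: "nat \<Rightarrow> nat \<Rightarrow> (nat \<Rightarrow> nat \<Rightarrow> bool) \<Rightarrow> nat \<Rightarrow> bool list" where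
  "shifted_row N d P u = map (shifted_entry N d P u) [0..<Suc N]"

definition trimmed_row :: "nat \<Rightarrow> nat \<Rightarrow> (nat \<Rightarrow> nat \<Rightarrow> bool) \<Rightarrow> nat \<Rightarrow> bool list" where
  "trimmed_row N d P u =
     (if u = 0 then drop d (shifted_row N d P u)
      else if Suc u = N then take (Suc d) (shifted_row N d P u)
      else shifted_row N d P u)"

lemma shifted_entry_iff: "u + e = d + v \<Longrightarrow> shifted_entry N d P u e \<longleftrightarrow> v < N \<and> P u v"
  by (simp add: shifted_entry_def)

lemma shifted_entry_outside: "u + e < d \<Longrightarrow> \<not> shifted_entry N d P u e"
  by (simp add: shifted_entry_def)

lemma matrix_entry_shifted:
  assumes "2 * d \<le> N" "k < N * N" and band: "\<And>u v. P u v \<Longrightarrow> u \<le> v + d \<and> v \<le> u + d"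
  shows "P (k div N) (k mod N) \<longleftrightarrow> shifted_entry N d P ((k + d) div Suc N) ((k + d) mod Suc N)"
proof
  assume P: "P (k div N) (k mod N)"
  let ?e = "k mod N + d - k div N"
  have "k mod N < N" using assms(2) by (cases N) auto
  from band[OF P] have "?e \<le> 2 * d" "k + d = k div N * Suc N + ?e"
    using div_mult_mod_eq[of k N] by (simp_all, linarith)
  then have "(k + d) div Suc N = k div N" "(k + d) mod Suc N = ?e"
    using row_major_div_mod[of ?e "Suc N" "k div N"] assms(1) by simp_all
  then show "shifted_entry N d P ((k + d) div Suc N) ((k + d) mod Suc N)"
    using P band[OF P] \<open>k mod N < N\<close> by (simp add: shifted_entry_def)
next
  let ?q = "(k + d) div Suc N" and ?r = "(k + d) mod Suc N"
  assume shifted: "shifted_entry N d P ?q ?r"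
  have "k + d = ?q * Suc N + ?r" by (simp only: div_mult_mod_eq)
  then have "k = ?q * N + (?q + ?r - d)"
    using shifted unfolding shifted_entry_def mult_Suc_right by linarith
  moreover have "?q + ?r - d < N" using shifted unfolding shifted_entry_def by blast
  ultimately have "k div N = ?q" "k mod N = ?q + ?r - d" by (metis row_major_div_mod)+
  then show "P (k div N) (k mod N)" using shifted unfolding shifted_entry_def by simp
qed

lemma matrix_eq_trimmed_rows:
  assumes "2 * d \<le> N" "1 \<le> d" and band: "\<And>u v. P u v \<Longrightarrow> u \<le> v + d \<and> v \<le> u + d"
  shows "concat (map (\<lambda>u. map (P u) [0..<N]) [0..<N]) = concat (map (trimmed_row N d P) [0..<N])"
proof -
  have trimmed_length: "Suc N - (N - d) = Suc d" using assms(1) by simp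
  let ?entry = "\<lambda>k. shifted_entry N d P (k div Suc N) (k mod Suc N)"
  have "concat (map (\<lambda>u. map (P u) [0..<N]) [0..<N]) = map (\<lambda>k. P (k div N) (k mod N)) [0..<N * N]"
    by (rule concat_map_row_major)
  also have "\<dots> = map (\<lambda>k. ?entry (d + k)) [0..<N * N]"
    using matrix_entry_shifted[OF assms(1) _ band] by (intro map_cong refl) (simp add: add.commute)
  also have "\<dots> = drop d (map ?entry [0..<d + N * N])"
    by (simp only: map_upt_add drop_append length_map length_upt drop_map) simp
  also have "\<dots> = take (N * N) (drop d (map ?entry [0..<N * Suc N]))"
    using assms(1) by (simp add: take_map drop_map)
  also have "map ?entry [0..<N * Suc N] = concat (map (shifted_row N d P) [0..<N])"
    unfolding shifted_row_def concat_map_row_major ..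
  also have "N * N = N * Suc N - d - (N - d)" using assms(1) by simp
  also have "take (N * Suc N - d - (N - d)) (drop d (concat (map (shifted_row N d P) [0..<N]))) =
      concat (map (trimmed_row N d P) [0..<N])"
    using trim_concat[of N "shifted_row N d P" "Suc N" d "N - d"] assms(1,2)
    unfolding trimmed_row_def trimmed_length by (simp add: shifted_row_def)
  finally show ?thesis .
qed

definition diagonal_window :: "site \<Rightarrow> bool \<Rightarrow> nat \<Rightarrow> bool list" where
  "diagonal_window x left s = map (\<lambda>e.
     if e = 0 then s = 0 \<and> left
     else if e = 18 then s = 0 \<and> right_edge x
     else 9 \<le> s + e \<and> s + e < 18 \<and> slot_adj (pendants x) s (s + e - 9)) [0..<19]"

definition vertex_row :: "bool \<Rightarrow> bool \<Rightarrow> site \<Rightarrow> bool \<Rightarrow> bool \<Rightarrow> nat \<Rightarrow> nat \<Rightarrow> nat \<Rightarrow> bool list" where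
  "vertex_row first_site last_site x up left near far s =
     (if first_site \<and> s = 0 then drop 9 (diagonal_window x left s)
      else [s = 0 \<and> up] @ replicate near False @
        (if last_site \<and> s = 8 then take 10 (diagonal_window x left s) else diagonal_window x left s)) @
     (if last_site \<and> s = 8 then [] else replicate near False @ [s = 0 \<and> down_edge x] @ replicate far False)"

definition color_word :: "site \<Rightarrow> bool list" where
  "color_word x = concat (map (\<lambda>s. replicate (slot_color x s) True @ [False]) [0..<9])"

locale wide_picture = picture +
  assumes rows_ge_2: "2 \<le> m" and columns_ge_2: "2 \<le> n"
begin

definition up_edge :: "nat \<Rightarrow> bool" where
  "up_edge g \<longleftrightarrow> n \<le> g \<and> down_edge (site_at (g - n))"

definition left_edge :: "nat \<Rightarrow> bool" where
  "left_edge g \<longleftrightarrow> 1 \<le> g \<and> right_edge (site_at (g - 1))"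

definition near_gap :: nat where
  "near_gap = 9 * n - 10"

definition far_gap :: nat where
  "far_gap = m * n * 9 - 2 * (9 * n)"

definition site_rows :: "nat \<Rightarrow> bool list" where
  "site_rows g = concat (map (vertex_row (g = 0) (Suc g = m * n) (site_at g) (up_edge g) (left_edge g)
     near_gap far_gap) [0..<9])"

lemma up_edge_row_major:
  assumes "j < n"
  shows "up_edge (i * n + j) \<longleftrightarrow> 0 < i \<and> down_edge (S (i - 1) j)"
proof (cases i)
  case 0
  then show ?thesis using assms by (simp add: up_edge_def)
next
  case (Suc k)
  then have "i * n + j - n = k * n + j" by simp
  then show ?thesis using Suc assms by (simp add: up_edge_def site_at_row_major)
qed

lemma left_edge_row_major:
  assumes "j < n"
  shows "left_edge (i * n + j) \<longleftrightarrow> 0 < j \<and> right_edge (S i (j - 1))"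
proof (cases j)
  case 0
  have "\<not> right_edge (S k (n - 1))" for k using right_edge_inside[of "n - 1" k] n_pos by auto
  moreover have "Suc k * n - 1 = k * n + (n - 1)" for k using n_pos by simp
  ultimately show ?thesis
    using 0 site_at_row_major[of "n - 1"] n_pos by (cases i) (simp_all add: left_edge_def)
next
  case (Suc l)
  then show ?thesis using assms site_at_row_major[of l i] by (simp add: left_edge_def)
qed

lemma bandwidth_eq: "9 * n = near_gap + 10"
  using columns_ge_2 by (simp add: near_gap_def)

lemma order_eq: "m * n * 9 = far_gap + 2 * (9 * n)"
proof -
  have "2 * n \<le> m * n" using rows_ge_2 by (rule mult_le_mono1)
  then show ?thesis by (simp add: far_gap_def)
qed

lemma adj_distance:
  assumes "adj u v"
  shows "v = u + 9 * n \<or> u = v + 9 * n \<or> v \<le> u + 9 \<and> u \<le> v + 9"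
  using assms
proof (cases rule: adj_cases)
  case (slot g s t)
  then show ?thesis using slot_adj_less[OF slot(3)] by linarith
next
  case (link g h)
  then have "h = g + 1 \<or> h = g + n" unfolding link_def by blast
  then show ?thesis using link by auto
next
  case (link_back g h)
  then have "g = h + 1 \<or> g = h + n" unfolding link_def by blast
  then show ?thesis using link_back by auto
qed

abbreviation entry :: "nat \<Rightarrow> nat \<Rightarrow> bool" where
  "entry \<equiv> shifted_entry (m * n * 9) (9 * n) adj"

lemma entry_far:
  assumes "e \<noteq> 0" "e \<noteq> 2 * (9 * n)" "e + 9 < 9 * n \<or> 9 * n + 9 < e"
  shows "\<not> entry u e"
proof
  assume "entry u e"
  then have "9 * n \<le> u + e" "adj u (u + e - 9 * n)" by (simp_all add: shifted_entry_def)
  then show False using adj_distance[of u "u + e - 9 * n"] assms by linarith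
qed

lemma not_link_down: "h \<le> g \<Longrightarrow> \<not> link g h"
  using n_pos by (auto simp: link_def)

lemma entry_forward:
  assumes g: "g < m * n" and s: "s < 9" and "0 < k"
  shows "entry (g * 9 + s) (9 * n + 9 * k) \<longleftrightarrow> s = 0 \<and> link g (g + k)"
proof -
  have "entry (g * 9 + s) (9 * n + 9 * k) \<longleftrightarrow>
      (g + k) * 9 + s < m * n * 9 \<and> adj (g * 9 + s) ((g + k) * 9 + s)"
    by (rule shifted_entry_iff) simp
  also have "adj (g * 9 + s) ((g + k) * 9 + s) \<longleftrightarrow> s = 0 \<and> link g (g + k)"
    unfolding adj_vertices[OF s s] using not_link_down[of g "g + k"] assms(3) by auto
  finally have "entry (g * 9 + s) (9 * n + 9 * k) \<longleftrightarrow>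
      (g + k) * 9 + s < m * n * 9 \<and> s = 0 \<and> link g (g + k)" .
  moreover have "(g + k) * 9 + s < m * n * 9" if "link g (g + k)"
    using link_less[OF g that] s by (rule row_major_less)
  ultimately show ?thesis by blast
qed

lemma entry_backward:
  assumes g: "g < m * n" and s: "s < 9" and "0 < k" "k \<le> n"
  shows "entry (g * 9 + s) (9 * n - 9 * k) \<longleftrightarrow> s = 0 \<and> k \<le> g \<and> link (g - k) g"
proof (cases "k \<le> g")
  case True
  then obtain h where h: "g = h + k" by (metis le_add_diff_inverse2)
  have "entry (g * 9 + s) (9 * n - 9 * k) \<longleftrightarrow> h * 9 + s < m * n * 9 \<and> adj (g * 9 + s) (h * 9 + s)"
    by (rule shifted_entry_iff) (use assms(4) in \<open>simp add: h\<close>)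
  moreover have "h * 9 + s < m * n * 9" using g s by (intro row_major_less) (simp_all add: h)
  moreover have "adj (g * 9 + s) (h * 9 + s) \<longleftrightarrow> s = 0 \<and> link h g"
    unfolding adj_vertices[OF s s] using not_link_down[of h g] assms(3) by (auto simp: h)
  ultimately show ?thesis by (simp add: h)
next
  case False
  then have "\<not> entry (g * 9 + s) (9 * n - 9 * k)"
    using s assms(4) by (intro shifted_entry_outside) linarith
  then show ?thesis using False by blast
qed

lemma link_right: "link g (g + 1) \<longleftrightarrow> right_edge (site_at g)"
  and link_down: "link g (g + n) \<longleftrightarrow> down_edge (site_at g)"
  using columns_ge_2 by (auto simp: link_def)

lemma entry_local:
  assumes g: "g < m * n" and s: "s < 9" and e: "1 \<le> e" "e < 18"
  shows "entry (g * 9 + s) (9 * n - 9 + e) \<longleftrightarrow>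
    9 \<le> s + e \<and> s + e < 18 \<and> slot_adj (pendants (site_at g)) s (s + e - 9)"
proof -
  have n: "9 \<le> 9 * n" using n_pos by simp
  consider (same_site) "9 \<le> s + e" "s + e < 18" | (previous_site) "s + e < 9" "0 < g"
    | (outside) "s + e < 9" "g = 0" | (next_site) "18 \<le> s + e"
    by linarith
  then show ?thesis
  proof cases
    case same_site
    then have t: "s + e - 9 < 9" by linarith
    have "entry (g * 9 + s) (9 * n - 9 + e) \<longleftrightarrow>
        g * 9 + (s + e - 9) < m * n * 9 \<and> adj (g * 9 + s) (g * 9 + (s + e - 9))"
      by (rule shifted_entry_iff) (use same_site n in linarith)
    then show ?thesis
      using same_site row_major_less[OF g t] adj_vertices[OF s t, of g g] not_link_down[of g g] by auto
  next
    case previous_site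
    then obtain h where h: "g = Suc h" by (cases g) auto
    have "entry (g * 9 + s) (9 * n - 9 + e) \<longleftrightarrow> h * 9 + (s + e) < m * n * 9 \<and> adj (g * 9 + s) (h * 9 + (s + e))"
      by (rule shifted_entry_iff) (use n in \<open>simp add: h\<close>)
    then show ?thesis using previous_site adj_vertices[OF s, of "s + e" g h] e by (simp add: h)
  next
    case outside
    then have "\<not> entry (g * 9 + s) (9 * n - 9 + e)" using n by (intro shifted_entry_outside) linarith
    then show ?thesis using outside by simp
  next
    case next_site
    then have t: "s + e - 18 < 9" "s \<noteq> 0" using s e by linarith+
    have "entry (g * 9 + s) (9 * n - 9 + e) \<longleftrightarrow>
        (g + 1) * 9 + (s + e - 18) < m * n * 9 \<and> adj (g * 9 + s) ((g + 1) * 9 + (s + e - 18))"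
      by (rule shifted_entry_iff) (use next_site n in \<open>unfold add_mult_distrib, linarith\<close>)
    then show ?thesis using next_site adj_vertices[OF s t(1), of g "g + 1"] t(2) by simp
  qed
qed

lemma entry_near_diagonal:
  assumes g: "g < m * n" and s: "s < 9"
  shows "map (\<lambda>e. entry (g * 9 + s) (1 + near_gap + e)) [0..<19] = diagonal_window (site_at g) (left_edge g) s"
proof -
  have shift: "1 + near_gap + e = 9 * n - 9 + e" for e by (simp add: bandwidth_eq)
  have "entry (g * 9 + s) (9 * n - 9) \<longleftrightarrow> s = 0 \<and> left_edge g"
    using entry_backward[OF g s, of 1] link_right[of "g - 1"] n_pos by (auto simp: left_edge_def)
  moreover have "9 * n - 9 + 18 = 9 * n + 9" by (simp add: bandwidth_eq)
  then have "entry (g * 9 + s) (9 * n - 9 + 18) \<longleftrightarrow> s = 0 \<and> right_edge (site_at g)"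
    using entry_forward[OF g s, of 1] link_right[of g] by (simp add: add.commute)
  ultimately show ?thesis
    unfolding diagonal_window_def shift
    by (intro map_cong refl) (auto simp: entry_local[OF g s])
qed

lemma shifted_row_vertex:
  assumes g: "g < m * n" and s: "s < 9"
  shows "shifted_row (m * n * 9) (9 * n) adj (g * 9 + s) =
    [s = 0 \<and> up_edge g] @ replicate near_gap False @ diagonal_window (site_at g) (left_edge g) s @
    replicate near_gap False @ [s = 0 \<and> down_edge (site_at g)] @ replicate far_gap False"
proof -
  let ?e = "entry (g * 9 + s)"
  have length: "Suc (m * n * 9) = 1 + (near_gap + (19 + (near_gap + (1 + far_gap))))"
    unfolding order_eq bandwidth_eq by simp
  have up: "?e 0 \<longleftrightarrow> s = 0 \<and> up_edge g"
    using entry_backward[OF g s, of n] link_down[of "g - n"] n_pos by (auto simp: up_edge_def)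
  have "1 + (near_gap + (19 + (near_gap + 0))) = 9 * n + 9 * n" by (simp add: bandwidth_eq)
  then have down: "?e (1 + (near_gap + (19 + (near_gap + 0)))) \<longleftrightarrow> s = 0 \<and> down_edge (site_at g)"
    using entry_forward[OF g s, of n] link_down[of g] n_pos by simp
  have "\<not> ?e (1 + k)" "\<not> ?e (1 + (near_gap + (19 + k)))" if "k < near_gap" for k
    using that by (intro entry_far; simp add: bandwidth_eq)+
  moreover have "\<not> ?e (1 + (near_gap + (19 + (near_gap + (1 + k)))))" for k
    by (intro entry_far) (simp_all add: bandwidth_eq)
  ultimately have zeros: "map (\<lambda>k. ?e (1 + k)) [0..<near_gap] = replicate near_gap False"
    "map (\<lambda>k. ?e (1 + (near_gap + (19 + k)))) [0..<near_gap] = replicate near_gap False"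
    "map (\<lambda>k. ?e (1 + (near_gap + (19 + (near_gap + (1 + k)))))) [0..<far_gap] = replicate far_gap False"
    by (auto intro!: nth_equalityI)
  have "map (\<lambda>k. ?e (1 + (near_gap + k))) [0..<19] = diagonal_window (site_at g) (left_edge g) s"
    using entry_near_diagonal[OF g s] by (simp only: add.assoc)
  moreover have "map f [0..<1] = [f 0]" for f :: "nat \<Rightarrow> bool" by simp
  ultimately show ?thesis
    unfolding shifted_row_def length map_upt_add zeros by (simp only: up down)
qed

lemma trimmed_row_vertex:
  assumes g: "g < m * n" and s: "s < 9"
  shows "trimmed_row (m * n * 9) (9 * n) adj (g * 9 + s) =
    vertex_row (g = 0) (Suc g = m * n) (site_at g) (up_edge g) (left_edge g) near_gap far_gap s"
proof -
  let ?window = "diagonal_window (site_at g) (left_edge g) s"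
  have ends: "Suc (g * 9 + s) = m * n * 9 \<longleftrightarrow> Suc g = m * n \<and> s = 8" "g * 9 + s = 0 \<longleftrightarrow> g = 0 \<and> s = 0"
    using g s by linarith+
  have "1 < m * n" using mult_le_mono[OF rows_ge_2 columns_ge_2] by simp
  have window: "length ?window = 19" by (simp add: diagonal_window_def)
  have trim: "drop (9 * n) ([a] @ replicate near_gap False @ ?window @ w) = drop 9 ?window @ w"
    "take (Suc (9 * n)) ([a] @ replicate near_gap False @ ?window @ w) =
      [a] @ replicate near_gap False @ take 10 ?window" for a w
    unfolding bandwidth_eq by (simp_all add: eval_nat_numeral window)
  consider (first) "g = 0" "s = 0" | (final) "Suc g = m * n" "s = 8"
    | (inner) "\<not> (g = 0 \<and> s = 0)" "\<not> (Suc g = m * n \<and> s = 8)"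
    by blast
  then show ?thesis
    unfolding trimmed_row_def vertex_row_def shifted_row_vertex[OF g s] ends trim
    by cases (use \<open>1 < m * n\<close> in auto)
qed

lemma matrix_word:
  "concat (map (\<lambda>u. map (\<lambda>v. (u, v) \<in> parcs graph) [0..<m * n * 9]) [0..<m * n * 9]) =
   concat (map site_rows [0..<m * n])"
proof -
  have "concat (map (\<lambda>u. map (\<lambda>v. (u, v) \<in> parcs graph) [0..<m * n * 9]) [0..<m * n * 9]) =
      concat (map (\<lambda>u. map (adj u) [0..<m * n * 9]) [0..<m * n * 9])"
    by (intro arg_cong[of _ _ concat] map_cong refl)
      (simp only: parcs_graph set_upt atLeastLessThan_iff simp_thms)
  also have "\<dots> = concat (map (trimmed_row (m * n * 9) (9 * n) adj) [0..<m * n * 9])"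
  proof (rule matrix_eq_trimmed_rows)
    show "2 * (9 * n) \<le> m * n * 9" "1 \<le> 9 * n" using order_eq n_pos by simp_all
    show "u \<le> v + 9 * n \<and> v \<le> u + 9 * n" if "adj u v" for u v
      using adj_distance[OF that] n_pos by linarith
  qed
  also have "\<dots> = concat (map site_rows [0..<m * n])"
    unfolding concat_row_major[of _ "m * n" 9] site_rows_def
    by (intro arg_cong[of _ _ concat] map_cong refl)
      (simp only: trimmed_row_vertex set_upt atLeastLessThan_iff)
  finally show ?thesis .
qed

lemma coloring_word:
  "concat (map (\<lambda>v. replicate (given_coloring v) True @ [False]) [0..<m * n * 9]) =
   concat (map (\<lambda>g. color_word (site_at g)) [0..<m * n])"
  unfolding concat_row_major[of _ "m * n" 9] color_word_def given_coloring_def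
  by (intro arg_cong[of _ _ concat] map_cong refl)
    (simp only: slot_coloring_vertex set_upt atLeastLessThan_iff)

theorem encode_instance_graph:
  "encode_instance graph given_coloring budget =
    concat (map (\<lambda>g. replicate 9 True) [0..<m * n]) @ [False] @ concat (map site_rows [0..<m * n]) @
    concat (map (\<lambda>g. color_word (site_at g)) [0..<m * n]) @ binary_word budget"
proof -
  have "concat (map (\<lambda>g. replicate 9 True) [0..<k]) = replicate (k * 9) True" for k
    by (induction k) (simp_all add: replicate_add[symmetric] add.commute)
  then show ?thesis
    unfolding encode_instance_def Let_def pverts_graph card_lessThan matrix_word coloring_word by simp
qed

end

section \<open>The picture of a word\<close>

instance cell_kind :: finite
proof
  have "UNIV \<subseteq> {Blank, Zero, One, Wild, Pre, Mid, Acc_One, Acc_Blank}" using cell_kind.exhaust by blast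
  then show "finite (UNIV :: cell_kind set)" by (rule finite_subset) simp
qed

abbreviation leftmost :: "cell \<Rightarrow> bool" where "leftmost c \<equiv> fst (snd c)"
abbreviation rightmost :: "cell \<Rightarrow> bool" where "rightmost c \<equiv> snd (snd c)"

locale reduction =
  fixes m :: nat and H V :: "nat \<Rightarrow> nat \<Rightarrow> bool" and A :: "cell \<Rightarrow> nat set" and p U :: "nat poly"
begin

definition block_height :: nat where "block_height = (3 * m + 2) * 8"
definition block_width :: nat where "block_width = (2 * m + 2) * 8"

definition cell_site :: "bool \<Rightarrow> cell \<Rightarrow> nat \<Rightarrow> nat \<Rightarrow> site" where
  "cell_site bottom_row c a b = tile_site (cell_tile m H V (A c) (a div 8) (b div 8))
     (bottom_row \<and> Suc (a div 8) = 3 * m + 2) (rightmost c \<and> Suc (b div 8) = 2 * m + 2) (a mod 8) (b mod 8)"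

definition cell_up_edge :: "bool \<Rightarrow> bool \<Rightarrow> cell \<Rightarrow> nat \<Rightarrow> nat \<Rightarrow> bool" where
  "cell_up_edge top_row bottom_row c a b =
     (if a = 0 then \<not> top_row \<and> b mod 8 = 3 else down_edge (cell_site bottom_row c (a - 1) b))"

definition cell_left_edge :: "bool \<Rightarrow> cell \<Rightarrow> nat \<Rightarrow> nat \<Rightarrow> bool" where
  "cell_left_edge bottom_row c a b =
     (if b = 0 then \<not> leftmost c \<and> a mod 8 = 3 else right_edge (cell_site bottom_row c a (b - 1)))"

lemma block_height_ge: "16 \<le> block_height" and block_width_ge: "16 \<le> block_width"
  by (simp_all add: block_height_def block_width_def)

lemma cell_site_last_row: "down_edge (cell_site False c (block_height - 1) b) \<longleftrightarrow> b mod 8 = 3"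
proof -
  have "block_height - 1 = (3 * m + 1) * 8 + 7" by (simp add: block_height_def)
  then have "(block_height - 1) mod 8 = 7" by presburger
  then show ?thesis
    using tile_down_bounds[of 7] by (auto simp: cell_site_def tile_site_def)
qed

lemma cell_site_last_column:
  assumes "\<not> rightmost c"
  shows "right_edge (cell_site bottom_row c a (block_width - 1)) \<longleftrightarrow> a mod 8 = 3"
proof -
  have "block_width - 1 = (2 * m + 1) * 8 + 7" by (simp add: block_width_def)
  then have "(block_width - 1) mod 8 = 7" by presburger
  then show ?thesis
    using assms tile_right_bounds[of _ 7] by (auto simp: cell_site_def tile_site_def)
qed

end

locale reduction_input = reduction +
  fixes x :: "bool list"
begin

definition slack :: nat where "slack = poly U (length x)"
definition rows :: nat where "rows = slack + 2"
definition cols :: nat where "cols = tableau_width (encode_pair x []) (poly p (length x)) slack"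

definition cell :: "nat \<Rightarrow> nat \<Rightarrow> cell" where
  "cell = tableau_cell (encode_pair x []) (poly p (length x)) slack"

definition pic :: "nat \<Rightarrow> nat \<Rightarrow> site" where
  "pic = tile_picture (rows * (3 * m + 2)) (cols * (2 * m + 2)) (expanded_tile m H V (\<lambda>i j. A (cell i j)))"

lemma cell_flags: "leftmost (cell i j) \<longleftrightarrow> j = 0" "rightmost (cell i j) \<longleftrightarrow> Suc j = cols"
  by (simp_all add: cell_def tableau_cell_def cols_def)

lemma rows_ge: "2 \<le> rows" and cols_pos: "0 < cols"
  by (simp_all add: rows_def cols_def tableau_width_def)

lemma picture_size: "rows * (3 * m + 2) * 8 = rows * block_height" "cols * (2 * m + 2) * 8 = cols * block_width"
  by (simp_all only: block_height_def block_width_def mult.assoc)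

sublocale wide_picture "rows * block_height" "cols * block_width" pic
proof (intro wide_picture.intro wide_picture_axioms.intro)
  show "picture (rows * block_height) (cols * block_width) pic"
    unfolding pic_def picture_size[symmetric]
    by (rule picture_tile_picture) (use rows_ge cols_pos in simp_all)
  show "2 \<le> rows * block_height" "2 \<le> cols * block_width"
    using mult_le_mono[OF rows_ge block_height_ge] mult_le_mono[OF Suc_leI[OF cols_pos] block_width_ge] by linarith+
qed

lemma pic_block:
  assumes "a < block_height" "b < block_width"
  shows "pic (i * block_height + a) (j * block_width + b) = cell_site (Suc i = rows) (cell i j) a b"
proof -
  have a: "a div 8 < 3 * m + 2" and b: "b div 8 < 2 * m + 2"
    using assms unfolding block_height_def block_width_def by (simp_all only: less_mult_imp_div_less)
  have div_mod: "(k * (n * 8) + l) div 8 = k * n + l div 8" "(k * (n * 8) + l) mod 8 = l mod 8" for k n l :: nat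
    by (simp_all only: mult.assoc[symmetric] mod_mult_self3 div_mult_self3)
  show ?thesis
    unfolding pic_def tile_picture_def cell_site_def cell_flags block_height_def block_width_def
    by (simp only: div_mod expanded_tile_block[OF a b] row_major_Suc_eq[OF a] row_major_Suc_eq[OF b])
qed

definition index :: "nat \<Rightarrow> nat \<Rightarrow> nat \<Rightarrow> nat \<Rightarrow> nat" where
  "index i a j b = (i * block_height + a) * (cols * block_width) + (j * block_width + b)"

context
  fixes i a j b
  assumes i: "i < rows" and a: "a < block_height" and j: "j < cols" and b: "b < block_width"
begin

lemma column_less: "j * block_width + b < cols * block_width"
  using j b by (rule row_major_less)

lemma site_at_index: "site_at (index i a j b) = cell_site (Suc i = rows) (cell i j) a b"
  unfolding index_def site_at_row_major[OF column_less] pic_block[OF a b] ..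

lemma index_eq_0: "index i a j b = 0 \<longleftrightarrow> i = 0 \<and> a = 0 \<and> leftmost (cell i j) \<and> b = 0"
  using column_less a b cols_pos by (auto simp: index_def cell_flags)

lemma Suc_index_eq: "Suc (index i a j b) = rows * block_height * (cols * block_width) \<longleftrightarrow>
    Suc i = rows \<and> Suc a = block_height \<and> rightmost (cell i j) \<and> Suc b = block_width"
  unfolding index_def row_major_Suc_eq[OF column_less] row_major_Suc_eq[OF a] row_major_Suc_eq[OF b] cell_flags
  by blast

lemma up_edge_index: "up_edge (index i a j b) \<longleftrightarrow> cell_up_edge (i = 0) (Suc i = rows) (cell i j) a b"
proof (cases a)
  case 0
  have last_row: "block_height - 1 < block_height" using a by simp
  have "Suc i' * block_height + a - 1 = i' * block_height + (block_height - 1)" for i' using 0 last_row by simp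
  then show ?thesis
    unfolding index_def up_edge_row_major[OF column_less]
    using 0 i last_row pic_block[OF last_row b] cell_site_last_row
    by (cases i) (simp_all add: cell_up_edge_def)
next
  case (Suc a')
  then have "i * block_height + a - 1 = i * block_height + a'" "a' < block_height" using a by simp_all
  then show ?thesis
    unfolding index_def up_edge_row_major[OF column_less]
    using Suc pic_block[of a' b i j] b by (simp add: cell_up_edge_def)
qed

lemma left_edge_index: "left_edge (index i a j b) \<longleftrightarrow> cell_left_edge (Suc i = rows) (cell i j) a b"
proof (cases b)
  case 0
  have last_column: "block_width - 1 < block_width" using b by simp
  have "Suc j' * block_width + b - 1 = j' * block_width + (block_width - 1)" for j' using 0 last_column by simp
  then show ?thesis
    unfolding index_def left_edge_row_major[OF column_less]
    using 0 j last_column pic_block[OF a last_column] cell_site_last_column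
    by (cases j) (simp_all add: cell_left_edge_def cell_flags)
next
  case (Suc b')
  then have "j * block_width + b - 1 = j * block_width + b'" "b' < block_width" using b by simp_all
  then show ?thesis
    unfolding index_def left_edge_row_major[OF column_less]
    using Suc pic_block[of a b' i j] a by (simp add: cell_left_edge_def)
qed

end

end

section \<open>Printing the instance\<close>

type_synonym printer = "bool \<Rightarrow> bool \<Rightarrow> cell \<Rightarrow> nat \<Rightarrow> nat \<Rightarrow> cell token list"

primrec mark :: "'c sym \<Rightarrow> 'c" where
  "mark (Mark c) = c"

text \<open>
  Registers: 0 input, 1 output, 2 and 3 the values of \<open>p\<close> and \<open>U\<close> in unary, 4 to 6 the first, the inner
  and the last row of the tableau, 7 and 8 the two lengths of zero runs in a row of the adjacency
  matrix, 9 and 10 the budget in unary and binary, from 11 on copies of the input length.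
\<close>

definition vertex_row_tokens :: "bool \<Rightarrow> bool \<Rightarrow> site \<Rightarrow> bool \<Rightarrow> bool \<Rightarrow> nat \<Rightarrow> cell token list" where
  "vertex_row_tokens first_site last_site x up left s =
     (if first_site \<and> s = 0 then map Lit (map Bit (drop 9 (diagonal_window x left s)))
      else [Lit (Bit (s = 0 \<and> up)), Each 7 (\<lambda>y. [y])] @ map Lit (map Bit
        (if last_site \<and> s = 8 then take 10 (diagonal_window x left s) else diagonal_window x left s))) @
     (if last_site \<and> s = 8 then [] else [Each 7 (\<lambda>y. [y]), Lit (Bit (s = 0 \<and> down_edge x)), Each 8 (\<lambda>y. [y])])"

lemma words_vertex_row_tokens:
  assumes "\<sigma> 7 = replicate near (Bit False)" "\<sigma> 8 = replicate far (Bit False)"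
  shows "words (vertex_row_tokens first_site last_site x up left s) \<sigma> =
    map Bit (vertex_row first_site last_site x up left near far s)"
  unfolding vertex_row_tokens_def vertex_row_def
  by (simp add: assms words_simps del: map_map)

lemma registers_vertex_row_tokens:
  "t \<in> set (vertex_row_tokens first_site last_site x up left s) \<Longrightarrow> token_registers t \<subseteq> {7, 8}"
  unfolding vertex_row_tokens_def by (auto split: if_splits)

context reduction
begin

definition unary_printer :: printer where
  "unary_printer top_row bottom_row c a b = map Lit (map Bit (replicate 9 True))"

definition matrix_printer :: printer where
  "matrix_printer top_row bottom_row c a b = concat (map (vertex_row_tokens
     (top_row \<and> a = 0 \<and> leftmost c \<and> b = 0) (bottom_row \<and> Suc a = block_height \<and> rightmost c \<and> Suc b = block_width)
     (cell_site bottom_row c a b) (cell_up_edge top_row bottom_row c a b) (cell_left_edge bottom_row c a b)) [0..<9])"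

definition color_printer :: printer where
  "color_printer top_row bottom_row c a b = map Lit (map Bit (color_word (cell_site bottom_row c a b)))"

definition budget_printer :: printer where
  "budget_printer top_row bottom_row c a b =
     map Lit (map Bit (if 1 \<le> pendants (cell_site bottom_row c a b) then [True] else []))"

definition row_loop :: "nat \<Rightarrow> printer \<Rightarrow> nat \<Rightarrow> bool \<Rightarrow> bool \<Rightarrow> cell cmd" where
  "row_loop r f i top_row bottom_row =
     seqs (map (\<lambda>a. For i (\<lambda>y. print r (concat (map (f top_row bottom_row (mark y) a) [0..<block_width])))) [0..<block_height])"

definition row_word :: "printer \<Rightarrow> nat \<Rightarrow> bool \<Rightarrow> bool \<Rightarrow> cell store \<Rightarrow> cell sym list" where
  "row_word f i top_row bottom_row \<sigma> = concat (map (\<lambda>a. concat (map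
     (\<lambda>y. words (concat (map (f top_row bottom_row (mark y) a) [0..<block_width])) \<sigma>) (\<sigma> i))) [0..<block_height])"

definition site_loop :: "nat \<Rightarrow> printer \<Rightarrow> cell cmd" where
  "site_loop r f = Seq (row_loop r f 4 True False)
     (Seq (For 3 (\<lambda>_. row_loop r f 5 False False)) (row_loop r f 6 False True))"

definition site_word :: "printer \<Rightarrow> cell store \<Rightarrow> cell sym list" where
  "site_word f \<sigma> = row_word f 4 True False \<sigma> @
     concat (map (\<lambda>_. row_word f 5 False False \<sigma>) (\<sigma> 3)) @ row_word f 6 False True \<sigma>"

lemma generates_row_loop:
  assumes "r \<notin> {i, 7, 8}" "i \<notin> {7, 8}"
    and registers: "\<And>t r l c a b. t \<in> set (f r l c a b) \<Longrightarrow> token_registers t \<subseteq> {7, 8}"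
  shows "generates (row_loop r f i top_row bottom_row) r {i, 7, 8} (row_word f i top_row bottom_row)"
proof -
  let ?tokens = "\<lambda>a y. concat (map (f top_row bottom_row (mark y) a) [0..<block_width])"
  have "generates (print r (?tokens a y)) r {7, 8} (words (?tokens a y))" for a y
  proof (rule generates_print)
    fix t assume "t \<in> set (?tokens a y)"
    then obtain b where "t \<in> set (f top_row bottom_row (mark y) a b)" by auto
    then show "token_registers t \<subseteq> {7, 8}" by (rule registers)
  qed (use assms(1) in simp_all)
  then have "generates (For i (\<lambda>y. print r (?tokens a y))) r {i, 7, 8}
     (\<lambda>\<sigma>. concat (map (\<lambda>y. words (?tokens a y) \<sigma>) (\<sigma> i)))" for a
    by (intro generates_For) (use assms(1,2) in auto)
  then show ?thesis
    unfolding row_loop_def row_word_def[abs_def] by (intro generates_seqs assms(1)) simp_all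
qed

lemma generates_site_loop:
  assumes "r \<notin> {3, 4, 5, 6, 7, 8}"
    and registers: "\<And>t r l c a b. t \<in> set (f r l c a b) \<Longrightarrow> token_registers t \<subseteq> {7, 8}"
  shows "generates (site_loop r f) r {3, 4, 5, 6, 7, 8} (site_word f)"
proof -
  have outer_row: "generates (row_loop r f i top_row bottom_row) r {3, 4, 5, 6, 7, 8}
      (row_word f i top_row bottom_row)" if "i \<in> {4, 6}" for i top_row bottom_row
    by (rule generates_mono[OF generates_row_loop[OF _ _ registers]]) (use assms(1) that in auto)
  have "generates (For 3 (\<lambda>_. row_loop r f 5 False False)) r {3, 5, 7, 8}
      (\<lambda>\<sigma>. concat (map (\<lambda>_. row_word f 5 False False \<sigma>) (\<sigma> 3)))"
    by (rule generates_For[OF _ _ generates_row_loop[OF _ _ registers]]) (use assms(1) in auto)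
  then have inner_rows: "generates (For 3 (\<lambda>_. row_loop r f 5 False False)) r {3, 4, 5, 6, 7, 8}
      (\<lambda>\<sigma>. concat (map (\<lambda>_. row_word f 5 False False \<sigma>) (\<sigma> 3)))"
    by (rule generates_mono) (use assms(1) in auto)
  show ?thesis
    unfolding site_loop_def site_word_def[abs_def] by (intro generates_Seq outer_row inner_rows) simp_all
qed

lemma generates_printer_loops:
  assumes "r \<notin> {3, 4, 5, 6, 7, 8}"
  shows "generates (site_loop r unary_printer) r {3, 4, 5, 6, 7, 8} (site_word unary_printer)"
    and "generates (site_loop r matrix_printer) r {3, 4, 5, 6, 7, 8} (site_word matrix_printer)"
    and "generates (site_loop r color_printer) r {3, 4, 5, 6, 7, 8} (site_word color_printer)"
    and "generates (site_loop r budget_printer) r {3, 4, 5, 6, 7, 8} (site_word budget_printer)"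
  by (rule generates_site_loop[OF assms];
      auto simp: unary_printer_def matrix_printer_def color_printer_def budget_printer_def
        dest: registers_vertex_row_tokens)+

end

context reduction_input
begin

definition inner_cell :: "nat \<Rightarrow> cell" where
  "inner_cell j = (Mid, j = 0, Suc j = cols)"

definition marks :: "(nat \<Rightarrow> cell) \<Rightarrow> cell sym list" where
  "marks f = map (\<lambda>j. Mark (f j)) [0..<cols]"

definition prepared :: "cell store \<Rightarrow> bool" where
  "prepared \<sigma> \<longleftrightarrow> length (\<sigma> 3) = slack \<and>
     \<sigma> 4 = marks (cell 0) \<and> \<sigma> 5 = marks inner_cell \<and> \<sigma> 6 = marks (cell (Suc slack)) \<and>
     \<sigma> 7 = replicate near_gap (Bit False) \<and> \<sigma> 8 = replicate far_gap (Bit False)"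

lemma cell_inner_row: "0 < i \<Longrightarrow> i \<le> slack \<Longrightarrow> cell i = inner_cell"
  by (simp add: cell_def tableau_cell_def tableau_kind_def inner_cell_def cols_def fun_eq_iff)

lemma row_word_index:
  assumes row: "\<sigma> k = marks (cell i)"
    and f: "\<And>a j b. a < block_height \<Longrightarrow> j < cols \<Longrightarrow> b < block_width \<Longrightarrow>
      words (f (i = 0) (Suc i = rows) (cell i j) a b) \<sigma> = F (index i a j b)"
  shows "row_word f k (i = 0) (Suc i = rows) \<sigma> =
    concat (map (\<lambda>a. concat (map (\<lambda>j. concat (map (\<lambda>b. F (index i a j b)) [0..<block_width])) [0..<cols])) [0..<block_height])"
  unfolding row_word_def row marks_def map_map comp_def words_concat mark.simps
  by (intro arg_cong[of _ _ concat] map_cong refl) (simp only: f set_upt atLeastLessThan_iff)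

lemma concat_index:
  "concat (map F [0..<rows * block_height * (cols * block_width)]) = concat (map (\<lambda>i. concat (map (\<lambda>a. concat (map
     (\<lambda>j. concat (map (\<lambda>b. F (index i a j b)) [0..<block_width])) [0..<cols])) [0..<block_height])) [0..<rows])"
  unfolding index_def concat_row_major[of F "rows * block_height" "cols * block_width"]
    concat_row_major[of _ rows block_height] concat_row_major[of _ cols block_width] ..

lemma site_word_eq:
  assumes \<sigma>: "prepared \<sigma>"
    and f: "\<And>i a j b. i < rows \<Longrightarrow> a < block_height \<Longrightarrow> j < cols \<Longrightarrow> b < block_width \<Longrightarrow>
      words (f (i = 0) (Suc i = rows) (cell i j) a b) \<sigma> = map Bit (F (index i a j b))"
  shows "site_word f \<sigma> = map Bit (concat (map F [0..<rows * block_height * (cols * block_width)]))"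
proof -
  define row where "row i = concat (map (\<lambda>a. concat (map (\<lambda>j. concat (map
    (\<lambda>b. map Bit (F (index i a j b)) :: cell sym list) [0..<block_width])) [0..<cols])) [0..<block_height])" for i
  have row_word: "row_word f k (i = 0) (Suc i = rows) \<sigma> = row i"
    if "\<sigma> k = marks (cell i)" "i < rows" for k i
    unfolding row_def
    by (rule row_word_index[of \<sigma> k i f "\<lambda>g. map Bit (F g)"]) (use that f in simp_all)
  have outer_rows: "row_word f 4 True False \<sigma> = row 0" "row_word f 6 False True \<sigma> = row (Suc slack)"
    using row_word[of 4 0] row_word[of 6 "Suc slack"] \<sigma> by (simp_all add: prepared_def rows_def)
  have inner_row: "row_word f 5 False False \<sigma> = row i" if "0 < i" "i \<le> slack" for i
    using row_word[of 5 i] \<sigma> that cell_inner_row[OF that] by (simp add: prepared_def rows_def)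
  have "concat (map (\<lambda>_. row_word f 5 False False \<sigma>) (\<sigma> 3)) =
      concat (map (\<lambda>_. row_word f 5 False False \<sigma>) [1..<Suc slack])"
    using \<sigma> by (simp add: map_replicate_const prepared_def)
  also have "\<dots> = concat (map row [1..<Suc slack])"
    by (intro arg_cong[of _ _ concat] map_cong refl inner_row) auto
  moreover have "[0..<rows] = 0 # [1..<Suc slack] @ [Suc slack]" by (simp add: rows_def upt_conv_Cons)
  ultimately have "site_word f \<sigma> = concat (map row [0..<rows])" by (simp add: site_word_def outer_rows)
  also have "\<dots> = concat (map (\<lambda>g. map Bit (F g)) [0..<rows * block_height * (cols * block_width)])"
    unfolding concat_index row_def ..
  finally show ?thesis by (simp add: map_concat comp_def)
qed

lemma site_word_printers:
  assumes "prepared \<sigma>"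
  shows "site_word unary_printer \<sigma> = map Bit (concat (map (\<lambda>g. replicate 9 True) [0..<rows * block_height * (cols * block_width)]))"
    and "site_word matrix_printer \<sigma> = map Bit (concat (map site_rows [0..<rows * block_height * (cols * block_width)]))"
    and "site_word color_printer \<sigma> =
      map Bit (concat (map (\<lambda>g. color_word (site_at g)) [0..<rows * block_height * (cols * block_width)]))"
    and "site_word budget_printer \<sigma> = map Bit (concat (map
      (\<lambda>g. if 1 \<le> pendants (site_at g) then [True] else []) [0..<rows * block_height * (cols * block_width)]))"
proof -
  show "site_word unary_printer \<sigma> = map Bit (concat (map (\<lambda>g. replicate 9 True) [0..<rows * block_height * (cols * block_width)]))"
    by (rule site_word_eq[OF assms]) (simp only: unary_printer_def words_simps)
  show "site_word color_printer \<sigma> =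
      map Bit (concat (map (\<lambda>g. color_word (site_at g)) [0..<rows * block_height * (cols * block_width)]))"
    by (rule site_word_eq[OF assms]) (simp only: color_printer_def words_simps site_at_index)
  show "site_word budget_printer \<sigma> = map Bit (concat (map
      (\<lambda>g. if 1 \<le> pendants (site_at g) then [True] else []) [0..<rows * block_height * (cols * block_width)]))"
    by (rule site_word_eq[OF assms]) (simp only: budget_printer_def words_simps site_at_index)
  have "\<sigma> 7 = replicate near_gap (Bit False)" "\<sigma> 8 = replicate far_gap (Bit False)"
    using assms by (simp_all add: prepared_def)
  note vertex_rows = words_vertex_row_tokens[of \<sigma>, OF this]
  show "site_word matrix_printer \<sigma> = map Bit (concat (map site_rows [0..<rows * block_height * (cols * block_width)]))"
  proof (rule site_word_eq[OF assms])
    fix i a j b assume ij: "i < rows" "a < block_height" "j < cols" "b < block_width"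
    show "words (matrix_printer (i = 0) (Suc i = rows) (cell i j) a b) \<sigma> = map Bit (site_rows (index i a j b))"
      unfolding matrix_printer_def site_rows_def words_concat map_map comp_def vertex_rows map_concat
        index_eq_0[OF ij] Suc_index_eq[OF ij] site_at_index[OF ij] up_edge_index[OF ij] left_edge_index[OF ij] ..
  qed
qed

end

section \<open>The program of the reduction\<close>

abbreviation plain :: "cell_kind \<Rightarrow> cell sym" where
  "plain k \<equiv> Mark (k, False, False)"

primrec input_mark :: "cell sym \<Rightarrow> cell sym" where
  "input_mark (Bit b) = plain (bit_cell b)"

definition input_row :: "cell token list" where
  "input_row = [Lit (Mark (Blank, True, False)), Each 3 (\<lambda>_. [plain Blank]), Lit (plain Pre),
     Each 0 (\<lambda>y. [input_mark y, input_mark y]), Lit (plain Zero), Lit (plain One),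
     Each 2 (\<lambda>_. [plain Wild]), Each 3 (\<lambda>_. [plain Blank]), Lit (Mark (Blank, False, True))]"

definition inner_row :: "cell token list" where
  "inner_row = [Each 4 (\<lambda>y. [Mark (Mid, snd (mark y))])]"

definition final_row :: "cell token list" where
  "final_row = [Lit (Mark (Mid, True, False)), Each 3 (\<lambda>_. [plain Mid]),
     Lit (plain Mid), Lit (plain Acc_One), Lit (plain Acc_Blank),
     Each 0 (\<lambda>_. [plain Mid, plain Mid]), Each 2 (\<lambda>_. [plain Mid]), Each 3 (\<lambda>_. [plain Mid]),
     Lit (Mark (Mid, False, True))]"

definition zeros :: "nat \<Rightarrow> 'c sym list" where
  "zeros k = replicate k (Bit False)"

lemma concat_zeros: "concat (map (\<lambda>_. zeros k) xs) = zeros (length xs * k)"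
  by (induction xs) (simp_all add: zeros_def replicate_add)

lemma zeros_append: "zeros k @ zeros l = zeros (k + l)"
  by (simp add: zeros_def replicate_add)

lemma input_row_kinds:
  "map (tableau_kind e n u 0) [0..<tableau_width e n u] =
    replicate (Suc u) Blank @ [Pre] @ map bit_cell e @ replicate n Wild @ replicate (Suc u) Blank"
proof -
  let ?kind = "tableau_kind e n u 0"
  have "tableau_width e n u = Suc u + (1 + (length e + (n + Suc u)))" by (simp add: tableau_width_def)
  moreover have "map ?kind [0..<Suc u] = replicate (Suc u) Blank"
    "map (\<lambda>k. ?kind (Suc u + k)) [0..<1] = [Pre]"
    "map (\<lambda>k. ?kind (Suc u + (1 + k))) [0..<length e] = map bit_cell e"
    "map (\<lambda>k. ?kind (Suc u + (1 + (length e + k)))) [0..<n] = replicate n Wild"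
    "map (\<lambda>k. ?kind (Suc u + (1 + (length e + (n + k))))) [0..<Suc u] = replicate (Suc u) Blank"
    by (auto intro!: nth_equalityI simp: tableau_kind_def simp del: upt_Suc replicate_Suc)
  ultimately show ?thesis by (simp only: map_upt_add)
qed

lemma final_row_kinds:
  assumes "length e = k + 2"
  shows "map (tableau_kind e n u (Suc u)) [0..<tableau_width e n u] =
    replicate (u + 2) Mid @ [Acc_One, Acc_Blank] @ replicate (k + (n + Suc u)) Mid"
proof -
  let ?kind = "tableau_kind e n u (Suc u)"
  have "tableau_width e n u = u + 2 + (2 + (k + (n + Suc u)))" using assms by (simp add: tableau_width_def)
  moreover have "map ?kind [0..<u + 2] = replicate (u + 2) Mid"
    "map (\<lambda>k. ?kind (u + 2 + (2 + k))) [0..<l] = replicate l Mid" for l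
    by (auto intro!: nth_equalityI simp: tableau_kind_def simp del: upt_Suc replicate_Suc)
  moreover have "map (\<lambda>k. ?kind (u + 2 + k)) [0..<2] = [Acc_One, Acc_Blank]"
    by (simp add: numeral_2_eq_2 tableau_kind_def)
  ultimately show ?thesis by (simp only: map_upt_add)
qed

context reduction
begin

definition lengths_cmd :: "cell cmd" where
  "lengths_cmd = Seq (copies 11 (degree p + degree U)) (Seq (unary_poly 11 2 p) (unary_poly 11 3 U))"

definition rows_cmd :: "cell cmd" where
  "rows_cmd = Seq (print 4 input_row) (Seq (print 5 inner_row) (print 6 final_row))"

definition near_gap_tokens :: "cell token list" where
  "near_gap_tokens = [Each 5 (\<lambda>y. zeros (if leftmost (mark y) then 9 * block_width - 10 else 9 * block_width))]"

definition far_gap_cmd :: "cell cmd" where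
  "far_gap_cmd = Seq (print 8 [Each 5 (\<lambda>_. zeros (9 * block_width * (2 * block_height - 2)))])
     (For 3 (\<lambda>_. print 8 [Each 5 (\<lambda>_. zeros (9 * block_width * block_height))]))"

definition gaps_cmd :: "cell cmd" where
  "gaps_cmd = Seq (print 7 near_gap_tokens) far_gap_cmd"

definition graph_cmd :: "cell cmd" where
  "graph_cmd = Seq (site_loop 1 unary_printer) (Seq (print 1 [Lit (Bit False)])
     (Seq (site_loop 1 matrix_printer) (site_loop 1 color_printer)))"

definition budget_cmd :: "cell cmd" where
  "budget_cmd = Seq (site_loop 9 budget_printer) (Seq (count 9 10) (print 1 [Each 10 (\<lambda>y. [y])]))"

definition program :: "cell cmd" where
  "program = Seq (Seq lengths_cmd (Seq rows_cmd gaps_cmd)) (Seq graph_cmd budget_cmd)"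

lemma generates_lengths:
  "generates (unary_poly 11 2 p :: cell cmd) 2 {11..<11 + (degree p + degree U)}
     (\<lambda>\<sigma>. replicate (\<Sum>i\<le>degree p. coeff p i * (\<Prod>j<i. length (\<sigma> (11 + j)))) (Bit True))"
  "generates (unary_poly 11 3 U :: cell cmd) 3 {11..<11 + (degree p + degree U)}
     (\<lambda>\<sigma>. replicate (\<Sum>i\<le>degree U. coeff U i * (\<Prod>j<i. length (\<sigma> (11 + j)))) (Bit True))"
  by (rule generates_unary_poly; simp)+

lemma generates_rows:
  "generates (print 4 input_row) 4 {0, 2, 3} (words input_row)"
  "generates (print 5 inner_row) 5 {4} (words inner_row)"
  "generates (print 6 final_row) 6 {0, 2, 3} (words final_row)"
  by (rule generates_print; force simp: input_row_def inner_row_def final_row_def)+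

lemma generates_near_gap: "generates (print 7 near_gap_tokens) 7 {5} (words near_gap_tokens)"
  by (rule generates_print) (simp_all add: near_gap_tokens_def)

lemma generates_far_gap:
  "generates far_gap_cmd 8 {3, 5} (\<lambda>\<sigma>. words [Each 5 (\<lambda>_. zeros (9 * block_width * (2 * block_height - 2)))] \<sigma> @
     concat (map (\<lambda>_. words [Each 5 (\<lambda>_. zeros (9 * block_width * block_height))] \<sigma>) (\<sigma> 3)))"
proof -
  have zeros: "generates (print 8 [Each 5 (\<lambda>_. zeros k)] :: cell cmd) 8 I (words [Each 5 (\<lambda>_. zeros k)])"
    if "I \<in> {{3, 5}, {5}}" for I k
    by (rule generates_print) (use that in auto)
  show ?thesis
    unfolding far_gap_cmd_def by (intro generates_Seq generates_For zeros) auto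
qed

lemma generates_graph:
  "generates graph_cmd 1 {3, 4, 5, 6, 7, 8} (\<lambda>\<sigma>. site_word unary_printer \<sigma> @ words [Lit (Bit False)] \<sigma> @
     site_word matrix_printer \<sigma> @ site_word color_printer \<sigma>)"
  unfolding graph_cmd_def
  by (intro generates_Seq generates_printer_loops generates_print) simp_all

lemma generates_output_budget: "generates (print 1 [Each 10 (\<lambda>y. [y])] :: cell cmd) 1 {10} (words [Each 10 (\<lambda>y. [y])])"
  by (rule generates_print) simp_all

lemma polytime_program: "polytime program"
proof -
  have "polytime lengths_cmd"
    unfolding lengths_cmd_def
    by (intro polytime_Seq polytime_copies generates_lengths[THEN generates_polytime]) simp
  moreover have "polytime rows_cmd"
    unfolding rows_cmd_def by (intro polytime_Seq generates_rows[THEN generates_polytime])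
  moreover have "polytime gaps_cmd"
    unfolding gaps_cmd_def
    by (intro polytime_Seq generates_near_gap[THEN generates_polytime] generates_far_gap[THEN generates_polytime])
  moreover have "polytime budget_cmd"
    unfolding budget_cmd_def
    by (intro polytime_Seq polytime_count generates_output_budget[THEN generates_polytime]
        generates_printer_loops(4)[THEN generates_polytime]) simp_all
  ultimately show ?thesis
    unfolding program_def by (intro polytime_Seq generates_graph[THEN generates_polytime])
qed

end

context reduction_input
begin

lemma exec_lengths:
  defines "\<sigma> \<equiv> exec lengths_cmd (init_store x)"
  shows "\<sigma> 0 = map Bit x" "length (\<sigma> 2) = poly p (length x)" "length (\<sigma> 3) = slack"
    and "\<And>i. i \<in> {1, 4, 5, 6, 7, 8, 9, 10} \<Longrightarrow> \<sigma> i = []"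
proof -
  define k where "k = degree p + degree U"
  define \<tau> :: "cell store" where "\<tau> = exec (copies 11 k) (init_store x)"
  have \<tau>: "\<tau> 0 = map Bit x" "\<And>i. 0 < i \<Longrightarrow> i < 11 \<Longrightarrow> \<tau> i = []"
    "\<And>j. j < k \<Longrightarrow> length (\<tau> (11 + j)) = length x"
    unfolding \<tau>_def by (simp_all add: exec_copies init_store_def)
  have poly_p: "exec (unary_poly 11 2 p) \<tau> = \<tau>(2 := replicate (poly p (length x)) (Bit True))"
    unfolding generates_exec[OF generates_lengths(1)]
    using \<tau> by (subst unary_poly_value[of p k]) (simp_all add: k_def)
  have poly_U: "exec (unary_poly 11 3 U) (\<tau>(2 := ys)) = \<tau>(2 := ys, 3 := replicate slack (Bit True))" for ys
    unfolding generates_exec[OF generates_lengths(2)]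
    using \<tau> by (subst unary_poly_value[of U k]) (simp_all add: k_def slack_def)
  have "\<sigma> = \<tau>(2 := replicate (poly p (length x)) (Bit True), 3 := replicate slack (Bit True))"
    unfolding \<sigma>_def lengths_cmd_def by (simp only: exec.simps k_def[symmetric] \<tau>_def[symmetric] poly_p poly_U)
  then show "\<sigma> 0 = map Bit x" "length (\<sigma> 2) = poly p (length x)" "length (\<sigma> 3) = slack"
    "\<And>i. i \<in> {1, 4, 5, 6, 7, 8, 9, 10} \<Longrightarrow> \<sigma> i = []"
    using \<tau> by auto
qed

lemma marks_eq:
  assumes kinds: "map (\<lambda>j. fst (f j)) [0..<cols] = k # ks @ [k']"
    and flags: "\<And>j. snd (f j) = (j = 0, Suc j = cols)"
  shows "marks f = Mark (k, True, False) # map plain ks @ [Mark (k', False, True)]"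
proof -
  define n where "n = length ks"
  have cols: "cols = Suc (Suc n)" using arg_cong[OF kinds, of length] by (simp add: n_def)
  have upt: "[0..<cols] = 0 # map Suc [0..<n] @ [Suc n]" unfolding cols by (rule upt_Suc_Suc)
  have "k = fst (f 0)" "ks = map (\<lambda>j. fst (f (Suc j))) [0..<n]" "k' = fst (f (Suc n))"
    using kinds n_def unfolding upt by (simp_all add: comp_def)
  moreover have "f j = (fst (f j), j = 0, Suc j = cols)" for j
    using flags[of j] by (simp add: prod_eq_iff)
  then have "marks f = map (\<lambda>j. Mark (fst (f j), j = 0, Suc j = cols)) [0..<cols]"
    unfolding marks_def by metis
  ultimately show ?thesis unfolding upt by (simp add: cols comp_def)
qed

lemma words_input_row:
  assumes "\<sigma> 0 = map Bit x" "length (\<sigma> 2) = poly p (length x)" "length (\<sigma> 3) = slack"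
  shows "words input_row \<sigma> = marks (cell 0)"
proof -
  let ?e = "encode_pair x []"
  have pairs: "concat (map (\<lambda>y. [input_mark y, input_mark y]) (map Bit x)) @ [plain Zero, plain One] =
      map plain (map bit_cell ?e)"
    unfolding encode_pair_def by (induction x) (simp_all add: bit_cell_def)
  have "marks (cell 0) = Mark (Blank, True, False) # map plain (replicate slack Blank @ [Pre] @ map bit_cell ?e @
      replicate (poly p (length x)) Wild @ replicate slack Blank) @ [Mark (Blank, False, True)]"
    by (rule marks_eq) (simp_all add: cell_def tableau_cell_def cols_def input_row_kinds replicate_append_same)
  then show ?thesis
    using assms unfolding input_row_def map_append pairs[symmetric]
    by (simp add: words_simps map_replicate_const)
qed

lemma words_final_row:
  assumes "\<sigma> 0 = map Bit x" "length (\<sigma> 2) = poly p (length x)" "length (\<sigma> 3) = slack"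
  shows "words final_row \<sigma> = marks (cell (Suc slack))"
proof -
  have pairs: "concat (replicate k [plain Mid, plain Mid]) = replicate (2 * k) (plain Mid)" for k
    by (induction k) simp_all
  have "marks (cell (Suc slack)) = Mark (Mid, True, False) # map plain (replicate slack Mid @
      [Mid, Acc_One, Acc_Blank] @ replicate (2 * length x) Mid @ replicate (poly p (length x)) Mid @
      replicate slack Mid) @ [Mark (Mid, False, True)]"
    by (rule marks_eq)
      (simp_all add: cell_def tableau_cell_def cols_def final_row_kinds length_encode_pair replicate_add
        replicate_append_same)
  then show ?thesis
    using assms unfolding final_row_def by (simp add: words_simps map_replicate_const pairs)
qed

lemma exec_rows:
  assumes \<sigma>: "\<sigma> 0 = map Bit x" "length (\<sigma> 2) = poly p (length x)" "length (\<sigma> 3) = slack"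
    and "\<sigma> 4 = []" "\<sigma> 5 = []" "\<sigma> 6 = []"
  shows "exec rows_cmd \<sigma> = \<sigma>(4 := marks (cell 0), 5 := marks inner_cell, 6 := marks (cell (Suc slack)))"
proof -
  have "words inner_row \<tau> = marks inner_cell" if "\<tau> 4 = marks (cell 0)" for \<tau>
    using that by (simp add: inner_row_def words_simps marks_def comp_def inner_cell_def prod_eq_iff cell_flags)
  then show ?thesis
    unfolding rows_cmd_def exec.simps generates_rows[THEN generates_exec]
    using assms by (simp add: words_input_row words_final_row fun_upd_def)
qed

lemma words_near_gap:
  assumes "\<sigma> 5 = marks inner_cell"
  shows "words near_gap_tokens \<sigma> = zeros near_gap"
proof -
  obtain k where k: "cols = Suc k" using cols_pos by (cases cols) auto
  have upt: "[0..<cols] = 0 # map Suc [0..<k]" by (simp add: k upt_conv_Cons map_Suc_upt)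
  have "near_gap = 9 * block_width - 10 + k * (9 * block_width)"
    using block_width_ge unfolding near_gap_def unfolding k by (simp add: algebra_simps)
  then show ?thesis
    by (simp add: near_gap_tokens_def words_simps assms marks_def upt comp_def inner_cell_def
      concat_zeros zeros_append)
qed

lemma far_gap_eq: "far_gap = cols * (9 * block_width * (2 * block_height - 2)) + slack * (cols * (9 * block_width * block_height))"
proof -
  obtain k where k: "block_height = Suc k" using block_height_ge by (cases block_height) auto
  then have "2 * block_height - 2 = 2 * k" by simp
  then show ?thesis unfolding far_gap_def unfolding rows_def k by (simp add: algebra_simps)
qed

lemma exec_gaps:
  assumes "length (\<sigma> 3) = slack" "\<sigma> 5 = marks inner_cell" "\<sigma> 7 = []" "\<sigma> 8 = []"
  shows "exec gaps_cmd \<sigma> = \<sigma>(7 := zeros near_gap, 8 := zeros far_gap)"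
proof -
  have zeros: "words [Each 5 (\<lambda>_. zeros k)] \<tau> = zeros (cols * k)" if "\<tau> 5 = marks inner_cell" for k \<tau>
    using that by (simp add: words_simps marks_def concat_zeros)
  show ?thesis
    unfolding gaps_cmd_def exec.simps generates_exec[OF generates_near_gap] generates_exec[OF generates_far_gap]
    using assms by (simp add: words_near_gap zeros concat_zeros zeros_append far_gap_eq)
qed

lemma exec_prepare:
  defines "\<sigma> \<equiv> exec (Seq lengths_cmd (Seq rows_cmd gaps_cmd)) (init_store x)"
  shows "prepared \<sigma>" "\<sigma> 1 = []" "\<sigma> 9 = []" "\<sigma> 10 = []"
proof -
  define \<tau> where "\<tau> = exec lengths_cmd (init_store x)"
  note \<tau> = exec_lengths[folded \<tau>_def]
  have "\<sigma> = \<tau>(4 := marks (cell 0), 5 := marks inner_cell, 6 := marks (cell (Suc slack)),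
      7 := zeros near_gap, 8 := zeros far_gap)"
    unfolding \<sigma>_def exec.simps \<tau>_def[symmetric] using \<tau> by (simp add: exec_rows exec_gaps)
  then show "prepared \<sigma>" "\<sigma> 1 = []" "\<sigma> 9 = []" "\<sigma> 10 = []"
    using \<tau> by (simp_all add: prepared_def zeros_def)
qed

definition instance_word :: "bool list" where
  "instance_word = encode_instance graph given_coloring budget"

lemma exec_budget:
  assumes "prepared \<sigma>" "\<sigma> 9 = []" "\<sigma> 10 = []"
  shows "exec budget_cmd \<sigma> 1 = \<sigma> 1 @ map Bit (binary_word budget)"
proof -
  let ?ones = "site_word budget_printer \<sigma>"
  have "length (concat (map (\<lambda>g. if P g then [True] else []) [0..<k])) = card {g. g < k \<and> P g}" for P k
  proof (induction k)
    case (Suc k)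
    have "{g. g < Suc k \<and> P g} = (if P k then insert k {g. g < k \<and> P g} else {g. g < k \<and> P g})"
      by (auto simp: less_Suc_eq)
    then show ?case using Suc by simp
  qed simp
  then have "length ?ones = budget" unfolding site_word_printers(4)[OF assms(1)] budget_def by simp
  moreover have "exec (site_loop 9 budget_printer) \<sigma> = \<sigma>(9 := ?ones)"
    using generates_exec[OF generates_printer_loops(4)[of 9], of \<sigma>] assms(2) by simp
  ultimately have "exec (count 9 10) (exec (site_loop 9 budget_printer) \<sigma>) =
      \<sigma>(9 := ?ones, 10 := map Bit (binary_word budget))"
    using exec_count[of 9 10 "\<sigma>(9 := ?ones)"] assms(3) by simp
  then show ?thesis
    unfolding budget_cmd_def exec.simps generates_exec[OF generates_output_budget]
    by (simp add: words_simps comp_def)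
qed

lemma exec_program: "exec program (init_store x) 1 = map Bit instance_word"
proof -
  define \<sigma> where "\<sigma> = exec (Seq lengths_cmd (Seq rows_cmd gaps_cmd)) (init_store x)"
  note \<sigma> = exec_prepare[folded \<sigma>_def]
  have "prepared (\<sigma>(1 := ys))" for ys using \<sigma>(1) by (simp add: prepared_def)
  then have "exec budget_cmd (exec graph_cmd \<sigma>) 1 = exec graph_cmd \<sigma> 1 @ map Bit (binary_word budget)"
    using \<sigma> by (intro exec_budget) (simp_all add: generates_exec[OF generates_graph])
  also have "\<dots> = map Bit instance_word"
    unfolding generates_exec[OF generates_graph] instance_word_def encode_instance_graph
    using \<sigma> by (simp add: site_word_printers words_simps del: map_concat)
  finally show ?thesis unfolding program_def \<sigma>_def exec.simps .
qed

lemma budget_pos: "0 < budget"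
proof -
  have "tile_constraint k 3 0 = (3, 2)" for k by (rule tile_constraint_site) (rule port_sites)
  moreover have block: "3 < block_height" "0 < block_width" using block_height_ge block_width_ge by linarith+
  ultimately have "pendants (site_at (index 0 3 0 0)) = 2"
    using site_at_index[of 0 3 0 0] rows_ge cols_pos by (simp add: cell_site_def tile_site_def)
  moreover have "index 0 3 0 0 < rows * block_height * (cols * block_width)"
    unfolding index_def
    by (intro row_major_less) (use block rows_ge cols_pos row_major_less[of 0 rows 3 block_height] in simp_all)
  ultimately have "index 0 3 0 0 \<in> {g. g < rows * block_height * (cols * block_width) \<and> 1 \<le> pendants (site_at g)}" by simp
  then show ?thesis unfolding budget_def by (subst card_gt_0_iff) auto
qed

theorem instance_word_correct:
  assumes "x \<in> L \<longleftrightarrow> (\<exists>s. label_tiling {..<m} H V rows cols (\<lambda>i j. A (cell i j)) s)"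
  shows "(x \<in> L \<longrightarrow> instance_word \<in> yes_instances (Fix_Promise 3 {G. planar G})) \<and>
    (x \<notin> L \<longrightarrow> instance_word \<in> no_instances (Fix_Promise 3 {G. planar G}))"
proof -
  have "x \<in> L \<longleftrightarrow> (\<exists>f. list_coloring (rows * block_height) (cols * block_width) pic f)"
    unfolding assms boolean_tiling_iff_label_tiling[symmetric] list_coloring_iff_boolean_tiling[symmetric]
      picture_size pic_def ..
  then have L: "x \<in> L \<longleftrightarrow> fixable graph 3 given_coloring budget" unfolding fixable_graph_iff .
  have "fix_instance 3 graph given_coloring budget"
    unfolding fix_instance_def using pair_graph_graph given_coloring_colorings pverts_graph budget_pos by blast
  then show ?thesis
    unfolding L instance_word_def Fix_Promise_def using planar_graph fix_promise_graph by auto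
qed

end

lemma (in reduction) polytime_computable_instance_word:
  "polytime_computable (reduction_input.instance_word m H V A p U)"
  using polytime_program reduction_input.exec_program by (rule polytime_computable_program)

theorem theorem6:
  shows "NP_hard (Fix_Promise 3 {G. planar G})"
  unfolding NP_hard_def
proof
  fix L assume "L \<in> NP"
  then obtain m :: nat and H V A and p U :: "nat poly" where L:
    "\<And>x. x \<in> L \<longleftrightarrow> (\<exists>s. label_tiling {..<m} H V (poly U (length x) + 2)
       (tableau_width (encode_pair x []) (poly p (length x)) (poly U (length x)))
       (\<lambda>i j. A (tableau_cell (encode_pair x []) (poly p (length x)) (poly U (length x)) i j)) s)"
    by (rule NP_label_tiling) blast
  let ?f = "reduction_input.instance_word m H V A p U"
  have "(x \<in> L \<longrightarrow> ?f x \<in> yes_instances (Fix_Promise 3 {G. planar G})) \<and>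
      (x \<notin> L \<longrightarrow> ?f x \<in> no_instances (Fix_Promise 3 {G. planar G}))" for x
    by (rule reduction_input.instance_word_correct)
      (simp only: L reduction_input.rows_def reduction_input.cols_def reduction_input.cell_def
        reduction_input.slack_def)
  then show "\<exists>f. polytime_computable f \<and>
      (\<forall>x. (x \<in> L \<longrightarrow> f x \<in> yes_instances (Fix_Promise 3 {G. planar G})) \<and>
        (x \<notin> L \<longrightarrow> f x \<in> no_instances (Fix_Promise 3 {G. planar G})))"
    using reduction.polytime_computable_instance_word by blast
qed

end
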